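(* Let $p$ be a fixed prime and $\mathbb{F}=\mathbb{F}_p$. There is a constant $C$ depending only on $p$ such that the following holds. Let $A \subset \mathbb{F}^n \times \mathbb{F}^n$ have density $\alpha = |A|/|\mathbb{F}|^{2n}$, and let $w = \mathrm{h}\mathrm{v}\mathrm{v}\mathrm{h}\mathrm{v}\mathrm{v}\mathrm{v}\mathrm{h}\mathrm{h}$. Then there exists a bilinear variety $B \subset \phi_w(A)$ of codimension $r \le C\log^{80}\alpha^{-1}$ (i.e. $r = O(\log^{80}\alpha^{-1})$).
   Context: For $A \subset \mathbb{F}^n\times\mathbb{F}^n$ define $\phi_{\mathrm{h}}(A) = \{(x_1-x_2,y) : (x_1,y),(x_2,y)\in A\}$ and $\phi_{\mathrm{v}}(A) = \{(x,y_1-y_2) : (x,y_1),(x,y_2)\in A\}$. For a word $w = w_1w_2\cdots w_k \in \{\mathrm{h},\mathrm{v}\}^k$, $\phi_w = \phi_{w_1}\circ\phi_{w_2}\circ\cdots\circ\phi_{w_k}$ (so $\phi_{w_k}$ is applied first). A bilinear variety of codimension $r = r_1+r_2+r_3$ is a set $B = \{(x,y)\in V\times W : b_1(x,y)=\cdots=b_{r_3}(x,y)=0\}$ where $V,W\subset\mathbb{F}^n$ are subspaces of codimension $r_1,r_2$ respectively and $b_1,\dots,b_{r_3}:\mathbb{F}^n\times\mathbb{F}^n\to\mathbb{F}$ are bilinear forms. *)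

theory Defs
  imports Complex_Main "Berlekamp_Zassenhaus.Finite_Field" "Jordan_Normal_Form.VS_Connect"
begin

text \<open>
  The space $F^n$ is rendered as \<^term>\<open>carrier_vec n\<close>, so that the dimension can be quantified
  inside a formula. The field with $p$ elements is the type \<open>'p mod_ring\<close> for a type \<open>'p\<close> of prime
  cardinality $p$.
\<close>

definition phi_h :: "('a :: field vec \<times> 'a vec) set \<Rightarrow> ('a vec \<times> 'a vec) set" where
  "phi_h A = {(x1 - x2, y) | x1 x2 y. (x1, y) \<in> A \<and> (x2, y) \<in> A}"

definition phi_v :: "('a :: field vec \<times> 'a vec) set \<Rightarrow> ('a vec \<times> 'a vec) set" where
  "phi_v A = {(x, y1 - y2) | x y1 y2. (x, y1) \<in> A \<and> (x, y2) \<in> A}"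

datatype direction = Hor | Ver

fun phi_dir :: "direction \<Rightarrow> ('a :: field vec \<times> 'a vec) set \<Rightarrow> ('a vec \<times> 'a vec) set" where
  "phi_dir Hor = phi_h"
| "phi_dir Ver = phi_v"

text \<open>The last letter of the word is applied first.\<close>

fun phi_word :: "direction list \<Rightarrow> ('a :: field vec \<times> 'a vec) set \<Rightarrow> ('a vec \<times> 'a vec) set" where
  "phi_word [] = id"
| "phi_word (d # w) = phi_dir d \<circ> phi_word w"

text \<open>
  The codimension is an explicit argument, constrained by an addition rather than computed by
  truncated subtraction.
\<close>

definition subspace_of_codim :: "nat \<Rightarrow> nat \<Rightarrow> 'a :: field vec set \<Rightarrow> bool" where
  "subspace_of_codim n r U \<longleftrightarrow>
     VectorSpace.subspace class_ring U (module_vec TYPE('a) n) \<and>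
     vectorspace.dim class_ring ((module_vec TYPE('a) n)\<lparr>carrier := U\<rparr>) + r = n"

definition bilinear_form :: "nat \<Rightarrow> ('a :: field vec \<Rightarrow> 'a vec \<Rightarrow> 'a) \<Rightarrow> bool" where
  "bilinear_form n b \<longleftrightarrow>
     (\<forall>x\<^sub>1 \<in> carrier_vec n. \<forall>x\<^sub>2 \<in> carrier_vec n. \<forall>y \<in> carrier_vec n.
        b (x\<^sub>1 + x\<^sub>2) y = b x\<^sub>1 y + b x\<^sub>2 y) \<and>
     (\<forall>x \<in> carrier_vec n. \<forall>y\<^sub>1 \<in> carrier_vec n. \<forall>y\<^sub>2 \<in> carrier_vec n.
        b x (y\<^sub>1 + y\<^sub>2) = b x y\<^sub>1 + b x y\<^sub>2) \<and>
     (\<forall>c. \<forall>x \<in> carrier_vec n. \<forall>y \<in> carrier_vec n.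
        b (c \<cdot>\<^sub>v x) y = c * b x y \<and> b x (c \<cdot>\<^sub>v y) = c * b x y)"

text \<open>
  The forms need not be independent, so one set can be a bilinear variety of several codimensions;
  the codimension belongs to the presentation.
\<close>

definition bilinear_variety :: "nat \<Rightarrow> nat \<Rightarrow> ('a :: field vec \<times> 'a vec) set \<Rightarrow> bool" where
  "bilinear_variety n r B \<longleftrightarrow>
     (\<exists>r\<^sub>1 r\<^sub>2 r\<^sub>3 U W b.
        r = r\<^sub>1 + r\<^sub>2 + r\<^sub>3 \<and>
        subspace_of_codim n r\<^sub>1 U \<and> subspace_of_codim n r\<^sub>2 W \<and>
        (\<forall>i < r\<^sub>3. bilinear_form n (b i)) \<and>
        B = {(x, y). x \<in> U \<and> y \<in> W \<and> (\<forall>i < r\<^sub>3. b i x y = 0)})"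

definition density :: "nat \<Rightarrow> ('a :: {field, finite} vec \<times> 'a vec) set \<Rightarrow> real" where
  "density n A = real (card A) / real (CARD('a)) ^ (2 * n)"

end

theory Submission
  imports Defs "HOL-Library.Set_Algebras" "HOL-Library.Function_Algebras" "HOL-Library.Product_Plus" "HOL-Library.FuncSet"
begin

text \<open>
  The proof is the one of Hosseini and Lovett. Sanders' form of the Bogolyubov-Ruzsa lemma puts into
  \<open>hh A\<close>, for a dense set of rows \<open>y\<close>, a subspace \<open>V y\<close> of codimension \<open>d = O(log^4 (1/\<alpha>))\<close>. Two
  vertical differences and a horizontal one turn the row at \<open>y1 - y2 = y3 - y4\<close> into
  \<open>(V y1 \<inter> V y2) + (V y3 \<inter> V y4)\<close>. By the Balog-Szemeredi-Gowers theorem, any part of the graph of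
  annihilators with large additive energy has a large intersection with the graph of an affine map.
  Removing such graphs greedily shows that, for a set of rows of density \<open>p^(-O(d^5))\<close>, the
  annihilator of the new row is spanned by the values of \<open>O(d)\<close> affine maps; enlarging the space of
  constants, one may assume that all nontrivial combinations of their linear parts have large rank.
  Sanders' lemma, applied to that set of rows, yields a space \<open>W\<close> of codimension \<open>O((d^5)^4)\<close>, which
  is the source of the exponent \<open>80\<close>, such that each \<open>w \<in> W\<close> has many representations
  \<open>w = y1 + y2 - y3 - y4\<close>. Because of the large ranks, the annihilators belonging to two generic
  representations of \<open>w\<close> meet only in the values of the maps at \<open>w\<close>, and a last horizontal difference
  leaves only these bilinear conditions.
\<close>

text \<open>The obstacle is that \<open>V y\<close> depends on the row in no controlled way, so
  linearity in \<open>y\<close> must come from additive quadruples. An element annihilating both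
  \<open>V y1 \<inter> V y2\<close> and \<open>V y3 \<inter> V y4\<close> has the forms
  \<open>u1 - u2\<close> and \<open>u3 - u4\<close>, each \<open>ui\<close> annihilating
  \<open>V yi\<close>; if \<open>y1 - y2 = y3 - y4\<close>, the points \<open>(yi, ui)\<close> form
  an additive quadruple in the graph of annihilators. This is where energy enters. Densities are
  bounded below by integral powers \<open>p ^ (- a)\<close>, which keeps the bookkeeping in natural
  numbers. The first use of Sanders' theorem gives \<open>d = O(a ^ 4)\<close>. The energy argument
  uses it once more, so \<open>p ^ O(d ^ 4)\<close> affine maps are removed. A row selects
  \<open>2 * d\<close> maps, and making all rows agree on the selection costs
  \<open>p ^ O(d ^ 5) = p ^ O(a ^ 20)\<close>; the last use of Sanders' theorem turns 20 into 80.
  The ranks required are only \<open>O(a ^ 20)\<close> for at most \<open>2 * d\<close> maps, so the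
  space of constants has dimension \<open>O(a ^ 24)\<close>, well below that.\<close>

section \<open>Sumset inequalities of Petridis, Pluennecke and Ruzsa\<close>

lemma card_set_plus_singleton:
  fixes A :: "'a::ab_group_add set"
  shows "card (A + {c}) = card A"
proof -
  have "A + {c} = (\<lambda>a. a + c) ` A"
    by (auto simp: set_plus_def)
  then show ?thesis
    by (simp add: card_image inj_on_def)
qed

text \<open>Petridis' induction on \<open>C\<close>. A new element \<open>c\<close> contributes only
  those translates of \<open>X + B\<close> that are not yet covered. The \<open>x\<close> whose
  whole translate \<open>x + c + B\<close> is covered form \<open>X'\<close>, and minimality of the
  ratio bounds \<open>X' + B\<close> from below.\<close>

lemma petridis:
  fixes X B C :: "'a::ab_group_add set"
  assumes fin: "finite X" "finite B" "finite C"
    and minX: "\<And>Y. Y \<subseteq> X \<Longrightarrow> card (X + B) * card Y \<le> card (Y + B) * card X"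
  shows "card (X + B + C) * card X \<le> card (X + B) * card (X + C)"
  using fin(3)
proof (induction C rule: finite_induct)
  case empty
  then show ?case by (simp add: set_plus_def)
next
  case (insert c C)
  define X' where "X' = {x \<in> X. {x + c} + B \<subseteq> X + B + C}"
  have fX': "finite X'" "X' \<subseteq> X" using fin by (auto simp: X'_def)
  have finXB: "finite (X + B)" "finite (X + B + C)" "finite (X + C)" "finite (X' + B)"
    using fin insert fX' by (auto intro!: finite_set_plus)
  have 1: "X + B + insert c C \<subseteq> (X + B + C) \<union> ((X + B + {c}) - (X' + B + {c}))"
  proof
    fix z assume "z \<in> X + B + insert c C"
    then obtain x b d where z: "x \<in> X" "b \<in> B" "d \<in> insert c C" "z = x + b + d"
      by (auto elim!: set_plus_elim)
    have "X' + B + {c} \<subseteq> X + B + C"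
    proof
      fix w assume "w \<in> X' + B + {c}"
      then obtain x b where w: "x \<in> X'" "b \<in> B" "w = x + b + c"
        by (auto elim!: set_plus_elim)
      then have "w \<in> {x + c} + B" by (auto simp: set_plus_def add_ac)
      then show "w \<in> X + B + C" using w by (auto simp: X'_def)
    qed
    moreover have "z \<in> X + B + C \<or> z \<in> X + B + {c}"
      using z by (cases "d = c") (auto intro: set_plus_intro)
    ultimately show "z \<in> (X + B + C) \<union> ((X + B + {c}) - (X' + B + {c}))"
      by blast
  qed
  have sub: "X' + B + {c} \<subseteq> X + B + {c}"
    using fX' by (intro set_plus_mono2) auto
  have "card (X + B + insert c C) \<le> card ((X + B + C) \<union> ((X + B + {c}) - (X' + B + {c})))"
    by (rule card_mono[OF _ 1]) (use finXB in \<open>auto intro!: finite_set_plus\<close>)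
  also have "\<dots> \<le> card (X + B + C) + card ((X + B + {c}) - (X' + B + {c}))"
    by (rule card_Un_le)
  also have "card ((X + B + {c}) - (X' + B + {c})) = card (X + B) - card (X' + B)"
    using finXB sub by (subst card_Diff_subset) (auto simp: card_set_plus_singleton intro!: finite_set_plus)
  finally have A: "card (X + B + insert c C) \<le> card (X + B + C) + (card (X + B) - card (X' + B))" .
  have le: "card (X' + B) \<le> card (X + B)"
    by (rule card_mono) (use finXB fX' in \<open>auto simp: set_plus_def\<close>)
  \<comment> \<open>These points are new in \<open>X + insert c C\<close>: if \<open>x + c\<close>
    were in \<open>X + C\<close>, then \<open>x + c + B\<close> would be covered and
    \<open>x\<close> would belong to \<open>X'\<close>.\<close>
  define Y where "Y = (\<lambda>x. x + c) ` (X - X')"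
  have disj: "(X + C) \<inter> Y = {}"
  proof -
    have "x \<in> X'" if "x \<in> X" "x + c \<in> X + C" for x
    proof -
      from \<open>x + c \<in> X + C\<close> obtain x1 d where x1: "x1 \<in> X" "d \<in> C" "x + c = x1 + d"
        by (auto elim!: set_plus_elim)
      have "{x + c} + B \<subseteq> X + B + C"
      proof
        fix w assume "w \<in> {x + c} + B"
        then obtain b where "b \<in> B" "w = x1 + b + d" using x1 by (auto simp: set_plus_def add_ac)
        then show "w \<in> X + B + C" using x1 by (auto intro!: set_plus_intro)
      qed
      then show ?thesis using that by (auto simp: X'_def)
    qed
    then show ?thesis by (auto simp: Y_def)
  qed
  have cY: "card Y = card X - card X'"
    unfolding Y_def using fX' fin by (simp add: card_image inj_on_def card_Diff_subset)
  have "card (X + C) + card Y = card ((X + C) \<union> Y)"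
    using disj finXB fin by (subst card_Un_disjoint) (auto simp: Y_def)
  also have "\<dots> \<le> card (X + insert c C)"
  proof (rule card_mono)
    show "finite (X + insert c C)" using fin insert by (intro finite_set_plus) auto
    show "X + C \<union> Y \<subseteq> X + insert c C" by (auto simp: Y_def set_plus_def)
  qed
  finally have Bq: "card (X + C) + (card X - card X') \<le> card (X + insert c C)" using cY by simp
  have leX: "card X' \<le> card X" using fX' fin by (simp add: card_mono)
  have m: "card (X + B) * card X' \<le> card (X' + B) * card X" using minX fX' by blast
  have "int (card (X + B + insert c C)) * card X
      \<le> (int (card (X + B + C)) + card (X + B) - card (X' + B)) * card X"
    using A le by (intro mult_right_mono) auto
  also have "\<dots> = int (card (X + B + C) * card X) + int (card (X + B)) * card X - int (card (X' + B) * card X)"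
    by (simp add: algebra_simps)
  also have "\<dots> \<le> int (card (X + B) * card (X + C)) + int (card (X + B)) * card X - int (card (X + B) * card X')"
    using insert.IH m by linarith
  also have "\<dots> = int (card (X + B)) * (int (card (X + C)) + card X - card X')"
    by (simp add: algebra_simps)
  also have "\<dots> \<le> int (card (X + B)) * int (card (X + insert c C))"
    using Bq leX by (intro mult_left_mono) auto
  finally show ?case by (metis of_nat_le_iff of_nat_mult)
qed

text \<open>A nonempty subset minimising \<open>card (X + B) / card X\<close> satisfies the
  hypothesis of \<open>petridis\<close> and has ratio at most \<open>K\<close>; every further
  summand \<open>B\<close> then costs one factor \<open>K\<close>.\<close>

lemma pluennecke:
  fixes A B :: "'a::ab_group_add set" and K :: real
  assumes fin: "finite A" "finite B" and ne: "A \<noteq> {}"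
    and K: "real (card (A + B)) \<le> K * card A"
  obtains X where "X \<subseteq> A" "X \<noteq> {}" "\<And>m. real (card (X + (\<Sum>i<m. B))) \<le> K ^ m * card X"
proof -
  define S where "S = {X. X \<subseteq> A \<and> X \<noteq> {}}"
  have "finite S" "S \<noteq> {}" unfolding S_def using fin ne by auto
  then obtain X where X: "X \<in> S" and min: "\<And>Y. Y \<in> S \<Longrightarrow> real (card (X + B)) / card X \<le> real (card (Y + B)) / card Y"
    using ex_min_if_finite[of "(\<lambda>X. real (card (X + B)) / card X) ` S"]
    by (metis (mono_tags, lifting) arg_min_if_finite(1) arg_min_least)
  have Xp: "X \<subseteq> A" "X \<noteq> {}" "finite X" "card X > 0"
    using X fin by (auto simp: S_def finite_subset card_gt_0_iff)
  have mX: "card (X + B) * card Y \<le> card (Y + B) * card X" if "Y \<subseteq> X" for Y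
  proof (cases "Y = {}")
    case False
    have "finite Y" using that Xp finite_subset by blast
    then have "real (card (X + B)) / card X \<le> real (card (Y + B)) / card Y"
      using min[of Y] False that Xp by (auto simp: S_def)
    moreover have "card Y > 0" using False \<open>finite Y\<close> by (simp add: card_gt_0_iff)
    ultimately have "real (card (X + B)) * card Y \<le> real (card (Y + B)) * card X"
      using Xp by (simp add: field_simps)
    then show ?thesis by (metis of_nat_le_iff of_nat_mult)
  qed auto
  have "real (card (X + B)) / card X \<le> real (card (A + B)) / card A"
    using min[of A] ne by (auto simp: S_def)
  also have "\<dots> \<le> K" using K ne fin by (simp add: divide_le_eq card_gt_0_iff)
  finally have KX: "real (card (X + B)) \<le> K * card X" using Xp by (simp add: field_simps)
  have "real (card (X + (\<Sum>i<m. B))) \<le> K ^ m * card X" for m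
  proof (induction m)
    case 0
    show ?case by (simp add: set_zero)
  next
    case (Suc m)
    define C where "C = (\<Sum>i<m. B)"
    have fC: "finite C" unfolding C_def
      using fin by (induction m) (auto simp: set_zero finite_set_plus)
    have "card (X + B + C) * card X \<le> card (X + B) * card (X + C)"
      by (rule petridis) (use Xp fin fC mX in auto)
    then have "real (card (X + B + C)) * card X \<le> real (card (X + B)) * card (X + C)"
      by (metis of_nat_le_iff of_nat_mult)
    also have "\<dots> \<le> (K * card X) * (K ^ m * card X)"
      using KX Suc.IH by (intro mult_mono) (auto simp: C_def intro: order_trans[OF _ KX])
    finally have "real (card (X + B + C)) \<le> K ^ Suc m * card X"
      using Xp by (simp add: field_simps)
    moreover have "X + (\<Sum>i<Suc m. B) = X + B + C" by (simp add: C_def add_ac)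
    ultimately show ?case by simp
  qed
  with Xp show ?thesis using that by blast
qed

text \<open>Fix one representation \<open>b - c\<close> of every difference. The pair
  \<open>(x + b, x + c)\<close> determines the difference by subtraction, and then
  \<open>x\<close>.\<close>

lemma ruzsa_triangle:
  fixes X B C :: "'a::ab_group_add set"
  assumes fin: "finite X" "finite B" "finite C"
  shows "card X * card (B + uminus ` C) \<le> card (X + B) * card (X + C)"
proof -
  define f where "f d = (SOME bc. fst bc \<in> B \<and> snd bc \<in> C \<and> d = fst bc - snd bc)" for d
  have f: "fst (f d) \<in> B" "snd (f d) \<in> C" "fst (f d) - snd (f d) = d" if "d \<in> B + uminus ` C" for d
  proof -
    have "\<exists>bc. fst bc \<in> B \<and> snd bc \<in> C \<and> d = fst bc - snd bc"
      using that by (auto elim!: set_plus_elim)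
    then show "fst (f d) \<in> B" "snd (f d) \<in> C" "fst (f d) - snd (f d) = d"
      unfolding f_def by (metis (mono_tags, lifting) someI_ex)+
  qed
  define h where "h = (\<lambda>(x, d). (x + fst (f d), x + snd (f d)))"
  have inj: "inj_on h (X \<times> (B + uminus ` C))"
  proof (rule inj_onI, clarify)
    fix x d x' d' assume d: "d \<in> B + uminus ` C" "d' \<in> B + uminus ` C" and e: "h (x, d) = h (x', d')"
    then have e1: "x + fst (f d) = x' + fst (f d')" and e2: "x + snd (f d) = x' + snd (f d')"
      by (auto simp: h_def)
    have "d = (x + fst (f d)) - (x + snd (f d))" using f(3)[OF d(1)] by simp
    also have "\<dots> = (x' + fst (f d')) - (x' + snd (f d'))" by (simp only: e1 e2)
    also have "\<dots> = d'" using f(3)[OF d(2)] by simp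
    finally have "d = d'" .
    then show "x = x' \<and> d = d'" using e1 by simp
  qed
  have "h ` (X \<times> (B + uminus ` C)) \<subseteq> (X + B) \<times> (X + C)"
    using f by (fastforce simp: h_def)
  then have "card (X \<times> (B + uminus ` C)) \<le> card ((X + B) \<times> (X + C))"
    by (rule card_inj_on_le[OF inj]) (use fin in \<open>auto intro!: finite_set_plus\<close>)
  then show ?thesis by (simp add: card_cartesian_product)
qed

lemma finite_iterated_set_plus: "finite B \<Longrightarrow> finite (\<Sum>i<(m::nat). B :: 'a::comm_monoid_add set)"
  by (induction m) (auto simp: set_zero finite_set_plus)

text \<open>The same \<open>X\<close> controls all iterated sums of \<open>B\<close>, so it serves
  as the middle set in Ruzsa's triangle inequality for both of them, and \<open>card X\<close>
  cancels.\<close>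

lemma pluennecke_ruzsa:
  fixes A B :: "'a::ab_group_add set" and K :: real
  assumes fin: "finite A" "finite B" and ne: "A \<noteq> {}"
    and K: "real (card (A + B)) \<le> K * card A"
  shows "real (card ((\<Sum>i<(m::nat). B) + uminus ` (\<Sum>i<(n::nat). B))) \<le> K ^ (m + n) * card A"
proof -
  obtain X where X: "X \<subseteq> A" "X \<noteq> {}" and P: "\<And>m. real (card (X + (\<Sum>i<m. B))) \<le> K ^ m * card X"
    using pluennecke[OF fin ne K] by blast
  have fX: "finite X" using X fin finite_subset by blast
  then have X0: "card X > 0" using X by (simp add: card_gt_0_iff)
  let ?D = "(\<Sum>i<m. B) + uminus ` (\<Sum>i<n. B)"
  have "card X * card ?D \<le> card (X + (\<Sum>i<m. B)) * card (X + (\<Sum>i<n. B))"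
    by (rule ruzsa_triangle) (use fX fin finite_iterated_set_plus in auto)
  then have "real (card X) * card ?D \<le> real (card (X + (\<Sum>i<m. B))) * card (X + (\<Sum>i<n. B))"
    by (metis of_nat_le_iff of_nat_mult)
  also have "\<dots> \<le> (K ^ m * card X) * (K ^ n * card X)"
    by (intro mult_mono P) (auto intro: order_trans[OF _ P])
  finally have "real (card ?D) \<le> K ^ (m + n) * card X" using X0 by (simp add: power_add field_simps)
  also have "\<dots> \<le> K ^ (m + n) * card A"
  proof -
    have "0 \<le> K * card A" using K by (meson of_nat_0_le_iff order_trans)
    then have "0 \<le> K" using fin ne by (simp add: zero_le_mult_iff)
    then show ?thesis using X fin by (intro mult_left_mono) (auto simp: card_mono)
  qed
  finally show ?thesis .
qed

section \<open>The Balog-Szemeredi-Gowers theorem\<close>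

lemma sum_squared_le_card_mult_sum_squares:
  fixes f :: "'a \<Rightarrow> real"
  assumes "finite A"
  shows "(\<Sum>x\<in>A. f x) ^ 2 \<le> card A * (\<Sum>x\<in>A. f x ^ 2)"
proof -
  have "0 \<le> (\<Sum>x\<in>A. \<Sum>y\<in>A. (f x - f y) ^ 2)" by (intro sum_nonneg) auto
  also have "\<dots> = (\<Sum>x\<in>A. card A * f x ^ 2 + (\<Sum>y\<in>A. f y ^ 2) - 2 * (f x * (\<Sum>y\<in>A. f y)))"
    by (simp add: power2_diff sum.distrib sum_subtractf sum_distrib_left mult_ac)
  also have "\<dots> = 2 * (card A * (\<Sum>x\<in>A. f x ^ 2)) - 2 * (\<Sum>x\<in>A. f x) ^ 2"
    by (simp add: sum.distrib sum_subtractf sum_distrib_left[symmetric] sum_distrib_right[symmetric] power2_eq_square)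
  finally show ?thesis by simp
qed

lemma sum_card_swap:
  assumes "finite A" "finite B"
  shows "(\<Sum>a\<in>A. card {b \<in> B. R a b}) = (\<Sum>b\<in>B. card {a \<in> A. R a b})"
  using sum_multicount_gen[OF assms(1) assms(2), of R "\<lambda>b. card {a \<in> A. R a b}"] by simp

text \<open>
  The neighbourhood of a random vertex is large, and few of its pairs have a small common
  neighbourhood, because such pairs are unlikely to be selected.
\<close>

lemma dense_paths_of_length_3:
  fixes A :: "'a set" and R :: "'a \<Rightarrow> 'a \<Rightarrow> bool" and d :: real
  assumes fin: "finite A" and sym: "\<And>a b. R a b \<Longrightarrow> R b a" and d: "0 < d" and ne: "A \<noteq> {}"
    and edges: "d * card A ^ 2 \<le> (\<Sum>a\<in>A. card {b \<in> A. R a b})"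
  obtains A2 B where "A2 \<subseteq> A" "B \<subseteq> A" "d * card A / 6 \<le> card A2" "d * card A / 4 \<le> card B"
    "\<And>a b. a \<in> A2 \<Longrightarrow> b \<in> B \<Longrightarrow>
      d ^ 5 / 3072 * card A ^ 2 \<le> card {(c, a') \<in> A \<times> A. R a c \<and> R c a' \<and> R a' b}"
proof -
  define N where "N = real (card A)"
  have N: "N > 0" using fin ne by (simp add: N_def card_gt_0_iff)
  define dg where "dg a = real (card {b \<in> A. R a b})" for a
  \<comment> \<open>Vertices of degree below \<open>d * N / 2\<close> carry at most half of the
    edges. Without them every member of a neighbourhood \<open>A1 v\<close> has many neighbours
    itself, which later bounds \<open>B\<close> from below.\<close>
  define A0 where "A0 = {a \<in> A. d * N / 2 \<le> dg a}"
  have A0: "A0 \<subseteq> A" "finite A0" using fin by (auto simp: A0_def)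
  have E: "d * N ^ 2 \<le> (\<Sum>a\<in>A. dg a)" using edges by (simp add: dg_def N_def)
  have "(\<Sum>a\<in>A - A0. dg a) \<le> (\<Sum>a\<in>A - A0. d * N / 2)"
    by (rule sum_mono) (auto simp: A0_def)
  also have "\<dots> = card (A - A0) * (d * N / 2)" by simp
  also have "\<dots> \<le> N * (d * N / 2)"
    using fin d N by (intro mult_right_mono) (auto simp: N_def card_mono)
  finally have "(\<Sum>a\<in>A - A0. dg a) \<le> d * N ^ 2 / 2" by (simp add: power2_eq_square mult_ac)
  moreover have "(\<Sum>a\<in>A. dg a) = (\<Sum>a\<in>A - A0. dg a) + (\<Sum>a\<in>A0. dg a)"
    using A0 fin by (intro sum.subset_diff) auto
  ultimately have E0: "d * N ^ 2 / 2 \<le> (\<Sum>a\<in>A0. dg a)" using E by linarith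
  define A1 where "A1 v = {a \<in> A0. R a v}" for v
  have fA1: "finite (A1 v)" for v using A0 by (auto simp: A1_def)
  define n where "n v = real (card (A1 v))" for v
  have "(\<Sum>v\<in>A. n v) = (\<Sum>a\<in>A0. dg a)"
    using sum_card_swap[OF A0(2) fin, of R] unfolding n_def dg_def A1_def
    by (metis (no_types, lifting) of_nat_sum sum.cong)
  then have E1: "d * N ^ 2 / 2 \<le> (\<Sum>v\<in>A. n v)" using E0 by simp
  have "(\<Sum>v\<in>A. n v) ^ 2 \<le> (\<Sum>v\<in>A. n v ^ 2) * N"
    using sum_squared_le_card_mult_sum_squares[OF fin, of n] by (simp add: N_def mult.commute)
  moreover have "(d * N ^ 2 / 2) ^ 2 \<le> (\<Sum>v\<in>A. n v) ^ 2"
    using E1 d N by (intro power_mono) auto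
  ultimately have "(d * N ^ 2 / 2) ^ 2 \<le> (\<Sum>v\<in>A. n v ^ 2) * N" by linarith
  then have E2: "d ^ 2 * N ^ 3 / 4 \<le> (\<Sum>v\<in>A. n v ^ 2)"
    using N by (simp add: power2_eq_square power3_eq_cube field_simps)
  \<comment> \<open>With this threshold the total penalty for bad pairs, \<open>16 / d\<close> times
    \<open>th * N ^ 3\<close>, is half of the lower bound \<open>d ^ 2 * N ^ 3 / 4\<close> for the
    second moment of \<open>n\<close>.\<close>
  define th where "th = d ^ 3 / 128"
  define co where "co a a' = real (card {c \<in> A. R a c \<and> R c a'})" for a a'
  define Bd where "Bd = {(a, a') \<in> A0 \<times> A0. co a a' < th * N}"
  have fBd: "finite Bd" using A0 by (auto simp: Bd_def intro: finite_subset[of _ "A0 \<times> A0"])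
  define bad where "bad v = real (card {q \<in> Bd. R (fst q) v \<and> R v (snd q)})" for v
  have "(\<Sum>v\<in>A. bad v) = (\<Sum>q\<in>Bd. co (fst q) (snd q))"
    using sum_card_swap[OF fBd fin, of "\<lambda>q v. R (fst q) v \<and> R v (snd q)"]
    unfolding bad_def co_def by (metis (no_types, lifting) of_nat_sum sum.cong)
  also have "\<dots> \<le> (\<Sum>q\<in>Bd. th * N)"
    by (rule sum_mono) (auto simp: Bd_def)
  also have "\<dots> = card Bd * (th * N)" by simp
  also have "\<dots> \<le> N ^ 2 * (th * N)"
  proof (rule mult_right_mono)
    have "card Bd \<le> card (A \<times> A)"
      by (rule card_mono) (use A0 fin in \<open>auto simp: Bd_def\<close>)
    then show "real (card Bd) \<le> N ^ 2"
      unfolding N_def card_cartesian_product power2_eq_square by (metis of_nat_le_iff of_nat_mult)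
  qed (use d N in \<open>auto simp: th_def\<close>)
  finally have Eb: "(\<Sum>v\<in>A. bad v) \<le> th * N ^ 3" by (simp add: power2_eq_square power3_eq_cube mult_ac)
  \<comment> \<open>The weight \<open>16 / d\<close> extracts two facts from one vertex: its
    neighbourhood is large, and at most a share \<open>d / 16\<close> of the ordered pairs in it is
    bad.\<close>
  have "\<exists>v\<in>A. d ^ 2 * N ^ 2 / 8 \<le> n v ^ 2 - 16 / d * bad v"
  proof (rule ccontr)
    assume "\<not> ?thesis"
    then have "(\<Sum>v\<in>A. n v ^ 2 - 16 / d * bad v) < (\<Sum>v\<in>A. d ^ 2 * N ^ 2 / 8)"
      using fin ne by (intro sum_strict_mono) (auto simp: not_le)
    also have "\<dots> = d ^ 2 * N ^ 3 / 8" by (simp add: N_def power2_eq_square power3_eq_cube)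
    finally have "(\<Sum>v\<in>A. n v ^ 2) - 16 / d * (\<Sum>v\<in>A. bad v) < d ^ 2 * N ^ 3 / 8"
      by (simp add: sum_subtractf sum_distrib_left)
    moreover have "16 / d * (\<Sum>v\<in>A. bad v) \<le> d ^ 2 * N ^ 3 / 8"
    proof -
      have "16 / d * (\<Sum>v\<in>A. bad v) \<le> 16 / d * (th * N ^ 3)"
        using Eb d by (intro mult_left_mono) auto
      also have "\<dots> = d ^ 2 * N ^ 3 / 8"
        using d by (simp add: th_def power2_eq_square power3_eq_cube)
      finally show ?thesis .
    qed
    ultimately show False using E2 by argo
  qed
  then obtain v where v: "v \<in> A" "d ^ 2 * N ^ 2 / 8 \<le> n v ^ 2 - 16 / d * bad v" by blast
  have bad0: "0 \<le> bad v" by (simp add: bad_def)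
  have "(d * N / 3) ^ 2 \<le> d ^ 2 * N ^ 2 / 8" using d N by (simp add: power2_eq_square divide_simps)
  also have "\<dots> \<le> n v ^ 2" using v(2) bad0 d by (smt (verit) divide_nonneg_pos mult_nonneg_nonneg)
  finally have nv: "d * N / 3 \<le> n v" by (rule power2_le_imp_le) (simp add: n_def)
  have nvp: "n v > 0" using nv d N by (smt (verit) divide_pos_pos mult_pos_pos)
  have "16 / d * bad v \<le> n v ^ 2"
    using v(2) by (smt (verit) divide_nonneg_nonneg mult_nonneg_nonneg zero_le_power2)
  then have badv: "bad v \<le> d / 16 * n v ^ 2" using d by (simp add: field_simps)
  define bn where "bn a = real (card {a' \<in> A1 v. (a, a') \<in> Bd})" for a
  \<comment> \<open>By Markov's inequality at most half of the neighbourhood is lost here.\<close>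
  define A2 where "A2 = {a \<in> A1 v. bn a \<le> d / 8 * n v}"
  have A2: "A2 \<subseteq> A1 v" "finite A2" using fA1 by (auto simp: A2_def)
  have sbn: "(\<Sum>a\<in>A1 v. bn a) \<le> bad v"
  proof -
    have "(\<Sum>a\<in>A1 v. card {a' \<in> A1 v. (a, a') \<in> Bd}) = card (SIGMA a:A1 v. {a' \<in> A1 v. (a, a') \<in> Bd})"
      using fA1 by simp
    also have "\<dots> \<le> card {q \<in> Bd. R (fst q) v \<and> R v (snd q)}"
    proof (rule card_mono)
      show "finite {q \<in> Bd. R (fst q) v \<and> R v (snd q)}" using fBd by simp
      have "R v a'" if "a' \<in> A1 v" for a' using that sym[of a' v] by (simp add: A1_def)
      then show "(SIGMA a:A1 v. {a' \<in> A1 v. (a, a') \<in> Bd}) \<subseteq> {q \<in> Bd. R (fst q) v \<and> R v (snd q)}"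
        by (auto simp: A1_def)
    qed
    finally show ?thesis unfolding bn_def bad_def of_nat_sum[symmetric] of_nat_le_iff .
  qed
  have "(\<Sum>a\<in>A1 v - A2. d / 8 * n v) \<le> (\<Sum>a\<in>A1 v - A2. bn a)"
    by (rule sum_mono) (auto simp: A2_def)
  also have "\<dots> \<le> (\<Sum>a\<in>A1 v. bn a)"
    by (rule sum_mono2) (use fA1 in \<open>auto simp: bn_def\<close>)
  also have "\<dots> \<le> d / 16 * n v ^ 2" using sbn badv by linarith
  finally have "card (A1 v - A2) * (d / 8 * n v) \<le> d / 16 * n v ^ 2" by simp
  then have "real (card (A1 v - A2)) \<le> n v / 2"
    using d nvp by (simp add: power2_eq_square field_simps)
  moreover have "real (card (A1 v - A2)) = n v - card A2"
    using A2 fA1 by (simp add: n_def card_Diff_subset card_mono of_nat_diff)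
  ultimately have cA2: "n v / 2 \<le> card A2" by linarith
  define m where "m b = real (card {a \<in> A1 v. R a b})" for b
  define B where "B = {b \<in> A. d / 4 * n v \<le> m b}"
  have B: "B \<subseteq> A" "finite B" using fin by (auto simp: B_def)
  have "n v * (d * N / 2) = (\<Sum>a\<in>A1 v. d * N / 2)" by (simp add: n_def)
  also have "\<dots> \<le> (\<Sum>a\<in>A1 v. dg a)" by (rule sum_mono) (auto simp: A1_def A0_def)
  also have "\<dots> = (\<Sum>b\<in>A. m b)"
    unfolding dg_def m_def using sum_card_swap[OF fA1 fin, of R] by (metis (no_types, lifting) of_nat_sum sum.cong)
  also have "\<dots> = (\<Sum>b\<in>A - B. m b) + (\<Sum>b\<in>B. m b)"
    using B fin by (intro sum.subset_diff) auto
  also have "(\<Sum>b\<in>A - B. m b) \<le> (\<Sum>b\<in>A - B. d / 4 * n v)"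
    by (rule sum_mono) (auto simp: B_def)
  also have "\<dots> = card (A - B) * (d / 4 * n v)" by simp
  also have "\<dots> \<le> N * (d / 4 * n v)"
    using fin d nvp by (intro mult_right_mono) (auto simp: N_def card_mono)
  also have "(\<Sum>b\<in>B. m b) \<le> (\<Sum>b\<in>B. n v)"
    unfolding m_def n_def by (rule sum_mono) (use fA1 in \<open>auto intro!: card_mono\<close>)
  also have "\<dots> = card B * n v" by simp
  finally have "n v * (d * N / 4) \<le> card B * n v" by (simp add: field_simps)
  then have cB: "d * N / 4 \<le> card B" using nvp by (simp add: mult.commute)
  have paths: "d ^ 5 / 3072 * N ^ 2 \<le> card {(c, a') \<in> A \<times> A. R a c \<and> R c a' \<and> R a' b}"
    if a: "a \<in> A2" and b: "b \<in> B" for a b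
  proof -
    \<comment> \<open>Of the at least \<open>d / 4 * n v\<close> neighbours of \<open>b\<close> in
      \<open>A1 v\<close>, at most \<open>d / 8 * n v\<close> are bad partners of \<open>a\<close>.
      Each of the others is joined to \<open>a\<close> by \<open>th * N\<close> paths of length two;
      with \<open>d * N / 3 \<le> n v\<close> this gives \<open>3072 = 8 * 3 * 128\<close>.\<close>
    define G where "G = {a' \<in> A1 v. R a' b \<and> (a, a') \<notin> Bd}"
    have fG: "finite G" using fA1 by (auto simp: G_def)
    have "{a' \<in> A1 v. R a' b} \<subseteq> G \<union> {a' \<in> A1 v. (a, a') \<in> Bd}" by (auto simp: G_def)
    then have "card {a' \<in> A1 v. R a' b} \<le> card (G \<union> {a' \<in> A1 v. (a, a') \<in> Bd})"
      by (rule card_mono[rotated]) (use fG fA1 in auto)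
    also have "\<dots> \<le> card G + card {a' \<in> A1 v. (a, a') \<in> Bd}" by (rule card_Un_le)
    finally have "m b \<le> card G + bn a" unfolding m_def bn_def by linarith
    moreover have "d / 4 * n v \<le> m b" "bn a \<le> d / 8 * n v" using a b by (auto simp: B_def A2_def)
    ultimately have G: "d / 8 * n v \<le> card G" by linarith
    have aA0: "a \<in> A0" using a A2 by (auto simp: A1_def)
    have "card G * (th * N) = (\<Sum>a'\<in>G. th * N)" by simp
    also have "\<dots> \<le> (\<Sum>a'\<in>G. co a a')"
      by (rule sum_mono) (use aA0 in \<open>auto simp: G_def Bd_def A1_def\<close>)
    also have "\<dots> = card (SIGMA a':G. {c \<in> A. R a c \<and> R c a'})"
      using fG fin by (simp add: co_def)
    also have "\<dots> = card ((\<lambda>(c, a'). (a', c)) ` (SIGMA a':G. {c \<in> A. R a c \<and> R c a'}))"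
      by (subst card_image) (auto simp: inj_on_def)
    also have "\<dots> \<le> card {(c, a') \<in> A \<times> A. R a c \<and> R c a' \<and> R a' b}"
    proof (rule of_nat_mono, rule card_mono)
      show "finite {(c, a') \<in> A \<times> A. R a c \<and> R c a' \<and> R a' b}"
        by (rule finite_subset[of _ "A \<times> A"]) (use fin in auto)
    qed (use A0 in \<open>auto simp: G_def A1_def\<close>)
    finally have "card G * (th * N) \<le> card {(c, a') \<in> A \<times> A. R a c \<and> R c a' \<and> R a' b}" .
    moreover have "(d / 8 * (d * N / 3)) * (th * N) \<le> card G * (th * N)"
    proof (rule mult_right_mono)
      have "d / 8 * (d * N / 3) \<le> d / 8 * n v" using nv d by (intro mult_left_mono) auto
      then show "d / 8 * (d * N / 3) \<le> card G" using G by linarith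
    qed (use d N in \<open>auto simp: th_def\<close>)
    moreover have "(d / 8 * (d * N / 3)) * (th * N) = d ^ 5 / 3072 * N ^ 2"
      by (simp add: th_def power2_eq_square eval_nat_numeral)
    ultimately show ?thesis by linarith
  qed
  show ?thesis
  proof (rule that[of A2 B])
    show "A2 \<subseteq> A" using A2 A0 by (auto simp: A1_def)
    show "d * card A / 6 \<le> card A2" using cA2 nv by (simp add: N_def)
    show "d * card A / 4 \<le> card B" using cB by (simp add: N_def)
  qed (use B paths in \<open>auto simp: N_def\<close>)
qed

lemma uminus_image_set_plus:
  fixes A B :: "'a::ab_group_add set"
  shows "uminus ` (A + B) = uminus ` A + uminus ` B"
proof
  show "uminus ` A + uminus ` B \<subseteq> uminus ` (A + B)"
  proof
    fix z assume "z \<in> uminus ` A + uminus ` B"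
    then obtain a b where "a \<in> A" "b \<in> B" "z = - a + - b" by (auto elim!: set_plus_elim)
    then show "z \<in> uminus ` (A + B)" by (intro image_eqI[of _ _ "a + b"]) (auto intro: set_plus_intro)
  qed
  show "uminus ` (A + B) \<subseteq> uminus ` A + uminus ` B"
  proof
    fix z assume "z \<in> uminus ` (A + B)"
    then obtain a b where "a \<in> A" "b \<in> B" "z = - a + - b" by (auto elim!: set_plus_elim)
    then show "z \<in> uminus ` A + uminus ` B" by (blast intro: set_plus_intro)
  qed
qed

definition energy :: "'a::ab_group_add set \<Rightarrow> nat" where
  "energy A = card {(a, b, c, d). a \<in> A \<and> b \<in> A \<and> c \<in> A \<and> d \<in> A \<and> a - b = c - d}"

definition diff_reps :: "'a::ab_group_add set \<Rightarrow> 'a \<Rightarrow> nat" where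
  "diff_reps A x = card {(a, b) \<in> A \<times> A. a - b = x}"

lemma energy_eq_sum_diff_reps:
  assumes "finite A"
  shows "energy A = (\<Sum>(a, b)\<in>A \<times> A. diff_reps A (a - b))"
proof -
  have "energy A = card (SIGMA q:A \<times> A. {(c, d) \<in> A \<times> A. c - d = fst q - snd q})"
    unfolding energy_def by (rule bij_betw_same_card[of "\<lambda>(a, b, c, d). ((a, b), (c, d))"])
      (force simp: bij_betw_def inj_on_def image_def)
  also have "\<dots> = (\<Sum>q\<in>A \<times> A. card {(c, d) \<in> A \<times> A. c - d = fst q - snd q})"
    by (rule card_SigmaI) (use assms in \<open>auto intro: finite_subset[of _ "A \<times> A"]\<close>)
  also have "\<dots> = (\<Sum>(a, b)\<in>A \<times> A. diff_reps A (a - b))"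
    by (rule sum.cong) (auto simp: diff_reps_def)
  finally show ?thesis .
qed

lemma diff_reps_le:
  assumes "finite A"
  shows "diff_reps A x \<le> card A"
  unfolding diff_reps_def
  by (rule card_inj_on_le[of fst]) (use assms in \<open>auto simp: inj_on_def\<close>)

lemma sum_diff_reps_le:
  assumes "finite A" "finite P"
  shows "(\<Sum>x\<in>P. diff_reps A x) \<le> card A ^ 2"
proof -
  have "(\<Sum>x\<in>P. diff_reps A x) = card (SIGMA x:P. {(a, b) \<in> A \<times> A. a - b = x})"
    unfolding diff_reps_def
    by (rule card_SigmaI[symmetric]) (use assms in \<open>auto intro: finite_subset[of _ "A \<times> A"]\<close>)
  also have "\<dots> \<le> card (A \<times> A)"
    by (rule card_inj_on_le[of snd]) (use assms in \<open>auto simp: inj_on_def\<close>)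
  finally show ?thesis by (simp add: card_cartesian_product power2_eq_square)
qed

lemma diff_reps_minus: "diff_reps A (- x) = diff_reps A x"
proof -
  have "{(a, b) \<in> A \<times> A. a - b = - x} = prod.swap ` {(a, b) \<in> A \<times> A. a - b = x}"
  proof -
    have "a - b = - x \<longleftrightarrow> b - a = x" for a b by (metis minus_diff_eq minus_minus)
    then show ?thesis by (auto simp: image_iff)
  qed
  then show ?thesis by (simp add: diff_reps_def card_image)
qed

text \<open>Join two elements when their difference is popular. Unpopular differences account for at
  most half of the energy, so the graph has density at least \<open>1 / (2 * K)\<close>, and every
  difference of an element of \<open>A'\<close> and one of \<open>B\<close> is in many ways a sum of
  three popular differences. As there are at most \<open>2 * K * N\<close> popular differences, such
  elements are few; \<open>786432 = 3072 * 2 ^ 8\<close>.\<close>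

theorem balog_szemeredi_gowers:
  fixes A :: "'a::ab_group_add set" and K :: real
  assumes fin: "finite A" and ne: "A \<noteq> {}" and K: "K > 0" and E: "card A ^ 3 \<le> K * energy A"
  obtains A' B where "A' \<subseteq> A" "B \<subseteq> A" "card A \<le> 12 * K * card A'" "card A \<le> 8 * K * card B"
    "card (A' + uminus ` B) \<le> 786432 * K ^ 8 * card A"
proof -
  define N where "N = real (card A)"
  have N: "N > 0" using fin ne by (simp add: N_def card_gt_0_iff)
  define D where "D = A + uminus ` A"
  have fD: "finite D" using fin by (auto simp: D_def intro!: finite_set_plus)
  define P where "P = {x \<in> D. N / (2 * K) \<le> diff_reps A x}"
  have fP: "finite P" using fD by (simp add: P_def)
  define R where "R a b \<longleftrightarrow> a - b \<in> P" for a b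
  have inD: "a - b \<in> D" if "a \<in> A" "b \<in> A" for a b
    using that set_plus_intro[of a A "- b" "uminus ` A"] by (auto simp: D_def)
  have symD: "- x \<in> D" if "x \<in> D" for x
    using that inD by (auto simp: D_def elim!: set_plus_elim)
  have sym: "R b a" if "R a b" for a b
    using that symD[of "a - b"] diff_reps_minus[of A "a - b"] by (auto simp: R_def P_def)
  have cP: "real (card P) * (N / (2 * K)) \<le> N ^ 2"
  proof -
    have "real (card P) * (N / (2 * K)) = (\<Sum>x\<in>P. N / (2 * K))" by simp
    also have "\<dots> \<le> (\<Sum>x\<in>P. real (diff_reps A x))" by (rule sum_mono) (auto simp: P_def)
    also have "\<dots> \<le> N ^ 2"
      using sum_diff_reps_le[OF fin fP] unfolding N_def by (metis of_nat_le_iff of_nat_power of_nat_sum)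
    finally show ?thesis .
  qed
  then have cP: "real (card P) \<le> 2 * K * N" using N K by (simp add: field_simps power2_eq_square)
  have "real (energy A) = (\<Sum>(a, b)\<in>A \<times> A. real (diff_reps A (a - b)))"
    by (simp add: energy_eq_sum_diff_reps[OF fin] case_prod_unfold)
  also have "\<dots> \<le> (\<Sum>(a, b)\<in>A \<times> A. N / (2 * K) + N * of_bool (R a b))"
  proof (rule sum_mono, clarify)
    fix a b assume "a \<in> A" "b \<in> A"
    moreover have "real (diff_reps A (a - b)) \<le> N" using diff_reps_le[OF fin] by (simp add: N_def)
    moreover have "0 \<le> N / (2 * K)" using N K by simp
    ultimately show "real (diff_reps A (a - b)) \<le> N / (2 * K) + N * of_bool (R a b)"
      using inD[of a b] by (auto simp: R_def P_def)
  qed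
  also have "\<dots> = N ^ 2 * (N / (2 * K)) + N * (\<Sum>(a, b)\<in>A \<times> A. of_bool (R a b))"
    by (simp add: case_prod_unfold sum.distrib sum_distrib_left card_cartesian_product N_def power2_eq_square)
  also have "(\<Sum>(a, b)\<in>A \<times> A. of_bool (R a b)) = real (\<Sum>a\<in>A. card {b \<in> A. R a b})"
    using fin by (simp add: sum.cartesian_product[symmetric] of_bool_def sum.If_cases Int_def)
  finally have "N ^ 3 \<le> K * (N ^ 2 * (N / (2 * K)) + N * real (\<Sum>a\<in>A. card {b \<in> A. R a b}))"
    using E K unfolding N_def by (smt (verit) mult_left_mono of_nat_power)
  then have edges: "1 / (2 * K) * N ^ 2 \<le> real (\<Sum>a\<in>A. card {b \<in> A. R a b})"
    using N K by (simp add: field_simps power2_eq_square power3_eq_cube)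
  obtain A' B where AB: "A' \<subseteq> A" "B \<subseteq> A" "1 / (2 * K) * N / 6 \<le> card A'" "1 / (2 * K) * N / 4 \<le> card B"
    and paths: "\<And>a b. a \<in> A' \<Longrightarrow> b \<in> B \<Longrightarrow>
      (1 / (2 * K)) ^ 5 / 3072 * N ^ 2 \<le> card {(c, a') \<in> A \<times> A. R a c \<and> R c a' \<and> R a' b}"
    using dense_paths_of_length_3[OF fin, of R "1 / (2 * K)"] sym K ne edges unfolding N_def by auto
  have fAB: "finite A'" "finite B" using AB fin finite_subset by auto
  define S where "S = A' + uminus ` B"
  have fS: "finite S" using fAB by (auto simp: S_def intro!: finite_set_plus)
  define T where "T x = {(p, q, r) \<in> P \<times> P \<times> P. p + q + r = x}" for x
  have fT: "finite (T x)" for x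
    unfolding T_def by (rule finite_subset[of _ "P \<times> P \<times> P"]) (use fP in auto)
  have cT: "(1 / (2 * K)) ^ 5 / 3072 * N ^ 2 \<le> card (T x)" if "x \<in> S" for x
  proof -
    obtain a b where ab: "a \<in> A'" "b \<in> B" "x = a - b"
      using \<open>x \<in> S\<close> by (auto simp: S_def elim!: set_plus_elim)
    \<comment> \<open>A path telescopes:
      \<open>a - b = (a - c) + (c - a') + (a' - b)\<close>.\<close>
    have "card {(c, a') \<in> A \<times> A. R a c \<and> R c a' \<and> R a' b} \<le> card (T x)"
      by (rule card_inj_on_le[of "\<lambda>(c, a'). (a - c, c - a', a' - b)"])
        (use fT ab in \<open>auto simp: inj_on_def T_def R_def\<close>)
    then show ?thesis using paths[OF ab(1,2)] by linarith
  qed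
  have "card S * ((1 / (2 * K)) ^ 5 / 3072 * N ^ 2) = (\<Sum>x\<in>S. (1 / (2 * K)) ^ 5 / 3072 * N ^ 2)" by simp
  also have "\<dots> \<le> (\<Sum>x\<in>S. real (card (T x)))" by (rule sum_mono) (rule cT)
  also have "\<dots> = real (card (SIGMA x:S. T x))" using fS fT by simp
  also have "card (SIGMA x:S. T x) \<le> card (P \<times> P \<times> P)"
    by (rule card_inj_on_le[of snd]) (use fP in \<open>auto simp: inj_on_def T_def\<close>)
  also have "real (card (P \<times> P \<times> P)) = real (card P) ^ 3"
    by (simp add: card_cartesian_product power3_eq_cube)
  also have "\<dots> \<le> (2 * K * N) ^ 3" using cP by (intro power_mono) auto
  finally have "card S * ((1 / (2 * K)) ^ 5 / 3072 * N ^ 2) \<le> (2 * K * N) ^ 3" by simp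
  then have "card S \<le> 786432 * K ^ 8 * N"
    using N K by (simp add: field_simps eval_nat_numeral)
  then show ?thesis
    using that[of A' B] AB K N by (simp add: S_def N_def field_simps)
qed

text \<open>The constant absorbs the ones of the Balog-Szemeredi-Gowers and of the Pluennecke inequality.\<close>

theorem energy_imp_small_iterated_difference:
  fixes A :: "'a::ab_group_add set" and K :: real
  assumes fin: "finite A" and ne: "A \<noteq> {}" and K: "K > 0" and E: "card A ^ 3 \<le> K * energy A"
  obtains B where "B \<subseteq> A" "card A \<le> 8 * K * card B"
    "\<And>m n :: nat. card ((\<Sum>i<m. B) + uminus ` (\<Sum>i<n. B)) \<le> (9437184 * K ^ 9) ^ (m + n) * card A"
proof -
  obtain A' B where AB: "A' \<subseteq> A" "B \<subseteq> A" "card A \<le> 12 * K * card A'" "card A \<le> 8 * K * card B"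
    and S: "card (A' + uminus ` B) \<le> 786432 * K ^ 8 * card A"
    using balog_szemeredi_gowers[OF fin ne K E] by metis
  have fAB: "finite A'" "finite B" using AB fin finite_subset by auto
  have "card A > 0" using fin ne by (simp add: card_gt_0_iff)
  then have A'ne: "A' \<noteq> {}" using AB(3) by (intro notI) simp
  have "card (A' + uminus ` B) \<le> 786432 * K ^ 8 * (12 * K * card A')"
    using S AB(3) K by (smt (verit) mult_left_mono zero_le_power)
  \<comment> \<open>The bound is now relative to \<open>A'\<close>, which may be smaller than
    \<open>A\<close> by the factor \<open>12 * K\<close>; hence
    \<open>9437184 = 12 * 786432\<close>.\<close>
  then have dbl: "card (A' + uminus ` B) \<le> 9437184 * K ^ 9 * card A'"
    by (simp add: eval_nat_numeral mult_ac)
  have neg: "(\<Sum>i<m. uminus ` B) = uminus ` (\<Sum>i<m. B)" for m :: nat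
    by (induction m) (simp_all add: set_zero uminus_image_set_plus)
  show ?thesis
  proof (rule that[of B])
    fix m n :: nat
    \<comment> \<open>The doubling bound concerns the negative of \<open>B\<close>, and negation
      exchanges \<open>m\<close> and \<open>n\<close>.\<close>
    have "(\<Sum>i<m. B) + uminus ` (\<Sum>i<n. B) = (\<Sum>i<n. uminus ` B) + uminus ` (\<Sum>i<m. uminus ` B)"
      unfolding neg by (simp add: image_image add.commute)
    then have "card ((\<Sum>i<m. B) + uminus ` (\<Sum>i<n. B)) \<le> (9437184 * K ^ 9) ^ (n + m) * card A'"
      using pluennecke_ruzsa[OF fAB(1) _ A'ne dbl, of n m] fAB by simp
    also have "\<dots> \<le> (9437184 * K ^ 9) ^ (n + m) * card A"
      using AB fin K by (intro mult_left_mono) (auto simp: card_mono)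
    finally show "card ((\<Sum>i<m. B) + uminus ` (\<Sum>i<n. B)) \<le> (9437184 * K ^ 9) ^ (m + n) * card A"
      by (simp add: add.commute)
  qed (use AB in auto)
qed

subsection \<open>Vectors over a prime field\<close>

text \<open>
  Vectors of length \<open>n\<close> are sequences vanishing from \<open>n\<close> on, so that they live in an abelian
  group type which does not depend on \<open>n\<close>. As the field is prime, subspaces are the same as
  additive subgroups.
\<close>

definition vecs :: "nat \<Rightarrow> (nat \<Rightarrow> 'a::zero) set" where
  "vecs n = {x. \<forall>i\<ge>n. x i = 0}"

definition add_subgroup :: "'a::ab_group_add set \<Rightarrow> bool" where
  "add_subgroup V \<longleftrightarrow> 0 \<in> V \<and> (\<forall>x\<in>V. \<forall>y\<in>V. x - y \<in> V)"

lemma add_subgroup_zero: "add_subgroup V \<Longrightarrow> 0 \<in> V"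
  by (simp add: add_subgroup_def)

lemma add_subgroup_diff: "add_subgroup V \<Longrightarrow> x \<in> V \<Longrightarrow> y \<in> V \<Longrightarrow> x - y \<in> V"
  by (simp add: add_subgroup_def)

lemma add_subgroup_uminus: "add_subgroup V \<Longrightarrow> x \<in> V \<Longrightarrow> - x \<in> V"
  using add_subgroup_diff[of V 0 x] add_subgroup_zero by auto

lemma add_subgroup_add: "add_subgroup V \<Longrightarrow> x \<in> V \<Longrightarrow> y \<in> V \<Longrightarrow> x + y \<in> V"
  using add_subgroup_diff[of V x "- y"] add_subgroup_uminus by auto

lemma add_subgroup_sum: "add_subgroup V \<Longrightarrow> (\<And>i. i \<in> I \<Longrightarrow> f i \<in> V) \<Longrightarrow> sum f I \<in> V"
  by (induction I rule: infinite_finite_induct) (auto intro: add_subgroup_zero add_subgroup_add)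

lemma add_subgroup_Int: "add_subgroup V \<Longrightarrow> add_subgroup W \<Longrightarrow> add_subgroup (V \<inter> W)"
  by (simp add: add_subgroup_def)

lemma add_subgroup_set_plus: "add_subgroup V \<Longrightarrow> add_subgroup W \<Longrightarrow> add_subgroup (V + W)"
  unfolding add_subgroup_def
proof (intro conjI ballI)
  assume V: "0 \<in> V \<and> (\<forall>x\<in>V. \<forall>y\<in>V. x - y \<in> V)" and W: "0 \<in> W \<and> (\<forall>x\<in>W. \<forall>y\<in>W. x - y \<in> W)"
  show "0 \<in> V + W" using V W set_plus_intro[of 0 V 0 W] by simp
  fix x y assume "x \<in> V + W" "y \<in> V + W"
  then obtain v w v' w' where *: "v \<in> V" "w \<in> W" "v' \<in> V" "w' \<in> W" "x = v + w" "y = v' + w'"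
    by (auto elim!: set_plus_elim)
  then have "x - y = (v - v') + (w - w')" by simp
  then show "x - y \<in> V + W" using * V W by (metis set_plus_intro)
qed

lemma add_subgroup_vecs: "add_subgroup (vecs n :: (nat \<Rightarrow> 'a::ab_group_add) set)"
  by (auto simp: add_subgroup_def vecs_def)

definition dot :: "nat \<Rightarrow> (nat \<Rightarrow> 'a::comm_ring_1) \<Rightarrow> (nat \<Rightarrow> 'a) \<Rightarrow> 'a" where
  "dot n x y = (\<Sum>i<n. x i * y i)"

lemma dot_commute: "dot n x y = dot n y x"
  by (simp add: dot_def mult.commute)

lemma dot_add_left: "dot n (x + x') y = dot n x y + dot n x' y"
  by (simp add: dot_def algebra_simps sum.distrib)

lemma dot_add_right: "dot n x (y + y') = dot n x y + dot n x y'"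
  by (simp add: dot_def algebra_simps sum.distrib)

lemma dot_diff_left: "dot n (x - x') y = dot n x y - dot n x' y"
  by (simp add: dot_def algebra_simps sum_subtractf)

lemma dot_diff_right: "dot n x (y - y') = dot n x y - dot n x y'"
  by (simp add: dot_def algebra_simps sum_subtractf)

lemma dot_zero_left [simp]: "dot n 0 y = 0"
  by (simp add: dot_def)

lemma dot_zero_right [simp]: "dot n x 0 = 0"
  by (simp add: dot_def)

definition perp :: "nat \<Rightarrow> (nat \<Rightarrow> 'a::comm_ring_1) set \<Rightarrow> (nat \<Rightarrow> 'a) set" where
  "perp n V = {x \<in> vecs n. \<forall>v\<in>V. dot n v x = 0}"

lemma add_subgroup_perp: "add_subgroup (perp n V)"
  by (auto simp: add_subgroup_def perp_def vecs_def dot_diff_right)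

lemma perp_subset_vecs: "perp n V \<subseteq> vecs n"
  by (auto simp: perp_def)

lemma bij_betw_restrict_vecs:
  "bij_betw (\<lambda>x. restrict x {..<n}) (vecs n) ({..<n} \<rightarrow>\<^sub>E (UNIV :: 'a::zero set))"
proof (rule bij_betw_byWitness[where f' = "\<lambda>g i. if i < n then g i else 0"])
  show "\<forall>x\<in>vecs n. (\<lambda>i. if i < n then restrict x {..<n} i else 0) = x"
    by (auto simp: vecs_def fun_eq_iff)
  show "\<forall>g\<in>{..<n} \<rightarrow>\<^sub>E UNIV. restrict (\<lambda>i. if i < n then g i else 0) {..<n} = g"
    by (auto simp: fun_eq_iff PiE_def extensional_def)
  show "(\<lambda>x. restrict x {..<n}) ` vecs n \<subseteq> {..<n} \<rightarrow>\<^sub>E UNIV"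
    by (auto split: if_splits)
  show "(\<lambda>g i. if i < n then g i else 0) ` ({..<n} \<rightarrow>\<^sub>E UNIV) \<subseteq> vecs n"
    by (rule image_subsetI) (simp add: vecs_def)
qed

lemma finite_vecs [simp]: "finite (vecs n :: (nat \<Rightarrow> 'a::{finite, zero}) set)"
  using bij_betw_finite[OF bij_betw_restrict_vecs[of n, where 'a = 'a]] by (auto intro: finite_PiE)

lemma card_vecs: "card (vecs n :: (nat \<Rightarrow> 'a::{finite, zero}) set) = CARD('a) ^ n"
  using bij_betw_same_card[OF bij_betw_restrict_vecs[of n, where 'a = 'a]] by (simp add: card_PiE)

lemma vecs_neq_empty [simp]: "vecs n \<noteq> ({} :: (nat \<Rightarrow> 'a::zero) set)"
proof -
  have "(\<lambda>_. 0) \<in> (vecs n :: (nat \<Rightarrow> 'a) set)" by (simp add: vecs_def)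
  then show ?thesis by blast
qed

lemma ex_dot_eq:
  assumes "x \<in> vecs n" "x \<noteq> (0 :: nat \<Rightarrow> 'a::field)"
  obtains y where "y \<in> vecs n" "dot n x y = c"
proof -
  obtain i where "x i \<noteq> 0" using assms(2) by (auto simp: fun_eq_iff)
  moreover from this have "i < n" using assms(1) by (auto simp: vecs_def not_less[symmetric])
  ultimately have i: "i < n" "x i \<noteq> 0" by auto
  define y where "y = (\<lambda>j. if j = i then c / x i else 0)"
  have "dot n x y = c" using i unfolding dot_def y_def by (simp add: if_distrib sum.delta cong: if_cong)
  moreover have "y \<in> vecs n" using i by (simp add: vecs_def y_def)
  ultimately show ?thesis using that by blast
qed

definition smul :: "'a::times \<Rightarrow> ('b \<Rightarrow> 'a) \<Rightarrow> 'b \<Rightarrow> 'a" where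
  "smul c x = (\<lambda>i. c * x i)"

lemma smul_apply [simp]: "smul c x i = c * x i"
  by (simp add: smul_def)

lemma dot_smul_left: "dot n (smul c x) y = c * dot n x y"
  by (simp add: dot_def smul_def sum_distrib_left mult_ac)

lemma dot_smul_right: "dot n x (smul c y) = c * dot n x y"
  by (simp add: dot_def smul_def sum_distrib_left mult_ac)

lemma smul_in_vecs: "x \<in> vecs n \<Longrightarrow> smul (c :: 'a::ring) x \<in> vecs n"
  by (auto simp: smul_def vecs_def)

lemma smul_of_nat: "smul (of_nat k) (x :: 'b \<Rightarrow> 'a::ring_1) = (\<Sum>i<k. x)"
  by (induction k) (auto simp: fun_eq_iff algebra_simps)

lemma mod_ring_eq_of_nat: "\<exists>k. (c :: 'p::prime_card mod_ring) = of_nat k"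
  using surj_of_nat_mod_ring by blast

lemma add_subgroup_smul:
  fixes c :: "'p::prime_card mod_ring"
  assumes "add_subgroup V" "x \<in> V"
  shows "smul c x \<in> V"
proof -
  obtain k where "c = of_nat k" using mod_ring_eq_of_nat by blast
  then have "smul c x = (\<Sum>i<k. x)" by (simp only: smul_of_nat)
  also have "\<dots> \<in> V" using assms by (intro add_subgroup_sum)
  finally show ?thesis .
qed

subsection \<open>Characters\<close>

definition chi :: "'p::prime_card mod_ring \<Rightarrow> complex" where
  "chi a = cis (2 * pi * (to_int_mod_ring a / CARD('p)))"

lemma cis_mod: "m > 0 \<Longrightarrow> cis (2 * pi * (real_of_int (k mod int m) / m)) = cis (2 * pi * (k / m))"
proof -
  assume "m > 0"
  then have "k / m = real_of_int (k mod int m) / m + of_int (k div int m)"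
    by (simp add: minus_mult_div_eq_mod[symmetric] diff_divide_distrib)
  then have "2 * pi * (k / m) = 2 * pi * (real_of_int (k mod int m) / m) + 2 * pi * of_int (k div int m)"
    by (simp only: distrib_left)
  then have "cis (2 * pi * (k / m)) = cis (2 * pi * (real_of_int (k mod int m) / m)) * cis (2 * pi * of_int (k div int m))"
    by (simp only: cis_mult)
  then show ?thesis by simp
qed

lemma chi_add: "chi (a + b) = chi a * chi (b :: 'p::prime_card mod_ring)"
proof -
  have "chi (a + b) = cis (2 * pi * (real_of_int (to_int_mod_ring a + to_int_mod_ring b) / CARD('p)))"
    unfolding chi_def to_int_mod_ring_add by (rule cis_mod) auto
  also have "\<dots> = chi a * chi b"
    by (simp add: chi_def cis_mult add_divide_distrib algebra_simps)
  finally show ?thesis .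
qed

lemma chi_0 [simp]: "chi 0 = 1"
  by (simp add: chi_def)

lemma norm_chi [simp]: "norm (chi a) = 1"
  by (simp add: chi_def)

lemma chi_nonzero [simp]: "chi a \<noteq> 0"
  using norm_chi[of a] by (metis norm_zero zero_neq_one)

lemma chi_uminus: "chi (- a) = cnj (chi a)"
proof -
  have "chi (- a) * chi a = 1" by (simp flip: chi_add)
  moreover have "cnj (chi a) * chi a = 1"
    using complex_norm_square[of "chi a"] by (simp add: mult.commute)
  ultimately show ?thesis by (metis mult_cancel_right chi_nonzero)
qed

lemma chi_diff: "chi (a - b) = chi a * cnj (chi b)"
  unfolding diff_conv_add_uminus chi_add chi_uminus ..

lemma chi_eq_1_iff: "chi a = 1 \<longleftrightarrow> a = (0 :: 'p::prime_card mod_ring)"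
proof
  assume c: "chi a = 1"
  obtain k where k: "k < CARD('p)" "a = of_nat k" using surj_of_nat_mod_ring by blast
  have "to_int_mod_ring a = int k"
    using k by (simp add: of_nat_of_int_mod_ring)
  then have "cis (2 * pi * real k / CARD('p)) = cis (2 * pi * real 0 / CARD('p))"
    using c by (simp add: chi_def)
  then have "k = 0"
    using bij_betw_roots_unity[of "CARD('p)"] k(1) unfolding bij_betw_def inj_on_def by auto
  then show "a = 0" using k by simp
qed auto

lemma sum_chi_UNIV: "(\<Sum>a\<in>UNIV. chi (a :: 'p::prime_card mod_ring)) = 0"
proof -
  have "(\<Sum>a\<in>UNIV. chi (a :: 'p mod_ring)) = (\<Sum>a\<in>UNIV. chi (1 + a :: 'p mod_ring))"
    by (rule sum.reindex_bij_witness[of _ "\<lambda>a. 1 + a" "\<lambda>a. a - 1"]) auto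
  also have "\<dots> = chi (1 :: 'p mod_ring) * (\<Sum>a\<in>UNIV. chi (a :: 'p mod_ring))"
    by (simp add: chi_add sum_distrib_left)
  finally show ?thesis using chi_eq_1_iff[of "1 :: 'p mod_ring"] by simp
qed

text \<open>Translation by an element with nonzero product multiplies the sum by a character value
  other than 1.\<close>

lemma sum_chi_subgroup:
  fixes x :: "nat \<Rightarrow> 'p::prime_card mod_ring"
  assumes V: "add_subgroup V"
  shows "(\<Sum>v\<in>V. chi (dot n x v)) = (if \<forall>v\<in>V. dot n x v = 0 then of_nat (card V) else 0)"
proof (cases "\<forall>v\<in>V. dot n x v = 0")
  case False
  then obtain w where w: "w \<in> V" "dot n x w \<noteq> 0" by blast
  have "(\<Sum>v\<in>V. chi (dot n x v)) = (\<Sum>v\<in>V. chi (dot n x (w + v)))"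
    by (rule sum.reindex_bij_witness[of _ "\<lambda>v. w + v" "\<lambda>v. v - w"])
      (use V w in \<open>auto intro: add_subgroup_add add_subgroup_diff\<close>)
  also have "\<dots> = chi (dot n x w) * (\<Sum>v\<in>V. chi (dot n x v))"
    by (simp add: chi_add dot_add_right sum_distrib_left)
  finally show ?thesis using False w chi_eq_1_iff[of "dot n x w"] by auto
qed simp

lemma sum_chi_vecs:
  fixes x :: "nat \<Rightarrow> 'p::prime_card mod_ring"
  assumes "x \<in> vecs n"
  shows "(\<Sum>y\<in>vecs n. chi (dot n x y)) = (if x = 0 then of_nat (CARD('p) ^ n) else 0)"
proof -
  have "(\<forall>v\<in>vecs n. dot n x v = 0) \<longleftrightarrow> x = 0"
    using ex_dot_eq[OF assms, of 1] by (metis dot_zero_left zero_neq_one)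
  then show ?thesis
    using sum_chi_subgroup[OF add_subgroup_vecs, of n x n] by (simp add: card_vecs)
qed

text \<open>Evaluating the sum of \<open>chi (dot n x v)\<close> over both variables in either order
  gives the duality of dimensions without choosing bases.\<close>

lemma card_perp:
  fixes V :: "(nat \<Rightarrow> 'p::prime_card mod_ring) set"
  assumes V: "add_subgroup V" "V \<subseteq> vecs n"
  shows "card V * card (perp n V) = CARD('p) ^ n"
proof -
  have fV: "finite V" by (rule finite_subset[OF V(2) finite_vecs])
  have "(\<Sum>x\<in>vecs n. \<Sum>v\<in>V. chi (dot n x v)) = (\<Sum>x\<in>vecs n. if x \<in> perp n V then of_nat (card V) else 0)"
    by (rule sum.cong) (auto simp: sum_chi_subgroup[OF V(1)] perp_def dot_commute)
  also have "\<dots> = of_nat (card V * card (perp n V))"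
    using perp_subset_vecs[of n V] by (simp add: sum.If_cases Int_absorb1 mult.commute)
  finally have 1: "(\<Sum>x\<in>vecs n. \<Sum>v\<in>V. chi (dot n x v)) = of_nat (card V * card (perp n V))" .
  have "(\<Sum>x\<in>vecs n. \<Sum>v\<in>V. chi (dot n x v)) = (\<Sum>v\<in>V. \<Sum>x\<in>vecs n. chi (dot n v x))"
    by (subst sum.swap) (simp add: dot_commute)
  also have "\<dots> = (\<Sum>v\<in>V. if v = 0 then of_nat (CARD('p) ^ n) else 0)"
  proof (rule sum.cong[OF refl])
    fix v assume "v \<in> V"
    then show "(\<Sum>x\<in>vecs n. chi (dot n v x)) = (if v = 0 then of_nat (CARD('p) ^ n) else 0)"
      using V by (intro sum_chi_vecs) auto
  qed
  also have "\<dots> = of_nat (CARD('p) ^ n)"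
    using fV add_subgroup_zero[OF V(1)] by (simp add: sum.delta)
  finally have "(of_nat (card V * card (perp n V)) :: complex) = of_nat (CARD('p) ^ n)" using 1 by simp
  then show ?thesis by (simp only: of_nat_eq_iff)
qed

text \<open>One inclusion is evident, and \<open>card_perp\<close>, applied twice, shows that the
  sizes agree.\<close>

lemma perp_perp:
  fixes V :: "(nat \<Rightarrow> 'p::prime_card mod_ring) set"
  assumes V: "add_subgroup V" "V \<subseteq> vecs n"
  shows "perp n (perp n V) = V"
proof -
  have "card (perp n V) * card (perp n (perp n V)) = card (perp n V) * card V"
    using card_perp[OF V] card_perp[OF add_subgroup_perp perp_subset_vecs, of n V] by (simp add: mult.commute)
  moreover have "card (perp n V) \<noteq> 0"
    using card_perp[OF V] by (intro notI) (simp add: eq_commute[of 0])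
  ultimately have "card V = card (perp n (perp n V))" by simp
  moreover have "V \<subseteq> perp n (perp n V)" using V by (auto simp: perp_def dot_commute)
  moreover have "finite (perp n (perp n V))" using perp_subset_vecs finite_subset by (metis finite_vecs)
  ultimately show ?thesis by (metis card_subset_eq)
qed

lemma perp_set_plus:
  assumes "0 \<in> V" "0 \<in> W"
  shows "perp n (V + W) = perp n V \<inter> perp n W"
proof -
  have "V \<subseteq> V + W" "W \<subseteq> V + W"
    using assms set_zero_plus2[of W V] set_zero_plus2[of V W] by (auto simp: add.commute)
  moreover have "x \<in> perp n (V + W)" if "x \<in> perp n V" "x \<in> perp n W" for x
    using that by (auto simp: perp_def dot_add_left elim!: set_plus_elim)
  ultimately show ?thesis by (auto simp: perp_def)
qed

lemma set_plus_subset_vecs: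
  assumes "V \<subseteq> vecs n" "W \<subseteq> (vecs n :: (nat \<Rightarrow> 'a::ab_group_add) set)"
  shows "V + W \<subseteq> vecs n"
proof
  fix x assume "x \<in> V + W"
  then obtain v w where "v \<in> V" "w \<in> W" "x = v + w" by (rule set_plus_elim)
  then show "x \<in> vecs n" using assms by (auto intro!: add_subgroup_add[OF add_subgroup_vecs])
qed

text \<open>Dual to \<open>perp_set_plus\<close> by way of \<open>perp_perp\<close>. Annihilators of
  intersections become sums, the form in which they produce additive quadruples.\<close>

lemma perp_Int:
  fixes V W :: "(nat \<Rightarrow> 'p::prime_card mod_ring) set"
  assumes V: "add_subgroup V" "V \<subseteq> vecs n" and W: "add_subgroup W" "W \<subseteq> vecs n"
  shows "perp n (V \<inter> W) = perp n V + perp n W"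
proof -
  have "perp n (perp n V + perp n W) = V \<inter> W"
    using V W by (simp add: perp_set_plus add_subgroup_zero[OF add_subgroup_perp] perp_perp)
  then show ?thesis
    using perp_perp[of "perp n V + perp n W" n] add_subgroup_set_plus[OF add_subgroup_perp add_subgroup_perp]
      set_plus_subset_vecs[OF perp_subset_vecs perp_subset_vecs] by metis
qed

subsection \<open>Almost periodicity\<close>

lemma exp_le_quadratic:
  fixes y :: real
  assumes "\<bar>y\<bar> \<le> 1"
  shows "exp y \<le> 1 + y + y ^ 2"
proof (cases "0 \<le> y")
  case True
  then show ?thesis using exp_bound[of y] assms by simp
next
  case False
  define x where "x = - y"
  have x: "0 < x" using False by (simp add: x_def)
  have "exp y = 1 / exp x" by (simp add: x_def exp_minus field_simps)
  also have "\<dots> \<le> 1 / (1 + x)" using x exp_ge_add_one_self[of x] by (intro divide_left_mono) auto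
  also have "\<dots> \<le> 1 - x + x ^ 2"
  proof -
    have "(1 - x + x ^ 2) * (1 + x) = 1 + x ^ 3" by (simp add: algebra_simps power2_eq_square power3_eq_cube)
    moreover have "0 \<le> x ^ 3" using x by simp
    ultimately show ?thesis using x by (simp add: divide_le_eq)
  qed
  finally show ?thesis by (simp add: x_def)
qed

text \<open>Mean zero removes the linear term of the quadratic bound. This moment bound for a single
  sample serves both the random sampling of \<open>A\<close> and the Chernoff bound in
  \<open>chang\<close>.\<close>

lemma sum_exp_le:
  fixes X :: "'i \<Rightarrow> real"
  assumes "finite I" "\<And>i. i \<in> I \<Longrightarrow> \<bar>X i\<bar> \<le> 1" "(\<Sum>i\<in>I. X i) = 0" "\<bar>t\<bar> \<le> 1"
  shows "(\<Sum>i\<in>I. exp (t * X i)) \<le> card I * exp (t ^ 2)"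
proof -
  have "(\<Sum>i\<in>I. exp (t * X i)) \<le> (\<Sum>i\<in>I. 1 + t * X i + t ^ 2)"
  proof (rule sum_mono)
    fix i assume i: "i \<in> I"
    have "\<bar>t * X i\<bar> \<le> 1 * 1" unfolding abs_mult using assms i by (intro mult_mono) auto
    then have "exp (t * X i) \<le> 1 + t * X i + (t * X i) ^ 2" by (intro exp_le_quadratic) simp
    moreover have "(t * X i) ^ 2 \<le> t ^ 2"
      using assms(2)[OF i] by (simp add: power_mult_distrib mult_left_le abs_square_le_1)
    ultimately show "exp (t * X i) \<le> 1 + t * X i + t ^ 2" by linarith
  qed
  also have "\<dots> = card I * (1 + t ^ 2)"
    using assms(3) by (simp add: sum.distrib sum_distrib_left[symmetric] algebra_simps)
  also have "\<dots> \<le> card I * exp (t ^ 2)"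
    by (intro mult_left_mono) (use exp_ge_add_one_self[of "t ^ 2"] in auto)
  finally show ?thesis .
qed

text \<open>Jensen's inequality, from the tangent line of \<open>exp\<close> at the mean.\<close>

lemma exp_mean_le:
  fixes f :: "'i \<Rightarrow> real"
  assumes "finite C" "C \<noteq> {}"
  shows "exp ((\<Sum>c\<in>C. f c) / card C) \<le> (\<Sum>c\<in>C. exp (f c)) / card C"
proof -
  define m where "m = (\<Sum>c\<in>C. f c) / card C"
  have C: "card C > 0" using assms by (simp add: card_gt_0_iff)
  have "(\<Sum>c\<in>C. exp m * (1 + (f c - m))) = exp m * (card C + ((\<Sum>c\<in>C. f c) - card C * m))"
    by (simp add: sum_distrib_left[symmetric] sum.distrib sum_subtractf)
  also have "\<dots> = exp m * card C" using C by (simp add: m_def)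
  finally have "exp m * card C = (\<Sum>c\<in>C. exp m * (1 + (f c - m)))" ..
  also have "\<dots> \<le> (\<Sum>c\<in>C. exp (f c))"
  proof (rule sum_mono)
    fix c
    have "exp m * (1 + (f c - m)) \<le> exp m * exp (f c - m)" using exp_ge_add_one_self[of "f c - m"] by simp
    then show "exp m * (1 + (f c - m)) \<le> exp (f c)" by (simp add: exp_diff)
  qed
  finally show ?thesis using C by (simp add: m_def field_simps)
qed

text \<open>
  Croot and Sisask sample \<open>A\<close>. Exponential moments replace the usual \<open>L^p\<close> norms, and by
  Jensen's inequality they control the error on every dense set \<open>C\<close> at once.
\<close>

lemma almost_periodicity:
  fixes G A :: "'a::ab_group_add set" and f :: "'a \<Rightarrow> real" and K e :: real and k :: nat
  defines "g \<equiv> \<lambda>x. (\<Sum>a\<in>A. f (x + a)) / card A"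
  assumes G: "add_subgroup G" "finite G" and A: "A \<subseteq> G" "A \<noteq> {}"
    and f: "\<And>x. 0 \<le> f x" "\<And>x. f x \<le> 1" and K: "card G \<le> K * card A"
    and e: "0 < e" "e \<le> 1" and k: "4 * ln (4 * K) \<le> k * e ^ 2" "k > 0"
  obtains T where "T \<subseteq> G" "card G \<le> 2 * K ^ k * card T"
    "\<And>s s' C. s \<in> T \<Longrightarrow> s' \<in> T \<Longrightarrow> C \<subseteq> G \<Longrightarrow> card G \<le> K * card C \<Longrightarrow>
       (\<Sum>c\<in>C. \<bar>g (c + s) - g (c + s')\<bar>) \<le> 2 * e * card C"
proof -
  define N where "N = real (card G)"
  have Gne: "G \<noteq> {}" using A by auto
  have N: "N > 0" using G Gne by (simp add: N_def card_gt_0_iff)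
  have fA: "finite A" using A G finite_subset by blast
  have cA: "card A > 0" using fA A by (simp add: card_gt_0_iff)
  have "real (card A) \<le> K * card A"
    using K A G card_mono[of G A] by (meson of_nat_mono order_trans)
  then have K1: "1 \<le> K" using cA by simp
  have gb: "0 \<le> g x" "g x \<le> 1" for x
  proof -
    show "0 \<le> g x" using f by (simp add: g_def sum_nonneg)
    have "(\<Sum>a\<in>A. f (x + a)) \<le> (\<Sum>a\<in>A. 1)" by (rule sum_mono) (rule f)
    then show "g x \<le> 1" using cA by (simp add: g_def divide_le_eq)
  qed
  \<comment> \<open>Accumulated sampling error at \<open>x\<close>. The entries of the tuple are
    independent, so its exponential moments factor into \<open>k\<close> equal sums over
    \<open>A\<close>.\<close>
  define S where "S a x = (\<Sum>i<k. f (x + a i) - g x)" for a :: "nat \<Rightarrow> 'a" and x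
  define t where "t = e / 2"
  have t: "0 < t" "t \<le> 1" using e by (auto simp: t_def)
  define AK where "AK = ({..<k} \<rightarrow>\<^sub>E A)"
  have AK: "finite AK" "card AK = card A ^ k" using fA by (auto simp: AK_def card_PiE intro: finite_PiE)
  have mom: "(\<Sum>a\<in>AK. exp (u * S a x)) \<le> (card A * exp (t ^ 2)) ^ k" if "\<bar>u\<bar> = t" for u x
  proof -
    have "(\<Sum>a\<in>AK. exp (u * S a x)) = (\<Sum>a\<in>AK. \<Prod>i<k. exp (u * (f (x + a i) - g x)))"
      by (simp add: S_def sum_distrib_left exp_sum)
    also have "\<dots> = (\<Prod>i<k. \<Sum>b\<in>A. exp (u * (f (x + b) - g x)))"
      unfolding AK_def using fA by (subst prod_sum_PiE) auto
    also have "\<dots> = (\<Sum>b\<in>A. exp (u * (f (x + b) - g x))) ^ k" by simp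
    also have "\<dots> \<le> (card A * exp (u ^ 2)) ^ k"
    proof (intro power_mono sum_exp_le)
      show "\<bar>f (x + b) - g x\<bar> \<le> 1" for b using f[of "x + b"] gb[of x] by linarith
      show "(\<Sum>b\<in>A. f (x + b) - g x) = 0" using cA by (simp add: sum_subtractf g_def)
    qed (use that t fA in \<open>auto intro: sum_nonneg\<close>)
    also have "u ^ 2 = t ^ 2" using that by (metis power2_abs)
    finally show ?thesis .
  qed
  \<comment> \<open>Both signs together dominate the exponential of the absolute value, and one
    number controls the errors at all points of \<open>G\<close>.\<close>
  define W where "W a = (\<Sum>x\<in>G. exp (t * S a x) + exp (- t * S a x))" for a
  define M where "M = exp (k * t ^ 2)"
  have M: "M > 0" by (simp add: M_def)
  have W0: "0 \<le> W a" for a by (simp add: W_def sum_nonneg add_nonneg_nonneg)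
  have "(\<Sum>a\<in>AK. W a) = (\<Sum>x\<in>G. (\<Sum>a\<in>AK. exp (t * S a x)) + (\<Sum>a\<in>AK. exp (- t * S a x)))"
    unfolding W_def by (subst sum.swap) (simp add: sum.distrib)
  also have "\<dots> \<le> (\<Sum>x\<in>G. (card A * exp (t ^ 2)) ^ k + (card A * exp (t ^ 2)) ^ k)"
    by (intro sum_mono add_mono mom) (use t in auto)
  also have "\<dots> = 2 * N * card A ^ k * M"
    by (simp add: N_def M_def power_mult_distrib exp_of_nat_mult[symmetric])
  finally have sumW: "(\<Sum>a\<in>AK. W a) \<le> 2 * N * card A ^ k * M" .
  \<comment> \<open>The threshold is twice the bound for the mean, so by Markov's inequality at
    least half of the samples are kept.\<close>
  define Q where "Q = {a \<in> AK. W a \<le> 4 * N * M}"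
  have Q: "Q \<subseteq> AK" "finite Q" using AK by (auto simp: Q_def)
  have "card (AK - Q) * (4 * N * M) = (\<Sum>a\<in>AK - Q. 4 * N * M)" by simp
  also have "\<dots> \<le> (\<Sum>a\<in>AK - Q. W a)" by (rule sum_mono) (auto simp: Q_def)
  also have "\<dots> \<le> (\<Sum>a\<in>AK. W a)" by (rule sum_mono2) (use AK W0 in auto)
  also note sumW
  finally have "card (AK - Q) * (4 * N * M) \<le> (card A ^ k / 2) * (4 * N * M)" by (simp add: mult_ac)
  then have "card (AK - Q) \<le> real (card A ^ k) / 2"
    by (rule mult_right_le_imp_le) (use N M in simp)
  moreover have "real (card (AK - Q)) = real (card A ^ k) - card Q"
    using Q AK card_mono[OF AK(1) Q(1)] by (simp add: card_Diff_subset of_nat_diff del: of_nat_power)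
  ultimately have cQ: "real (card A ^ k) / 2 \<le> card Q" by linarith
  have good: "(\<Sum>c\<in>C. \<bar>S a c\<bar>) \<le> e * k * card C" if a: "a \<in> Q" and C: "C \<subseteq> G" "N \<le> K * card C" for a C
  proof -
    have fC: "finite C" using C G finite_subset by blast
    have Cne: "C \<noteq> {}" using C N by auto
    have C0: "card C > 0" using fC Cne by (simp add: card_gt_0_iff)
    have "exp ((\<Sum>c\<in>C. t * \<bar>S a c\<bar>) / card C) \<le> (\<Sum>c\<in>C. exp (t * \<bar>S a c\<bar>)) / card C"
      by (rule exp_mean_le[OF fC Cne])
    also have "\<dots> \<le> W a / card C"
    proof (rule divide_right_mono)
      have "(\<Sum>c\<in>C. exp (t * \<bar>S a c\<bar>)) \<le> (\<Sum>c\<in>C. exp (t * S a c) + exp (- t * S a c))"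
        by (rule sum_mono) (auto simp: abs_if)
      also have "\<dots> \<le> W a" unfolding W_def by (rule sum_mono2) (use C G in \<open>auto simp: add_nonneg_nonneg\<close>)
      finally show "(\<Sum>c\<in>C. exp (t * \<bar>S a c\<bar>)) \<le> W a" .
    qed simp
    also have "\<dots> \<le> (4 * N * M) / card C" using a by (intro divide_right_mono) (auto simp: Q_def)
    also have "\<dots> \<le> 4 * K * M"
      using C(2) C0 M by (simp add: divide_le_eq mult_right_mono mult_ac)
    also have "\<dots> = exp (ln (4 * K) + k * t ^ 2)"
      using K1 by (simp add: exp_add M_def)
    finally have "(\<Sum>c\<in>C. t * \<bar>S a c\<bar>) / card C \<le> ln (4 * K) + k * t ^ 2" by simp
    \<comment> \<open>The size of \<open>k\<close> makes the entropy term \<open>ln (4 * K)\<close>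
      at most as large as the variance term \<open>k * t ^ 2\<close> for \<open>t = e / 2\<close>;
      together they are at most \<open>t * (e * k)\<close>.\<close>
    also have "\<dots> \<le> k * e ^ 2 / 4 + k * e ^ 2 / 4"
      using k(1) by (simp add: t_def power_divide)
    also have "\<dots> = t * (e * k)" by (simp add: t_def power2_eq_square)
    finally have "t * (\<Sum>c\<in>C. \<bar>S a c\<bar>) \<le> t * (e * k) * card C"
      using C0 by (simp add: divide_le_eq sum_distrib_left)
    then show ?thesis using t by simp
  qed
  define GK where "GK = ({..<k} \<rightarrow>\<^sub>E G)"
  have GK: "finite GK" "card GK = card G ^ k" "GK \<noteq> {}"
    using G Gne by (auto simp: GK_def card_PiE PiE_eq_empty_iff intro: finite_PiE)
  \<comment> \<open>Pigeonhole over a base tuple \<open>b\<close>: adding any \<open>s\<close> to a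
    good tuple gives a tuple over \<open>G\<close>, so some \<open>b\<close> arises from good tuples
    for many \<open>s\<close>. For all these \<open>s\<close> the translate of \<open>g\<close> is
    close to the same empirical mean \<open>h\<close>, which does not depend on
    \<open>s\<close>.\<close>
  define sh where "sh b s = restrict (\<lambda>i. b i - s) {..<k}" for b :: "nat \<Rightarrow> 'a" and s
  have cs: "card Q \<le> card {b \<in> GK. sh b s \<in> Q}" if s: "s \<in> G" for s
  proof (rule card_inj_on_le[of "\<lambda>a. restrict (\<lambda>i. a i + s) {..<k}"])
    show "inj_on (\<lambda>a. restrict (\<lambda>i. a i + s) {..<k}) Q"
    proof (rule inj_onI)
      fix a b assume ab: "a \<in> Q" "b \<in> Q" "restrict (\<lambda>i. a i + s) {..<k} = restrict (\<lambda>i. b i + s) {..<k}"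
      have "a i = b i" if "i < k" for i
        using fun_cong[OF ab(3), of i] that by simp
      then show "a = b" using ab Q by (intro PiE_ext[of a "{..<k}" "\<lambda>_. A" b]) (auto simp: AK_def)
    qed
    have "sh (restrict (\<lambda>i. a i + s) {..<k}) s = a" if "a \<in> Q" for a
      using that Q by (auto simp: sh_def AK_def PiE_def extensional_def fun_eq_iff)
    moreover have "restrict (\<lambda>i. a i + s) {..<k} \<in> GK" if "a \<in> Q" for a
    proof -
      have "a i \<in> G" if "i < k" for i using \<open>a \<in> Q\<close> Q A that by (auto simp: AK_def PiE_iff)
      then show ?thesis using s by (auto simp: GK_def intro: add_subgroup_add[OF G(1)])
    qed
    ultimately show "(\<lambda>a. restrict (\<lambda>i. a i + s) {..<k}) ` Q \<subseteq> {b \<in> GK. sh b s \<in> Q}" by auto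
  qed (use GK in auto)
  have "\<exists>b\<in>GK. card Q * card G \<le> card {s \<in> G. sh b s \<in> Q} * card G ^ k"
  proof (rule ccontr)
    assume "\<not> ?thesis"
    then have "(\<Sum>b\<in>GK. card {s \<in> G. sh b s \<in> Q} * card G ^ k) < (\<Sum>b\<in>GK. card Q * card G)"
      using GK by (intro sum_strict_mono) (auto simp: not_le)
    also have "\<dots> = card G ^ k * (card G * card Q)" using GK by simp
    also have "card G * card Q \<le> (\<Sum>s\<in>G. card {b \<in> GK. sh b s \<in> Q})"
      using sum_mono[of G "\<lambda>_. card Q", OF cs] by simp
    also have "\<dots> = (\<Sum>b\<in>GK. card {s \<in> G. sh b s \<in> Q})"
      using G GK by (intro sum_card_swap) auto
    finally show False by (simp add: sum_distrib_left mult.commute)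
  qed
  then obtain b where b: "b \<in> GK" "card Q * card G \<le> card {s \<in> G. sh b s \<in> Q} * card G ^ k" by blast
  define T where "T = {s \<in> G. sh b s \<in> Q}"
  define h where "h c = (\<Sum>i<k. f (c + b i)) / k" for c
  have close: "(\<Sum>c\<in>C. \<bar>g (c + s) - h c\<bar>) \<le> e * card C" if s: "s \<in> T" and C: "C \<subseteq> G" "card G \<le> K * card C" for s C
  proof -
    have sG: "s \<in> G" "sh b s \<in> Q" using s by (auto simp: T_def)
    have cC: "card ((\<lambda>c. c + s) ` C) = card C" by (simp add: card_image inj_on_def)
    have Sh: "S (sh b s) (c + s) = k * (h c - g (c + s))" for c
    proof -
      have "S (sh b s) (c + s) = (\<Sum>i<k. f (c + b i) - g (c + s))"
        unfolding S_def by (rule sum.cong) (auto simp: sh_def algebra_simps)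
      moreover have "(\<Sum>i<k. f (c + b i)) = k * h c" using k(2) by (simp add: h_def)
      ultimately show ?thesis by (simp add: sum_subtractf right_diff_distrib)
    qed
    have "k * (\<Sum>c\<in>C. \<bar>g (c + s) - h c\<bar>) = (\<Sum>c\<in>C. \<bar>S (sh b s) (c + s)\<bar>)"
      by (simp add: Sh abs_mult sum_distrib_left abs_minus_commute)
    also have "\<dots> = (\<Sum>c\<in>(\<lambda>c. c + s) ` C. \<bar>S (sh b s) c\<bar>)"
      by (subst sum.reindex) (auto simp: inj_on_def)
    also have "\<dots> \<le> e * k * card ((\<lambda>c. c + s) ` C)"
      by (rule good) (use sG C cC add_subgroup_add[OF G(1)] in \<open>auto simp: N_def\<close>)
    also have "\<dots> = k * (e * card C)" using cC by simp
    finally show ?thesis using k(2) by simp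
  qed
  show ?thesis
  proof (rule that[of T])
    have "real (card A ^ k) / 2 * real (card G) \<le> real (card Q) * real (card G)"
      using cQ by (intro mult_right_mono) auto
    also have "\<dots> = real (card Q * card G)" by simp
    also have "\<dots> \<le> real (card T * card G ^ k)"
      using b(2) unfolding T_def of_nat_le_iff .
    also have "\<dots> \<le> card T * (K * card A) ^ k"
      using K by (simp add: power_mono mult_left_mono)
    finally have "card A ^ k * real (card G) \<le> card A ^ k * (2 * K ^ k * card T)"
      by (simp add: power_mult_distrib mult_ac)
    then show "card G \<le> 2 * K ^ k * card T" using cA by simp
    fix s s' C assume s: "s \<in> T" "s' \<in> T" and C: "C \<subseteq> G" "card G \<le> K * card C"
    have "(\<Sum>c\<in>C. \<bar>g (c + s) - g (c + s')\<bar>) \<le> (\<Sum>c\<in>C. \<bar>g (c + s) - h c\<bar> + \<bar>g (c + s') - h c\<bar>)"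
      by (rule sum_mono) linarith
    also have "\<dots> \<le> e * card C + e * card C"
      unfolding sum.distrib using close[OF s(1) C] close[OF s(2) C] by linarith
    finally show "(\<Sum>c\<in>C. \<bar>g (c + s) - g (c + s')\<bar>) \<le> 2 * e * card C" by simp
  qed (auto simp: T_def)
qed

subsection \<open>Fourier analysis\<close>

definition ft :: "nat \<Rightarrow> ((nat \<Rightarrow> 'p::prime_card mod_ring) \<Rightarrow> real) \<Rightarrow> (nat \<Rightarrow> 'p mod_ring) \<Rightarrow> complex" where
  "ft n f z = (\<Sum>x\<in>vecs n. of_real (f x) * chi (dot n z x))"

text \<open>The Fourier transform of the uniform probability measure on \<open>S\<close>.\<close>

definition mu :: "nat \<Rightarrow> (nat \<Rightarrow> 'p::prime_card mod_ring) set \<Rightarrow> (nat \<Rightarrow> 'p mod_ring) \<Rightarrow> complex" where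
  "mu n S z = (\<Sum>s\<in>S. chi (dot n z s)) / of_nat (card S)"

definition avg :: "'a::ab_group_add set \<Rightarrow> ('a \<Rightarrow> real) \<Rightarrow> 'a \<Rightarrow> real" where
  "avg S f x = (\<Sum>s\<in>S. f (x + s)) / card S"

text \<open>Averaging over the differences of \<open>T\<close> has the nonnegative Fourier
  multiplier \<open>norm (mu n T z) ^ 2\<close>; iterating it suppresses the frequencies outside the
  large spectrum of \<open>T\<close>.\<close>

definition smooth :: "'a::ab_group_add set \<Rightarrow> ('a \<Rightarrow> real) \<Rightarrow> 'a \<Rightarrow> real" where
  "smooth T f x = (\<Sum>s\<in>T. \<Sum>s'\<in>T. f (x + s - s')) / card T ^ 2"

lemma ft_parseval:
  fixes f g :: "(nat \<Rightarrow> 'p::prime_card mod_ring) \<Rightarrow> real"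
  shows "(\<Sum>z\<in>vecs n. ft n f z * cnj (ft n g z)) = of_real (CARD('p) ^ n * (\<Sum>x\<in>vecs n. f x * g x))"
proof -
  have "(\<Sum>z\<in>vecs n. ft n f z * cnj (ft n g z)) =
      (\<Sum>z\<in>vecs n. \<Sum>x\<in>vecs n. \<Sum>y\<in>vecs n. of_real (f x * g y) * chi (dot n (x - y) z))"
    unfolding ft_def cnj_sum sum_product
  proof (intro sum.cong refl)
    fix z x y :: "nat \<Rightarrow> 'p mod_ring"
    show "of_real (f x) * chi (dot n z x) * cnj (of_real (g y) * chi (dot n z y)) =
        of_real (f x * g y) * chi (dot n (x - y) z)"
      by (simp add: dot_diff_left chi_diff dot_commute[of n z])
  qed
  also have "\<dots> = (\<Sum>x\<in>vecs n. \<Sum>y\<in>vecs n. of_real (f x * g y) * (\<Sum>z\<in>vecs n. chi (dot n (x - y) z)))"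
    unfolding sum_distrib_left
    by (subst sum.swap, rule sum.cong[OF refl], subst sum.swap, rule refl)
  also have "\<dots> = (\<Sum>x\<in>vecs n. \<Sum>y\<in>vecs n. if y = x then of_real (f x * g x) * of_nat (CARD('p) ^ n) else 0)"
  proof (intro sum.cong refl)
    fix x y :: "nat \<Rightarrow> 'p mod_ring" assume "x \<in> vecs n" "y \<in> vecs n"
    then have "x - y \<in> vecs n" by (rule add_subgroup_diff[OF add_subgroup_vecs])
    then show "of_real (f x * g y) * (\<Sum>z\<in>vecs n. chi (dot n (x - y) z)) =
        (if y = x then of_real (f x * g x) * of_nat (CARD('p) ^ n) else 0)"
      by (simp add: sum_chi_vecs)
  qed
  also have "\<dots> = (\<Sum>x\<in>vecs n. of_real (f x * g x) * of_nat (CARD('p) ^ n))"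
    by (intro sum.cong refl) (simp add: sum.delta)
  finally show ?thesis by (simp add: sum_distrib_left mult_ac)
qed

lemma sum_vecs_shift:
  fixes f :: "(nat \<Rightarrow> 'a::{finite, ab_group_add}) \<Rightarrow> 'b::comm_monoid_add"
  assumes "u \<in> vecs n"
  shows "(\<Sum>x\<in>vecs n. f (x + u)) = (\<Sum>x\<in>vecs n. f x)"
  by (rule sum.reindex_bij_witness[of _ "\<lambda>x. x - u" "\<lambda>x. x + u"])
    (use assms in \<open>auto intro: add_subgroup_add[OF add_subgroup_vecs] add_subgroup_diff[OF add_subgroup_vecs]\<close>)

lemma ft_shift:
  assumes "u \<in> vecs n"
  shows "ft n (\<lambda>x. f (x + u)) z = cnj (chi (dot n z u)) * ft n f z"
proof -
  have "ft n (\<lambda>x. f (x + u)) z = (\<Sum>x\<in>vecs n. of_real (f (x + u)) * chi (dot n z (x + u - u)))"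
    by (simp add: ft_def)
  also have "\<dots> = (\<Sum>x\<in>vecs n. of_real (f x) * chi (dot n z (x - u)))"
    using assms by (rule sum_vecs_shift)
  also have "\<dots> = cnj (chi (dot n z u)) * ft n f z"
    unfolding ft_def sum_distrib_left
    by (intro sum.cong refl) (simp add: dot_diff_right chi_diff)
  finally show ?thesis .
qed

lemma ft_sum: "finite I \<Longrightarrow> ft n (\<lambda>x. \<Sum>i\<in>I. f i x) z = (\<Sum>i\<in>I. ft n (f i) z)"
  unfolding ft_def of_real_sum sum_distrib_right by (rule sum.swap)

lemma ft_divide: "ft n (\<lambda>x. f x / c) z = ft n f z / of_real c"
  by (simp add: ft_def sum_divide_distrib)

lemma ft_diff: "ft n (\<lambda>x. f x - g x) z = ft n f z - ft n g z"
  by (simp add: ft_def left_diff_distrib sum_subtractf)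

lemma ft_avg:
  assumes "S \<subseteq> vecs n"
  shows "ft n (avg S f) z = cnj (mu n S z) * ft n f z"
proof -
  have fS: "finite S" using assms finite_subset finite_vecs by blast
  have "ft n (avg S f) z = (\<Sum>s\<in>S. ft n (\<lambda>x. f (x + s)) z) / of_nat (card S)"
    unfolding avg_def ft_divide ft_sum[OF fS] by simp
  also have "(\<Sum>s\<in>S. ft n (\<lambda>x. f (x + s)) z) = (\<Sum>s\<in>S. cnj (chi (dot n z s)) * ft n f z)"
    by (intro sum.cong refl ft_shift) (use assms in auto)
  finally show ?thesis by (simp add: mu_def sum_distrib_right)
qed

lemma ft_smooth:
  assumes "T \<subseteq> vecs n"
  shows "ft n (smooth T f) z = of_real (norm (mu n T z) ^ 2) * ft n f z"
proof -
  have fT: "finite T" using assms finite_subset finite_vecs by blast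
  have "ft n (smooth T f) z = (\<Sum>s\<in>T. \<Sum>s'\<in>T. ft n (\<lambda>x. f (x + s - s')) z) / of_nat (card T ^ 2)"
    unfolding smooth_def ft_divide ft_sum[OF fT] by simp
  also have "(\<Sum>s\<in>T. \<Sum>s'\<in>T. ft n (\<lambda>x. f (x + s - s')) z)
      = (\<Sum>s\<in>T. \<Sum>s'\<in>T. (cnj (chi (dot n z s)) * chi (dot n z s')) * ft n f z)"
  proof (intro sum.cong refl)
    fix s s' assume "s \<in> T" "s' \<in> T"
    then have "s - s' \<in> vecs n" using assms add_subgroup_diff[OF add_subgroup_vecs] by blast
    from ft_shift[OF this, of f z]
    show "ft n (\<lambda>x. f (x + s - s')) z = (cnj (chi (dot n z s)) * chi (dot n z s')) * ft n f z"
      by (simp add: add_diff_eq dot_diff_right chi_diff)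
  qed
  also have "\<dots> = cnj (\<Sum>s\<in>T. chi (dot n z s)) * (\<Sum>s\<in>T. chi (dot n z s)) * ft n f z"
  proof -
    have "cnj (\<Sum>s\<in>T. chi (dot n z s)) * (\<Sum>s\<in>T. chi (dot n z s)) =
        (\<Sum>s\<in>T. \<Sum>s'\<in>T. cnj (chi (dot n z s)) * chi (dot n z s'))"
      by (simp only: cnj_sum sum_product)
    then show ?thesis by (simp only: sum_distrib_right)
  qed
  finally have "ft n (smooth T f) z = (mu n T z * cnj (mu n T z)) * ft n f z"
    by (simp add: mu_def power2_eq_square mult_ac)
  then show ?thesis by (simp only: complex_norm_square)
qed

lemma ft_smooth_iterate:
  assumes "T \<subseteq> vecs n"
  shows "ft n ((smooth T ^^ l) f) z = of_real (norm (mu n T z) ^ (2 * l)) * ft n f z"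
  by (induction l) (simp_all add: ft_smooth[OF assms] power_add power2_eq_square mult_ac)

lemma norm_ft_indicator_le: "norm (ft n (\<lambda>x. of_bool (x \<in> D)) (z :: nat \<Rightarrow> 'p::prime_card mod_ring)) \<le> CARD('p) ^ n"
proof -
  have "norm (ft n (\<lambda>x. of_bool (x \<in> D)) z) \<le> (\<Sum>x\<in>(vecs n :: (nat \<Rightarrow> 'p mod_ring) set). 1)"
    unfolding ft_def by (rule order_trans[OF norm_sum]) (rule sum_mono, auto simp: norm_mult)
  then show ?thesis by (simp add: card_vecs)
qed

lemma ft_indicator:
  assumes "A \<subseteq> vecs n"
  shows "ft n (\<lambda>x. of_bool (x \<in> A)) z = of_nat (card A) * mu n A z"
proof -
  have fA: "finite A" using assms finite_subset finite_vecs by blast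
  have "ft n (\<lambda>x. of_bool (x \<in> A)) z = (\<Sum>x\<in>vecs n. if x \<in> A then chi (dot n z x) else 0)"
    unfolding ft_def by (intro sum.cong) auto
  also have "\<dots> = (\<Sum>x\<in>A. chi (dot n z x))"
    using assms by (simp add: sum.If_cases Int_absorb1)
  finally show ?thesis using fA by (cases "A = {}") (auto simp: mu_def)
qed

lemma sum_norm_mu_squared:
  fixes A :: "(nat \<Rightarrow> 'p::prime_card mod_ring) set"
  assumes "A \<subseteq> vecs n" "A \<noteq> {}"
  shows "(\<Sum>z\<in>vecs n. norm (mu n A z) ^ 2) * card A = CARD('p) ^ n"
proof -
  have fA: "finite A" using assms finite_subset finite_vecs by blast
  define i where "i x = (of_bool (x \<in> A) :: real)" for x
  have "(\<Sum>z\<in>vecs n. ft n i z * cnj (ft n i z)) = of_real (CARD('p) ^ n * (\<Sum>x\<in>vecs n. i x * i x))"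
    by (rule ft_parseval)
  also have "(\<Sum>x\<in>vecs n. i x * i x) = (\<Sum>x\<in>vecs n. if x \<in> A then 1 else 0)"
    by (intro sum.cong) (auto simp: i_def)
  also have "\<dots> = card A" using assms by (simp add: sum.If_cases Int_absorb1)
  also have "(\<Sum>z\<in>vecs n. ft n i z * cnj (ft n i z)) = of_real (card A ^ 2 * (\<Sum>z\<in>vecs n. norm (mu n A z) ^ 2))"
    unfolding i_def ft_indicator[OF assms(1)] of_real_mult of_real_sum sum_distrib_left
  proof (intro sum.cong refl)
    fix z
    show "of_nat (card A) * mu n A z * cnj (of_nat (card A) * mu n A z) =
        of_real (real (card A ^ 2)) * of_real (norm (mu n A z) ^ 2)"
      unfolding complex_norm_square by (simp add: power2_eq_square mult_ac)
  qed
  finally have "card A ^ 2 * (\<Sum>z\<in>vecs n. norm (mu n A z) ^ 2) = CARD('p) ^ n * real (card A)"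
    by (simp only: of_real_eq_iff)
  then show ?thesis using fA assms by (simp add: power2_eq_square mult_ac)
qed

section \<open>Large spectra and Chang's bound\<close>

text \<open>Every \<open>x\<close> splits into a kernel element and the multiple
  \<open>h x / h v\<close> of \<open>v\<close>. One further independent condition thus shows as an
  exact factor of the size, which takes the place of a dimension count.\<close>

lemma card_kernel_functional:
  fixes W :: "(nat \<Rightarrow> 'p::prime_card mod_ring) set" and h :: "(nat \<Rightarrow> 'p mod_ring) \<Rightarrow> 'p mod_ring"
  assumes W: "add_subgroup W" and v: "v \<in> W" "h v \<noteq> 0"
    and h: "\<And>x y. h (x + y) = h x + h y" "\<And>c x. h (smul c x) = c * h x"
  shows "card W = CARD('p) * card {x \<in> W. h x = 0}"
proof -
  have hd: "h (x - y) = h x - h y" for x y using h(1)[of "x - y" y] by simp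
  have "bij_betw (\<lambda>(x, c). x + smul c v) ({x \<in> W. h x = 0} \<times> UNIV) W"
    by (rule bij_betw_byWitness[where f' = "\<lambda>x. (x - smul (h x / h v) v, h x / h v)"])
      (use W v in \<open>auto simp: h hd intro!: add_subgroup_add[OF W] add_subgroup_diff[OF W] add_subgroup_smul[OF W]\<close>)
  from bij_betw_same_card[OF this] show ?thesis by (simp add: card_cartesian_product mult.commute)
qed

lemma perp_insert: "perp n (insert z Z) = {x \<in> perp n Z. dot n z x = 0}"
  by (auto simp: perp_def)

text \<open>A fibre of the map to the tuple of values is empty or a translate of the common
  annihilator, so the values may be treated as independent and uniform.\<close>

lemma sum_prod_dot_le:
  fixes zs :: "nat \<Rightarrow> nat \<Rightarrow> 'p::prime_card mod_ring" and F :: "nat \<Rightarrow> 'p mod_ring \<Rightarrow> real"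
  assumes F: "\<And>i c. 0 \<le> F i c"
  shows "(\<Sum>x\<in>vecs n. \<Prod>i<r. F i (dot n (zs i) x)) \<le> card (perp n (zs ` {..<r})) * (\<Prod>i<r. \<Sum>c\<in>UNIV. F i c)"
proof -
  define W where "W = perp n (zs ` {..<r})"
  define P where "P = ({..<r} \<rightarrow>\<^sub>E (UNIV :: 'p mod_ring set))"
  have fP: "finite P" unfolding P_def by (intro finite_PiE) auto
  have fW: "finite W" unfolding W_def by (rule finite_subset[OF perp_subset_vecs finite_vecs])
  define m where "m x = restrict (\<lambda>i. dot n (zs i) x) {..<r}" for x
  have fib: "card {x \<in> vecs n. m x = y} \<le> card W" for y
  proof (cases "{x \<in> vecs n. m x = y} = {}")
    case False
    then obtain x0 where x0: "x0 \<in> vecs n" "m x0 = y" by blast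
    show ?thesis
    proof (rule card_inj_on_le[of "\<lambda>x. x - x0"])
      show "(\<lambda>x. x - x0) ` {x \<in> vecs n. m x = y} \<subseteq> W"
      proof clarify
        fix x assume x: "x \<in> vecs n" "y = m x"
        have "dot n (zs i) x = dot n (zs i) x0" if "i < r" for i
        proof -
          have "m x i = m x0 i" using x x0 by simp
          then show ?thesis using that by (simp add: m_def)
        qed
        then show "x - x0 \<in> W" using x x0 add_subgroup_diff[OF add_subgroup_vecs]
          by (auto simp: W_def perp_def dot_diff_right)
      qed
    qed (use fW in \<open>auto simp: inj_on_def\<close>)
  next
    case True
    then show ?thesis by (metis card.empty zero_le)
  qed
  have "(\<Sum>x\<in>vecs n. \<Prod>i<r. F i (dot n (zs i) x)) = (\<Sum>x\<in>vecs n. \<Prod>i<r. F i (m x i))"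
    by (intro sum.cong prod.cong) (auto simp: m_def)
  also have "\<dots> = (\<Sum>y\<in>P. \<Sum>x\<in>{x \<in> vecs n. m x = y}. \<Prod>i<r. F i (m x i))"
    by (rule sum.group[symmetric]) (use fP in \<open>auto simp: m_def P_def split: if_splits\<close>)
  also have "\<dots> = (\<Sum>y\<in>P. card {x \<in> vecs n. m x = y} * (\<Prod>i<r. F i (y i)))"
    by (intro sum.cong refl) simp
  also have "\<dots> \<le> (\<Sum>y\<in>P. card W * (\<Prod>i<r. F i (y i)))"
    using fib by (intro sum_mono mult_right_mono) (auto intro: prod_nonneg F)
  also have "\<dots> = card W * (\<Prod>i<r. \<Sum>c\<in>UNIV. F i c)"
    unfolding P_def by (subst prod_sum_PiE) (auto simp: sum_distrib_left)
  finally show ?thesis by (simp add: W_def)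
qed

text \<open>
  Linearly independent frequencies make the values \<open>dot n z x\<close> independent and uniform, so a
  Chernoff bound shows that few of them can be biased on \<open>T\<close>.
\<close>

theorem chang:
  fixes T :: "(nat \<Rightarrow> 'p::prime_card mod_ring) set"
  assumes T: "T \<subseteq> vecs n" "T \<noteq> {}"
  obtains V r where "add_subgroup V" "V \<subseteq> vecs n" "card V * CARD('p) ^ r = CARD('p) ^ n"
    "real r \<le> 16 * ln (CARD('p) ^ n / card T)"
    "\<And>z v. z \<in> vecs n \<Longrightarrow> 1 / 2 \<le> norm (mu n T z) \<Longrightarrow> v \<in> V \<Longrightarrow> dot n z v = 0"
proof -
  define Spec where "Spec = {z \<in> vecs n. 1 / 2 \<le> norm (mu n T z)}"
  have fT: "finite T" using T finite_subset finite_vecs by blast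
  have T0: "card T > 0" using fT T by (simp add: card_gt_0_iff)
  \<comment> \<open>Linear independence of \<open>r\<close> frequencies of the spectrum, expressed
    through the size of their common annihilator.\<close>
  define ok where "ok r \<longleftrightarrow> (\<exists>zs. zs ` {..<r} \<subseteq> Spec \<and> card (perp n (zs ` {..<r})) * CARD('p) ^ r = CARD('p) ^ n)" for r
  have p1: "1 < CARD('p)" using prime_card[where 'a = 'p] prime_gt_1_nat by blast
  have "ok 0" by (simp add: ok_def perp_def card_vecs)
  moreover have "r \<le> n" if "ok r" for r
  proof -
    obtain W where "card (W :: (nat \<Rightarrow> 'p mod_ring) set) * CARD('p) ^ r = CARD('p) ^ n"
      using \<open>ok r\<close> by (auto simp: ok_def)
    then have "CARD('p) ^ r dvd CARD('p) ^ n" by (metis dvd_triv_right)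
    then show ?thesis using p1 by (simp add: power_dvd_imp_le)
  qed
  ultimately obtain r where r: "ok r" and max: "\<And>r'. ok r' \<Longrightarrow> r' \<le> r"
    using GreatestI_nat[of ok 0 n] Greatest_le_nat[of ok _ n] by blast
  from r obtain zs where zs: "zs ` {..<r} \<subseteq> Spec" "card (perp n (zs ` {..<r})) * CARD('p) ^ r = CARD('p) ^ n"
    by (auto simp: ok_def)
  define V where "V = perp n (zs ` {..<r})"
  \<comment> \<open>A frequency of the spectrum not vanishing on \<open>V\<close> would cut
    \<open>V\<close> by exactly the factor \<open>CARD('p)\<close> and extend a maximal independent
    family.\<close>
  have ann: "dot n z v = 0" if z: "z \<in> Spec" and v: "v \<in> V" for z v
  proof (rule ccontr)
    assume nz: "dot n z v \<noteq> 0"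
    define zs' where "zs' = zs(r := z)"
    have im: "zs' ` {..<Suc r} = insert z (zs ` {..<r})" by (auto simp: zs'_def lessThan_Suc)
    have "card V = CARD('p) * card {x \<in> V. dot n z x = 0}"
      by (rule card_kernel_functional[of V v "dot n z"])
        (use v nz in \<open>auto simp: V_def add_subgroup_perp dot_add_right dot_smul_right\<close>)
    then have "card (perp n (zs' ` {..<Suc r})) * CARD('p) ^ Suc r = CARD('p) ^ n"
      using zs(2) by (simp add: im perp_insert V_def mult_ac)
    moreover have "zs' ` {..<Suc r} \<subseteq> Spec" using im z zs by auto
    ultimately have "ok (Suc r)" unfolding ok_def by blast
    then show False using max by fastforce
  qed
  \<comment> \<open>The phase that turns \<open>mu n T (zs i)\<close> into its absolute
    value.\<close>
  define c where "c i = cnj (mu n T (zs i)) / of_real (norm (mu n T (zs i)))" for i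
  have nc: "norm (c i) = 1" if "i < r" for i
  proof -
    have "1 / 2 \<le> norm (mu n T (zs i))" using zs that by (auto simp: Spec_def)
    then show ?thesis by (auto simp: c_def norm_divide)
  qed
  have cm: "1 / 2 \<le> Re (c i * mu n T (zs i))" if "i < r" for i
  proof -
    have g: "1 / 2 \<le> norm (mu n T (zs i))" using zs that by (auto simp: Spec_def)
    have "c i * mu n T (zs i) = of_real (norm (mu n T (zs i)) ^ 2) / of_real (norm (mu n T (zs i)))"
      by (simp only: c_def complex_norm_square times_divide_eq_left mult.commute[of "cnj _"])
    also have "\<dots> = of_real (norm (mu n T (zs i)))"
      using g by (simp add: power2_eq_square)
    finally show ?thesis using g by simp
  qed
  define R where "R i b = Re (c i * chi b)" for i and b :: "'p mod_ring"
  have sR: "(\<Sum>x\<in>T. R i (dot n (zs i) x)) / card T = Re (c i * mu n T (zs i))" for i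
    by (simp add: R_def mu_def sum_distrib_left Re_divide_of_nat)
  \<comment> \<open>With weight \<open>1 / 4\<close> on each frequency the bias contributes at least
    \<open>r / 8\<close> to the exponent, while independence allows at most \<open>r / 16\<close>,
    that is \<open>(1 / 4) ^ 2\<close> for each. The gap \<open>r / 16\<close> is the source of the
    constant 16.\<close>
  have "exp (r / 8) * card T \<le> exp ((\<Sum>x\<in>T. \<Sum>i<r. 1 / 4 * R i (dot n (zs i) x)) / card T) * card T"
  proof -
    have "(\<Sum>x\<in>T. \<Sum>i<r. 1 / 4 * R i (dot n (zs i) x)) / card T = (\<Sum>i<r. 1 / 4 * Re (c i * mu n T (zs i)))"
    proof -
      have "(\<Sum>x\<in>T. \<Sum>i<r. 1 / 4 * R i (dot n (zs i) x)) / card T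
          = (\<Sum>i<r. 1 / 4 * ((\<Sum>x\<in>T. R i (dot n (zs i) x)) / card T))"
        by (subst sum.swap) (simp add: sum_divide_distrib sum_distrib_left)
      then show ?thesis by (simp only: sR)
    qed
    also have "\<dots> \<ge> (\<Sum>i<r. 1 / 4 * (1 / 2))" using cm by (intro sum_mono mult_left_mono) auto
    finally have "r / 8 \<le> (\<Sum>x\<in>T. \<Sum>i<r. 1 / 4 * R i (dot n (zs i) x)) / card T" by simp
    then show ?thesis by (intro mult_right_mono) auto
  qed
  also have "\<dots> \<le> (\<Sum>x\<in>T. exp (\<Sum>i<r. 1 / 4 * R i (dot n (zs i) x)))"
    using exp_mean_le[OF fT T(2)] T0 by (simp add: le_divide_eq)
  also have "\<dots> \<le> (\<Sum>x\<in>vecs n. exp (\<Sum>i<r. 1 / 4 * R i (dot n (zs i) x)))"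
    by (rule sum_mono2) (use T in auto)
  also have "\<dots> = (\<Sum>x\<in>vecs n. \<Prod>i<r. exp (1 / 4 * R i (dot n (zs i) x)))"
    by (simp only: exp_sum finite_lessThan)
  also have "\<dots> \<le> card V * (\<Prod>i<r. \<Sum>b\<in>UNIV. exp (1 / 4 * R i b))"
    unfolding V_def by (rule sum_prod_dot_le) simp
  also have "\<dots> \<le> card V * (\<Prod>i<r. CARD('p) * exp ((1 / 4) ^ 2))"
  proof (intro mult_left_mono prod_mono conjI)
    fix i assume "i \<in> {..<r}"
    then have i: "i < r" by simp
    have "(\<Sum>b\<in>UNIV. exp (1 / 4 * R i b)) \<le> card (UNIV :: 'p mod_ring set) * exp ((1 / 4) ^ 2)"
    proof (rule sum_exp_le)
      show "\<bar>R i b\<bar> \<le> 1" for b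
        using abs_Re_le_cmod[of "c i * chi b"] nc[OF i] by (simp add: R_def norm_mult)
      have "(\<Sum>b\<in>UNIV. R i b) = Re (c i * (\<Sum>b\<in>UNIV. chi (b :: 'p mod_ring)))"
        by (simp add: R_def sum_distrib_left)
      then show "(\<Sum>b\<in>UNIV. R i b) = 0" by (simp add: sum_chi_UNIV)
    qed auto
    then show "(\<Sum>b\<in>UNIV. exp (1 / 4 * R i b)) \<le> CARD('p) * exp ((1 / 4) ^ 2)" by simp
  qed (auto intro: sum_nonneg)
  also have "\<dots> = (card V * CARD('p) ^ r) * exp (r / 16)"
    by (simp add: power_mult_distrib exp_of_nat_mult[symmetric] power2_eq_square)
  also have "card V * CARD('p) ^ r = CARD('p) ^ n" using zs(2) by (simp add: V_def)
  finally have "exp (r / 8) * card T \<le> CARD('p) ^ n * exp (r / 16)" by simp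
  then have "exp (r / 8) / exp (r / 16) \<le> CARD('p) ^ n / card T"
    using T0 by (simp add: field_simps)
  then have "exp (r / 16) \<le> CARD('p) ^ n / card T" by (simp add: exp_diff[symmetric])
  then have "r / 16 \<le> ln (CARD('p) ^ n / card T)"
    using T0 by (subst ln_ge_iff) auto
  then have "real r \<le> 16 * ln (CARD('p) ^ n / card T)" by simp
  moreover have "add_subgroup V" "V \<subseteq> vecs n"
    unfolding V_def by (rule add_subgroup_perp perp_subset_vecs)+
  ultimately show ?thesis
    using that[of V r] zs(2) ann unfolding V_def Spec_def by blast
qed

subsection \<open>Sanders' theorem\<close>

lemma smooth_mono: "(\<And>x. f x \<le> g x) \<Longrightarrow> smooth T f x \<le> smooth T g x"
  unfolding smooth_def by (intro divide_right_mono sum_mono) auto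

lemma avg_mono: "(\<And>x. f x \<le> g x) \<Longrightarrow> avg T f x \<le> avg T g x"
  unfolding avg_def by (intro divide_right_mono sum_mono) auto

lemma smooth_affine:
  assumes "finite T" "T \<noteq> {}"
  shows "smooth T (\<lambda>x. a + b * f x) = (\<lambda>x. a + b * smooth T f x)"
proof
  fix x
  have "card T > 0" using assms by (simp add: card_gt_0_iff)
  then show "smooth T (\<lambda>x. a + b * f x) x = a + b * smooth T f x"
    by (simp add: smooth_def sum.distrib sum_distrib_left[symmetric] add_divide_distrib power2_eq_square)
qed

lemma avg_affine:
  assumes "finite T" "T \<noteq> {}"
  shows "avg T (\<lambda>x. a + b * f x) = (\<lambda>x. a + b * avg T f x)"
proof
  fix x
  have "card T > 0" using assms by (simp add: card_gt_0_iff)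
  then show "avg T (\<lambda>x. a + b * f x) x = a + b * avg T f x"
    by (simp add: avg_def sum.distrib sum_distrib_left[symmetric] add_divide_distrib)
qed

lemma avg_commute: "avg S (avg T f) = avg T (avg S f)"
proof
  fix x
  show "avg S (avg T f) x = avg T (avg S f) x"
    by (simp add: avg_def sum_divide_distrib) (subst sum.swap, simp add: add_ac mult.commute)
qed

lemma sum_avg:
  assumes "T \<subseteq> vecs n" "T \<noteq> {}"
  shows "(\<Sum>x\<in>vecs n. avg T f x) = (\<Sum>x\<in>(vecs n :: (nat \<Rightarrow> 'a::{finite, ab_group_add}) set). f x)"
proof -
  have "finite T" using assms finite_subset finite_vecs by blast
  then have T: "card T > 0" using assms by (simp add: card_gt_0_iff)
  have "(\<Sum>x\<in>vecs n. avg T f x) = (\<Sum>t\<in>T. \<Sum>x\<in>vecs n. f (x + t)) / card T"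
    unfolding avg_def sum_divide_distrib[symmetric] by (subst sum.swap) (rule refl)
  also have "(\<Sum>t\<in>T. \<Sum>x\<in>vecs n. f (x + t)) = (\<Sum>t\<in>T. \<Sum>x\<in>vecs n. f x)"
    using assms by (intro sum.cong refl sum_vecs_shift) auto
  finally show ?thesis using T by simp
qed

lemma sum_smooth:
  assumes "T \<subseteq> vecs n" "T \<noteq> {}"
  shows "(\<Sum>x\<in>vecs n. smooth T f x) = (\<Sum>x\<in>(vecs n :: (nat \<Rightarrow> 'a::{finite, ab_group_add}) set). f x)"
proof -
  have "finite T" using assms finite_subset finite_vecs by blast
  then have T: "card T > 0" using assms by (simp add: card_gt_0_iff)
  have "(\<Sum>x\<in>vecs n. smooth T f x) = (\<Sum>x\<in>vecs n. \<Sum>s\<in>T. \<Sum>s'\<in>T. f (x + (s - s'))) / card T ^ 2"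
    by (simp add: smooth_def sum_divide_distrib add_diff_eq)
  also have "(\<Sum>x\<in>vecs n. \<Sum>s\<in>T. \<Sum>s'\<in>T. f (x + (s - s'))) = (\<Sum>s\<in>T. \<Sum>s'\<in>T. \<Sum>x\<in>vecs n. f (x + (s - s')))"
    by (subst sum.swap, rule sum.cong[OF refl], subst sum.swap, rule refl)
  also have "\<dots> = (\<Sum>s\<in>T. \<Sum>s'\<in>T. \<Sum>x\<in>vecs n. f x)"
    using assms by (intro sum.cong refl sum_vecs_shift add_subgroup_diff[OF add_subgroup_vecs]) auto
  finally show ?thesis using T by (simp add: power2_eq_square)
qed

text \<open>One more smoothing compares \<open>f\<close> with \<open>g\<close> on the translate of
  \<open>C\<close> by \<open>s - s'\<close>, where the induction hypothesis applies, and then moves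
  \<open>g\<close> back by almost periodicity on the translate by \<open>- s'\<close>. Hence the
  statement must hold for all large \<open>C\<close> at once.\<close>

lemma smooth_iterate_close:
  fixes G T :: "'a::ab_group_add set" and g :: "'a \<Rightarrow> real" and e K :: real
  assumes G: "add_subgroup G" "finite G" and T: "T \<subseteq> G" "T \<noteq> {}"
    and per: "\<And>s s' C. s \<in> T \<Longrightarrow> s' \<in> T \<Longrightarrow> C \<subseteq> G \<Longrightarrow> card G \<le> K * card C \<Longrightarrow>
       (\<Sum>c\<in>C. \<bar>g (c + s) - g (c + s')\<bar>) \<le> e * card C"
    and C: "C \<subseteq> G" "card G \<le> K * card C"
  shows "(\<Sum>c\<in>C. \<bar>(smooth T ^^ l) g c - g c\<bar>) \<le> e * l * card C"
  using C
proof (induction l arbitrary: C)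
  case 0
  then show ?case by simp
next
  case (Suc l)
  have "finite T" using T G finite_subset by blast
  then have T0: "card T > 0" using T by (simp add: card_gt_0_iff)
  define f where "f = (smooth T ^^ l) g"
  have trans: "(\<lambda>c. c + u) ` C \<subseteq> G" "card ((\<lambda>c. c + u) ` C) = card C" if "u \<in> G" for u
    using Suc.prems(1) that by (auto intro: add_subgroup_add[OF G(1)] simp: card_image inj_on_def)
  have "(\<Sum>c\<in>C. \<bar>smooth T f c - g c\<bar>) \<le> (\<Sum>c\<in>C. (\<Sum>s\<in>T. \<Sum>s'\<in>T. \<bar>f (c + s - s') - g c\<bar>) / card T ^ 2)"
  proof (rule sum_mono)
    fix c
    have "smooth T f c - g c = (\<Sum>s\<in>T. \<Sum>s'\<in>T. f (c + s - s') - g c) / card T ^ 2"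
      using T0 by (simp add: smooth_def sum_subtractf diff_divide_distrib power2_eq_square)
    also have "\<bar>\<dots>\<bar> \<le> (\<Sum>s\<in>T. \<bar>\<Sum>s'\<in>T. f (c + s - s') - g c\<bar>) / card T ^ 2"
      by (simp add: abs_divide divide_right_mono)
    also have "\<dots> \<le> (\<Sum>s\<in>T. \<Sum>s'\<in>T. \<bar>f (c + s - s') - g c\<bar>) / card T ^ 2"
      by (intro divide_right_mono sum_mono sum_abs) auto
    finally show "\<bar>smooth T f c - g c\<bar> \<le> (\<Sum>s\<in>T. \<Sum>s'\<in>T. \<bar>f (c + s - s') - g c\<bar>) / card T ^ 2" .
  qed
  also have "\<dots> = (\<Sum>s\<in>T. \<Sum>s'\<in>T. \<Sum>c\<in>C. \<bar>f (c + s - s') - g c\<bar>) / card T ^ 2"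
    unfolding sum_divide_distrib[symmetric]
    by (subst sum.swap, rule arg_cong[of _ _ "\<lambda>u. u / _"], rule sum.cong[OF refl], subst sum.swap, rule refl)
  also have "\<dots> \<le> (\<Sum>s\<in>T. \<Sum>s'\<in>T. e * Suc l * card C) / card T ^ 2"
  proof (intro divide_right_mono sum_mono)
    fix s s' assume s: "s \<in> T" "s' \<in> T"
    then have sG: "s - s' \<in> G" "- s' \<in> G"
      using T add_subgroup_diff[OF G(1)] add_subgroup_uminus[OF G(1)] by blast+
    have "(\<Sum>c\<in>C. \<bar>f (c + s - s') - g c\<bar>)
        \<le> (\<Sum>c\<in>C. \<bar>f (c + (s - s')) - g (c + (s - s'))\<bar> + \<bar>g (c + - s' + s) - g (c + - s' + s')\<bar>)"
      by (rule sum_mono) (simp add: algebra_simps)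
    also have "\<dots> = (\<Sum>c\<in>(\<lambda>c. c + (s - s')) ` C. \<bar>f c - g c\<bar>) + (\<Sum>c\<in>(\<lambda>c. c + - s') ` C. \<bar>g (c + s) - g (c + s')\<bar>)"
      by (simp add: sum.distrib sum.reindex inj_on_def)
    also have "\<dots> \<le> e * l * card C + e * card C"
    proof (rule add_mono)
      show "(\<Sum>c\<in>(\<lambda>c. c + (s - s')) ` C. \<bar>f c - g c\<bar>) \<le> e * l * card C"
        using Suc.IH[of "(\<lambda>c. c + (s - s')) ` C"] trans[OF sG(1)] Suc.prems(2) by (simp add: f_def)
      show "(\<Sum>c\<in>(\<lambda>c. c + - s') ` C. \<bar>g (c + s) - g (c + s')\<bar>) \<le> e * card C"
        using per[OF s, of "(\<lambda>c. c + - s') ` C"] trans[OF sG(2)] Suc.prems(2) by simp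
    qed
    finally show "(\<Sum>c\<in>C. \<bar>f (c + s - s') - g c\<bar>) \<le> e * Suc l * card C" by (simp add: algebra_simps)
  qed auto
  also have "\<dots> = e * Suc l * card C" using T0 by (simp add: power2_eq_square)
  finally show ?case by (simp add: f_def)
qed

lemma avg_indicator: "avg S (\<lambda>x. of_bool (x \<in> D)) y = card {s \<in> S. y + s \<in> D} / card S" if "finite S"
  using that by (simp add: avg_def of_bool_def sum.If_cases Int_def)

text \<open>Sanders' argument with popular sums \<open>D\<close>. The function \<open>g\<close>
  records how often \<open>c + a\<close> falls into \<open>D\<close>, and it is large on average
  over \<open>A\<close>. Smoothing by the almost periods \<open>T\<close> hardly changes it on
  \<open>A\<close>. A further average over \<open>V\<close> is then harmless: \<open>V\<close>
  annihilates the large spectrum of \<open>T\<close>, and smoothing has damped all other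
  frequencies. Therefore many cosets of \<open>V\<close> lie in \<open>D\<close> for at least three
  quarters, so \<open>D\<close> and its translate by any \<open>v\<close> in \<open>V\<close>
  overlap substantially, and each common point gives many representations of
  \<open>v\<close>.\<close>

lemma bogolyubov_quadruples:
  fixes A :: "(nat \<Rightarrow> 'p::prime_card mod_ring) set" and K :: real and k l :: nat
  assumes A: "A \<subseteq> vecs n" and K: "CARD('p) ^ n \<le> K * card A"
    and l: "32 * K \<le> 4 ^ l" "l > 0" and k: "4 * ln (4 * K) \<le> k / (64 * l) ^ 2" "k > 0"
  obtains V r where "add_subgroup V" "V \<subseteq> vecs n" "card V * CARD('p) ^ r = CARD('p) ^ n"
    "real r \<le> 16 * ln (2 * K ^ k)"
    "\<And>v. v \<in> V \<Longrightarrow> CARD('p) ^ (3 * n) \<le> 1024 * K ^ 5 *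
       card {(x1, x2, x3). x1 \<in> A \<and> x2 \<in> A \<and> x3 \<in> A \<and> x1 + x2 - x3 - v \<in> A}"
proof -
  define G where "G = (vecs n :: (nat \<Rightarrow> 'p mod_ring) set)"
  define N where "N = real (card G)"
  have NP: "N = CARD('p) ^ n" by (simp add: N_def G_def card_vecs)
  have N: "N > 0" by (simp add: NP)
  have G: "add_subgroup G" "finite G" by (auto simp: G_def add_subgroup_vecs)
  have KN: "N \<le> K * card A" using K by (simp add: NP)
  have Ane: "A \<noteq> {}" using KN N by auto
  have fA: "finite A" using A G finite_subset unfolding G_def by blast
  define m where "m = real (card A)"
  have m: "m > 0" "N \<le> K * m" using fA Ane KN by (auto simp: m_def card_gt_0_iff)
  have mN: "m \<le> N" unfolding m_def N_def using A G by (simp add: G_def card_mono)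
  have K1: "1 \<le> K" using m mN by (smt (verit) mult_le_cancel_right1)
  define r2 where "r2 d = card {(a, a') \<in> A \<times> A. a + a' = d}" for d
  \<comment> \<open>Sums with fewer than \<open>th\<close> representations arise from at most
    \<open>m ^ 2 / 16\<close> pairs.\<close>
  define th where "th = m ^ 2 / (16 * N)"
  have th: "th > 0" using m N by (simp add: th_def)
  define D where "D = {d \<in> G. th \<le> r2 d}"
  have D: "D \<subseteq> G" "finite D" using G by (auto simp: D_def)
  define iD where "iD x = (of_bool (x \<in> D) :: real)" for x
  define g where "g = avg A iD"
  \<comment> \<open>The loss of \<open>l\<close> smoothing steps is
    \<open>2 * e * l = 1 / 32\<close>.\<close>
  define e where "e = 1 / (64 * real l)"
  have e: "0 < e" "e \<le> 1" using l by (auto simp: e_def)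
  have ke: "4 * ln (4 * K) \<le> k * e ^ 2" using k by (simp add: e_def power_divide)
  obtain T where T: "T \<subseteq> G" "card G \<le> 2 * K ^ k * card T"
    and per: "\<And>s s' C. s \<in> T \<Longrightarrow> s' \<in> T \<Longrightarrow> C \<subseteq> G \<Longrightarrow> card G \<le> K * card C \<Longrightarrow>
       (\<Sum>c\<in>C. \<bar>g (c + s) - g (c + s')\<bar>) \<le> 2 * e * card C"
    using almost_periodicity[of G A iD K e k] G A Ane KN e ke k unfolding g_def avg_def[abs_def] iD_def N_def G_def
    by auto
  have Tne: "T \<noteq> {}" using T N by (auto simp: N_def)
  have fT: "finite T" using T G finite_subset by blast
  have T0: "card T > 0" using Tne fT by (simp add: card_gt_0_iff)
  obtain V r where V: "add_subgroup V" "V \<subseteq> vecs n" "card V * CARD('p) ^ r = CARD('p) ^ n"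
    and r: "real r \<le> 16 * ln (CARD('p) ^ n / card T)"
    and spec: "\<And>z v. z \<in> vecs n \<Longrightarrow> 1 / 2 \<le> norm (mu n T z) \<Longrightarrow> v \<in> V \<Longrightarrow> dot n z v = 0"
    using chang[of T n] T Tne unfolding G_def by blast
  have fV: "finite V" using V finite_subset finite_vecs by blast
  have V0: "card V > 0" using V(1) fV add_subgroup_zero by (auto simp: card_gt_0_iff)
  have "CARD('p) ^ n / card T \<le> 2 * K ^ k" using T(2) T0 NP by (simp add: divide_le_eq N_def[symmetric])
  then have "ln (CARD('p) ^ n / card T) \<le> ln (2 * K ^ k)" using T0 by (intro ln_mono) auto
  then have r: "real r \<le> 16 * ln (2 * K ^ k)" using r by linarith

  have sg: "15 / 16 * m \<le> (\<Sum>c\<in>A. g c)"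
  proof -
    define B where "B = {(a, a') \<in> A \<times> A. a + a' \<notin> D}"
    have fB: "finite B" unfolding B_def by (rule finite_subset[of _ "A \<times> A"]) (use fA in auto)
    have "card B \<le> card (SIGMA d:G - D. {(a, a') \<in> A \<times> A. a + a' = d})"
    proof (rule card_inj_on_le[of "\<lambda>(a, a'). (a + a', (a, a'))"])
      show "finite (SIGMA d:G - D. {(a, a') \<in> A \<times> A. a + a' = d})"
        by (rule finite_subset[of _ "G \<times> A \<times> A"]) (use G fA in auto)
      show "(\<lambda>(a, a'). (a + a', (a, a'))) ` B \<subseteq> (SIGMA d:G - D. {(a, a') \<in> A \<times> A. a + a' = d})"
        using A by (auto simp: B_def G_def intro: add_subgroup_add[OF add_subgroup_vecs])
    qed (auto simp: inj_on_def)
    also have "\<dots> = (\<Sum>d\<in>G - D. r2 d)"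
      unfolding r2_def by (rule card_SigmaI) (use G in \<open>auto intro: finite_subset[OF _ finite_cartesian_product[OF fA fA]]\<close>)
    finally have "real (card B) \<le> (\<Sum>d\<in>G - D. real (r2 d))" by (metis of_nat_le_iff of_nat_sum)
    also have "\<dots> \<le> (\<Sum>d\<in>G - D. th)" by (rule sum_mono) (auto simp: D_def)
    also have "\<dots> = card (G - D) * th" by simp
    also have "\<dots> \<le> N * th" unfolding N_def using th G by (intro mult_right_mono) (auto simp: card_mono)
    also have "\<dots> = m ^ 2 / 16" using N by (simp add: th_def)
    finally have cB: "real (card B) \<le> m ^ 2 / 16" .
    have "(\<Sum>c\<in>A. g c) = (\<Sum>c\<in>A. \<Sum>a\<in>A. iD (c + a)) / m"
      by (simp add: g_def avg_def sum_divide_distrib m_def)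
    also have "(\<Sum>c\<in>A. \<Sum>a\<in>A. iD (c + a)) = (\<Sum>q\<in>A \<times> A. 1 - (if q \<in> B then 1 else 0))"
      unfolding sum.cartesian_product by (intro sum.cong) (auto simp: iD_def B_def)
    also have "\<dots> = m ^ 2 - card B"
    proof -
      have "(A \<times> A) \<inter> B = B" by (auto simp: B_def)
      then show ?thesis using fA
        by (simp add: sum_subtractf sum.If_cases card_cartesian_product m_def power2_eq_square)
    qed
    also have "15 / 16 * m \<le> (m ^ 2 - card B) / m"
      using cB m by (simp add: le_divide_eq power2_eq_square)
    finally show ?thesis .
  qed

  \<comment> \<open>The budget on \<open>A\<close>, in units of \<open>m\<close>: at least 15/16 for
    \<open>g\<close>, then 1/32 is lost by smoothing and another 1/32 by averaging over
    \<open>V\<close>, which leaves 28/32 = 7/8.\<close>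
  define f1 where "f1 = (smooth T ^^ l) g"
  define f2 where "f2 = (smooth T ^^ l) (avg V g)"
  have "(\<Sum>c\<in>A. \<bar>f1 c - g c\<bar>) \<le> 2 * e * l * card A"
    unfolding f1_def by (rule smooth_iterate_close[OF G T(1) Tne per]) (use A KN in \<open>auto simp: G_def N_def\<close>)
  also have "\<dots> = m / 32" using l by (simp add: e_def m_def)
  finally have d1: "(\<Sum>c\<in>A. \<bar>f1 c - g c\<bar>) \<le> m / 32" .
  have s1: "29 / 32 * m \<le> (\<Sum>c\<in>A. f1 c)"
  proof -
    have "(\<Sum>c\<in>A. g c) - (\<Sum>c\<in>A. f1 c) = (\<Sum>c\<in>A. g c - f1 c)" by (simp add: sum_subtractf)
    also have "\<dots> \<le> (\<Sum>c\<in>A. \<bar>f1 c - g c\<bar>)" by (rule sum_mono) linarith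
    finally show ?thesis using d1 sg by linarith
  qed

  have four: "N * \<bar>\<Sum>c\<in>A. f1 c - f2 c\<bar> \<le> N * (m / 32)"
  proof -
    have "(\<Sum>c\<in>A. f1 c - f2 c) = (\<Sum>x\<in>vecs n. (f1 x - f2 x) * of_bool (x \<in> A))"
      using A by (simp add: of_bool_def if_distrib sum.If_cases Int_absorb1 cong: if_cong)
    then have pars: "of_real (N * (\<Sum>c\<in>A. f1 c - f2 c)) =
        (\<Sum>z\<in>vecs n. ft n (\<lambda>x. f1 x - f2 x) z * cnj (ft n (\<lambda>x. of_bool (x \<in> A)) z))"
      unfolding ft_parseval NP by simp
    have "N * \<bar>\<Sum>c\<in>A. f1 c - f2 c\<bar> =
        norm (\<Sum>z\<in>vecs n. ft n (\<lambda>x. f1 x - f2 x) z * cnj (ft n (\<lambda>x. of_bool (x \<in> A)) z))"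
      unfolding pars[symmetric] norm_of_real abs_mult using N by simp
    also have "\<dots> \<le> (\<Sum>z\<in>vecs n. norm (ft n (\<lambda>x. f1 x - f2 x) z * cnj (ft n (\<lambda>x. of_bool (x \<in> A)) z)))"
      by (rule norm_sum)
    also have "\<dots> \<le> (\<Sum>z\<in>(vecs n :: (nat \<Rightarrow> 'p mod_ring) set). m * ((1 / 4) ^ l * N) * norm (mu n A z) ^ 2)"
    proof (rule sum_mono)
      fix z :: "nat \<Rightarrow> 'p mod_ring" assume z: "z \<in> vecs n"
      have fg: "ft n g z = cnj (mu n A z) * ft n iD z" unfolding g_def by (rule ft_avg[OF A])
      have "ft n (\<lambda>x. f1 x - f2 x) z = of_real (norm (mu n T z) ^ (2 * l)) * (1 - cnj (mu n V z)) * ft n g z"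
        unfolding ft_diff f1_def f2_def using T(1) V(2)
        by (simp add: ft_smooth_iterate ft_avg G_def algebra_simps)
      then have 1: "norm (ft n (\<lambda>x. f1 x - f2 x) z) =
          (norm (mu n T z) ^ (2 * l) * norm (1 - cnj (mu n V z))) * (norm (mu n A z) * norm (ft n iD z))"
        by (simp add: fg norm_mult norm_power)
      \<comment> \<open>If \<open>V\<close> annihilates \<open>z\<close>, averaging over
        \<open>V\<close> does not touch this frequency. Otherwise \<open>z\<close> is outside the
        large spectrum, and the \<open>2 * l\<close>-th power of a number below \<open>1 / 2\<close>
        is small.\<close>
      have 2: "norm (mu n T z) ^ (2 * l) * norm (1 - cnj (mu n V z)) \<le> (1 / 4) ^ l"
      proof (cases "\<forall>v\<in>V. dot n z v = 0")
        case True
        then have "mu n V z = 1" using V0 by (simp add: mu_def)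
        then show ?thesis by simp
      next
        case False
        then have "mu n V z = 0" by (simp only: mu_def sum_chi_subgroup[OF V(1)] if_False) simp
        moreover have "norm (mu n T z) < 1 / 2" using False spec[OF z] by force
        then have "norm (mu n T z) ^ (2 * l) \<le> (1 / 2) ^ (2 * l)" by (intro power_mono) auto
        ultimately show ?thesis by (simp add: power_mult power2_eq_square)
      qed
      have 3: "norm (ft n iD z) \<le> N" unfolding iD_def NP by (rule norm_ft_indicator_le)
      have "norm (ft n (\<lambda>x. f1 x - f2 x) z) \<le> (1 / 4) ^ l * (norm (mu n A z) * N)"
        unfolding 1 by (intro mult_mono 2 3) auto
      then have "norm (ft n (\<lambda>x. f1 x - f2 x) z) * norm (ft n (\<lambda>x. of_bool (x \<in> A)) z)
          \<le> ((1 / 4) ^ l * (norm (mu n A z) * N)) * (m * norm (mu n A z))"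
        unfolding ft_indicator[OF A] using N by (intro mult_mono) (auto simp: norm_mult m_def)
      then show "norm (ft n (\<lambda>x. f1 x - f2 x) z * cnj (ft n (\<lambda>x. of_bool (x \<in> A)) z))
          \<le> m * ((1 / 4) ^ l * N) * norm (mu n A z) ^ 2"
        by (simp add: norm_mult power2_eq_square mult_ac)
    qed
    also have "\<dots> = ((1 / 4) ^ l * N) * ((\<Sum>z\<in>(vecs n :: (nat \<Rightarrow> 'p mod_ring) set). norm (mu n A z) ^ 2) * card A)"
      by (simp add: sum_distrib_left[symmetric] m_def mult_ac)
    also have "\<dots> = ((1 / 4) ^ l * N) * N"
      using sum_norm_mu_squared[OF A Ane] by (simp add: NP)
    also have "\<dots> \<le> N * (m / 32)"
    proof -
      have "32 * N \<le> 32 * (K * m)" using m by simp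
      also have "\<dots> \<le> 4 ^ l * m" using l m by (simp add: mult_right_mono flip: mult.assoc)
      finally have "(1 / 4) ^ l * N \<le> m / 32" by (simp add: power_divide field_simps)
      then show ?thesis using N by (simp add: mult.commute)
    qed
    finally show ?thesis .
  qed
  then have "\<bar>\<Sum>c\<in>A. f1 c - f2 c\<bar> \<le> m / 32" using N by simp
  then have s2: "7 / 8 * m \<le> (\<Sum>c\<in>A. f2 c)" using s1 unfolding sum_subtractf by linarith

  define q where "q = avg V iD"
  define Y where "Y = {y \<in> G. 3 / 4 \<le> q y}"
  have fY: "finite Y" using G by (simp add: Y_def)
  have qc: "q y = card {u \<in> V. y + u \<in> D} / card V" for y
    unfolding q_def iD_def by (rule avg_indicator[OF fV])
  \<comment> \<open>Smoothing and averaging are monotone and preserve constants and total sums. The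
    excess of \<open>7 / 8 * m\<close> over \<open>3 / 4 * m\<close> must therefore come from
    \<open>Y\<close>, which makes \<open>Y\<close> at least half as large as
    \<open>A\<close>.\<close>
  have q_le: "q y \<le> 3 / 4 + 1 / 4 * of_bool (y \<in> Y)" for y
  proof (cases "3 / 4 \<le> q y")
    case True
    then have "card {u \<in> V. y + u \<in> D} \<noteq> 0" by (intro notI) (simp add: qc)
    then obtain u where "u \<in> V" "y + u \<in> D" by (metis (no_types, lifting) card.empty empty_Collect_eq)
    then have "y \<in> G" using D V add_subgroup_diff[OF G(1), of "y + u" u] by (auto simp: G_def)
    moreover have "card {u \<in> V. y + u \<in> D} \<le> card V" using fV by (intro card_mono) auto
    then have "q y \<le> 1" using V0 by (simp add: qc)
    ultimately show ?thesis using True by (simp add: Y_def)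
  qed auto
  define iY where "iY y = (of_bool (y \<in> Y) :: real)" for y
  have f2_le: "f2 x \<le> 3 / 4 + 1 / 4 * (smooth T ^^ l) (avg A iY) x" for x
  proof -
    have "avg V g = avg A q" unfolding g_def q_def by (rule avg_commute)
    then have base: "avg V g x \<le> 3 / 4 + 1 / 4 * avg A iY x" for x
      using avg_mono[of q "\<lambda>y. 3 / 4 + 1 / 4 * iY y" A x] q_le
      unfolding iY_def avg_affine[OF fA Ane] by simp
    have "(smooth T ^^ j) (avg V g) x \<le> 3 / 4 + 1 / 4 * (smooth T ^^ j) (avg A iY) x" for j x
    proof (induction j arbitrary: x)
      case (Suc j)
      have "smooth T ((smooth T ^^ j) (avg V g)) x \<le> smooth T (\<lambda>x. 3 / 4 + 1 / 4 * (smooth T ^^ j) (avg A iY) x) x"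
        by (rule smooth_mono) (rule Suc)
      then show ?case by (simp only: smooth_affine[OF fT Tne] funpow.simps o_apply)
    qed (use base in simp)
    then show ?thesis by (simp add: f2_def)
  qed
  have nonneg: "0 \<le> (smooth T ^^ j) (avg A iY) x" for j x
    by (induction j arbitrary: x) (auto simp: smooth_def avg_def iY_def intro!: divide_nonneg_nonneg sum_nonneg)
  have "7 / 8 * m \<le> (\<Sum>c\<in>A. 3 / 4 + 1 / 4 * (smooth T ^^ l) (avg A iY) c)"
    using s2 sum_mono[of A f2, OF f2_le] by linarith
  also have "\<dots> = 3 / 4 * m + 1 / 4 * (\<Sum>c\<in>A. (smooth T ^^ l) (avg A iY) c)"
    by (simp add: sum.distrib sum_distrib_left m_def)
  also have "(\<Sum>c\<in>A. (smooth T ^^ l) (avg A iY) c) \<le> (\<Sum>x\<in>vecs n. (smooth T ^^ l) (avg A iY) x)"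
    by (rule sum_mono2) (use A nonneg in auto)
  also have "\<dots> = (\<Sum>x\<in>vecs n. avg A iY x)"
    using T(1) Tne by (induction l) (auto simp: sum_smooth G_def)
  also have "\<dots> = (\<Sum>x\<in>vecs n. iY x)" by (rule sum_avg[OF A Ane])
  also have "\<dots> = card Y"
    by (simp add: iY_def of_bool_def sum.If_cases Int_absorb1 Y_def G_def Int_def)
  finally have cY: "m / 2 \<le> card Y" by simp

  have reps: "CARD('p) ^ (3 * n) \<le> 1024 * K ^ 5 *
       card {(x1, x2, x3). x1 \<in> A \<and> x2 \<in> A \<and> x3 \<in> A \<and> x1 + x2 - x3 - v \<in> A}" if v: "v \<in> V" for v
  proof -
    define DD where "DD = {d \<in> D. d - v \<in> D}"
    have fDD: "finite DD" using D by (simp add: DD_def)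
    \<comment> \<open>Two subsets of \<open>V\<close>, each filling three quarters of it, share at
      least half of it.\<close>
    have half: "real (card V) / 2 \<le> card {u \<in> V. y + u \<in> DD}" if y: "y \<in> Y" for y
    proof -
      define X1 where "X1 = {u \<in> V. y + u \<in> D}"
      define X2 where "X2 = {u \<in> V. y + u - v \<in> D}"
      have fX: "finite X1" "finite X2" using fV by (auto simp: X1_def X2_def)
      have c1: "3 / 4 * card V \<le> card X1" using y V0 by (simp add: Y_def qc X1_def le_divide_eq)
      have "X2 = (\<lambda>u. u + v) ` X1"
      proof
        show "(\<lambda>u. u + v) ` X1 \<subseteq> X2"
          using v by (auto simp: X1_def X2_def add.assoc[symmetric] intro: add_subgroup_add[OF V(1)])
        show "X2 \<subseteq> (\<lambda>u. u + v) ` X1"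
        proof
          fix u assume "u \<in> X2"
          then have "u - v \<in> X1" using v by (auto simp: X1_def X2_def add_diff_eq intro: add_subgroup_diff[OF V(1)])
          then show "u \<in> (\<lambda>u. u + v) ` X1" by (intro image_eqI[of _ _ "u - v"]) simp_all
        qed
      qed
      then have c2: "card X2 = card X1" by (simp add: card_image inj_on_def)
      have "card (X1 \<union> X2) \<le> card V" using fV by (intro card_mono) (auto simp: X1_def X2_def)
      then have "card X1 + card X2 \<le> card V + card (X1 \<inter> X2)"
        using card_Un_Int[OF fX] by linarith
      moreover have "X1 \<inter> X2 = {u \<in> V. y + u \<in> DD}" by (auto simp: X1_def X2_def DD_def)
      ultimately have "card X1 + card X1 \<le> card V + card {u \<in> V. y + u \<in> DD}" using c2 by simp
      then have "real (card X1) + real (card X1) \<le> real (card V) + real (card {u \<in> V. y + u \<in> DD})"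
        unfolding of_nat_add[symmetric] of_nat_le_iff .
      then show ?thesis using c1 by linarith
    qed
    have "real (card Y) * (card V / 2) = (\<Sum>y\<in>Y. card V / 2)" by simp
    also have "\<dots> \<le> (\<Sum>y\<in>Y. real (card {u \<in> V. y + u \<in> DD}))" by (rule sum_mono) (rule half)
    also have "\<dots> = real (card (SIGMA y:Y. {u \<in> V. y + u \<in> DD}))" using fY fV by simp
    \<comment> \<open>For given \<open>u\<close> the point \<open>y\<close> is recovered from
      \<open>y + u\<close>, so each element of \<open>DD\<close> is counted at most
      \<open>card V\<close> times.\<close>
    also have "card (SIGMA y:Y. {u \<in> V. y + u \<in> DD}) \<le> card (V \<times> DD)"
      by (rule card_inj_on_le[of "\<lambda>(y, u). (u, y + u)"]) (use fV fDD in \<open>auto simp: inj_on_def\<close>)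
    also have "real (card (V \<times> DD)) = card DD * card V" by (simp add: card_cartesian_product)
    finally have "real (card Y) / 2 * card V \<le> card DD * card V" by simp
    then have cDD: "m / 4 \<le> card DD" using V0 cY by simp
    let ?Q = "{(x1, x2, x3). x1 \<in> A \<and> x2 \<in> A \<and> x3 \<in> A \<and> x1 + x2 - x3 - v \<in> A}"
    have fQ: "finite ?Q" by (rule finite_subset[of _ "A \<times> A \<times> A"]) (use fA in auto)
    define R where "R d = {(a, a') \<in> A \<times> A. a + a' = d}" for d
    have fR: "finite (R d)" for d unfolding R_def by (rule finite_subset[of _ "A \<times> A"]) (use fA in auto)
    have "m / 4 * th ^ 2 \<le> card DD * th ^ 2" using cDD by (intro mult_right_mono) auto
    also have "\<dots> = (\<Sum>d\<in>DD. th * th)" by (simp add: power2_eq_square)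
    also have "\<dots> \<le> (\<Sum>d\<in>DD. real (r2 d) * real (r2 (d - v)))"
      using th by (intro sum_mono mult_mono) (auto simp: DD_def D_def)
    also have "\<dots> = real (\<Sum>d\<in>DD. card (R d \<times> R (d - v)))"
      by (simp add: r2_def R_def card_cartesian_product)
    also have "(\<Sum>d\<in>DD. card (R d \<times> R (d - v))) = card (SIGMA d:DD. R d \<times> R (d - v))"
      using fDD fR by (intro card_SigmaI[symmetric]) auto
    also have "\<dots> \<le> card ?Q"
    proof (rule card_inj_on_le[of "\<lambda>(d, (a, a'), (b, b')). (a, a', b)"])
      show "inj_on (\<lambda>(d, (a, a'), (b, b')). (a, a', b)) (SIGMA d:DD. R d \<times> R (d - v))"
        by (auto simp: inj_on_def R_def) (metis add_left_cancel)+
      have "a + a' - b - v = b'" if "b + b' = a + a' - v" for a a' b b' :: "nat \<Rightarrow> 'p mod_ring"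
      proof -
        have "a + a' - b - v = (b + b') - b" unfolding that by (simp add: algebra_simps)
        then show ?thesis by simp
      qed
      then show "(\<lambda>(d, (a, a'), (b, b')). (a, a', b)) ` (SIGMA d:DD. R d \<times> R (d - v)) \<subseteq> ?Q"
        by (auto simp: R_def)
    qed (rule fQ)
    finally have Q: "m / 4 * th ^ 2 \<le> card ?Q" by simp
    \<comment> \<open>\<open>1024 = 4 * 16 ^ 2\<close>, from \<open>m / 4\<close> common points and
      the square of \<open>th\<close>.\<close>
    have "N ^ 3 \<le> 1024 * K ^ 5 * (m / 4 * th ^ 2)"
    proof -
      have "N ^ 5 \<le> (K * m) ^ 5" using m N by (intro power_mono) auto
      then have "N ^ 3 * N ^ 2 \<le> K ^ 5 * m ^ 5" by (simp add: power_mult_distrib flip: power_add)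
      then show ?thesis using N by (simp add: th_def power_divide field_simps eval_nat_numeral)
    qed
    also have "\<dots> \<le> 1024 * K ^ 5 * card ?Q" using Q K1 by (intro mult_left_mono) auto
    finally show ?thesis by (simp add: NP power_mult[symmetric] mult.commute)
  qed
  show ?thesis by (rule that[of V r]) (use V r reps in auto)
qed

text \<open>The choice of parameters for \<open>K = p ^ a\<close>: there are \<open>l = O(a)\<close>
  smoothing steps, precision \<open>1 / (64 * l)\<close> takes a sample of size
  \<open>k = O(a ^ 3)\<close>, and the codimension has order \<open>k * ln K\<close>, which is
  \<open>O(a ^ 4)\<close>. The number of representations is recorded because a generic one must be
  chosen later.\<close>

theorem sanders:
  "\<exists>C::nat. \<forall>n a. \<forall>A :: (nat \<Rightarrow> 'p::prime_card mod_ring) set.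
    0 < a \<longrightarrow> A \<subseteq> vecs n \<longrightarrow> CARD('p) ^ n \<le> card A * CARD('p) ^ a \<longrightarrow>
    (\<exists>V. add_subgroup V \<and> V \<subseteq> vecs n \<and> CARD('p) ^ n \<le> card V * CARD('p) ^ (C * a ^ 4) \<and>
      (\<forall>v\<in>V. CARD('p) ^ (3 * n) \<le> CARD('p) ^ (C * a) *
        card {(x1, x2, x3). x1 \<in> A \<and> x2 \<in> A \<and> x3 \<in> A \<and> x1 + x2 - x3 - v \<in> A}))"
proof -
  define p where "p = CARD('p)"
  have p: "2 \<le> p" using prime_card[where 'a = 'p] prime_ge_2_nat by (simp add: p_def)
  \<comment> \<open>The product bounds the codimension; the 15 covers
    \<open>1024 * K ^ 5 \<le> p ^ (10 * a) * p ^ (5 * a)\<close>.\<close>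
  define C where "C = 512 * p ^ 2 * (64 * (p + 3)) ^ 2 + 15"
  show ?thesis unfolding p_def[symmetric]
  proof (intro exI[of _ C] allI impI)
    fix n a and A :: "(nat \<Rightarrow> 'p mod_ring) set"
    assume a: "0 < a" and A: "A \<subseteq> vecs n" "p ^ n \<le> card A * p ^ a"
    define K where "K = real p ^ a"
    define l where "l = p * a + 3"
    define k where "k = 16 * p * a * (64 * l) ^ 2"
    have lnp: "ln (real p) \<le> p" using ln_bound[of "real p"] p by simp
    have lnK: "ln K \<le> real (p * a)" using lnp a p by (simp add: K_def ln_realpow mult.commute)
    have "p * 1 \<le> p * a" using a by (intro mult_le_mono2) simp
    then have pa: "2 \<le> p * a" using p by linarith
    have ln4: "ln (4 :: real) \<le> 2" using ln_2_less_1 ln_realpow[of 2 2] by simp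
    have A': "real (CARD('p) ^ n) \<le> K * card A"
      using A(2) unfolding K_def p_def[symmetric] by (metis mult.commute of_nat_le_iff of_nat_mult of_nat_power)
    have l1: "32 * K \<le> 4 ^ l"
    proof -
      have "real p \<le> 4 ^ p"
      proof -
        have "p < 2 ^ p" by simp
        also have "(2 :: nat) ^ p \<le> 4 ^ p" by (rule power_mono) auto
        finally have "real p < real (4 ^ p)" unfolding of_nat_less_iff .
        then show ?thesis by simp
      qed
      then have "K \<le> (4 ^ p) ^ a" unfolding K_def by (rule power_mono) simp
      moreover have "0 \<le> K" by (simp add: K_def)
      ultimately have "32 * K \<le> 64 * (4 ^ p) ^ a" by linarith
      then show ?thesis by (simp add: l_def power_add power_mult)
    qed
    have "4 * ln (4 * K) = 4 * (ln 4 + ln K)" using p by (simp add: K_def ln_mult)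
    also have "\<dots> \<le> 4 * (2 + real (p * a))" using lnK ln4 by simp
    also have "\<dots> \<le> 16 * real (p * a)"
    proof -
      have "real 2 \<le> real (p * a)" using pa unfolding of_nat_le_iff .
      moreover have "4 * (2 + x) \<le> 16 * x" if "real 2 \<le> x" for x using that by simp
      ultimately show ?thesis by blast
    qed
    also have "\<dots> = k / (64 * l) ^ 2"
    proof -
      have "l > 0" by (simp add: l_def)
      then show ?thesis by (simp add: k_def)
    qed
    finally have k1: "4 * ln (4 * K) \<le> k / (64 * l) ^ 2" .
    have k0: "k > 0" using a p by (simp add: k_def l_def)
    obtain V r where V: "add_subgroup V" "V \<subseteq> vecs n" "card V * p ^ r = p ^ n"
      and r: "real r \<le> 16 * ln (2 * K ^ k)"
      and reps: "\<And>v. v \<in> V \<Longrightarrow> real (p ^ (3 * n)) \<le> 1024 * K ^ 5 *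
         card {(x1, x2, x3). x1 \<in> A \<and> x2 \<in> A \<and> x3 \<in> A \<and> x1 + x2 - x3 - v \<in> A}"
      using bogolyubov_quadruples[OF A(1) A' l1 _ k1 k0] unfolding p_def by (auto simp: l_def)
    have "16 * ln (2 * K ^ k) = 16 * (ln 2 + k * ln K)"
      using p by (simp add: K_def ln_mult ln_realpow)
    also have "\<dots> \<le> 16 * (1 + k * real (p * a))"
      using ln_2_less_1 lnK by (intro mult_left_mono add_mono) auto
    also have "\<dots> \<le> 32 * (k * real (p * a))"
    proof -
      have "1 \<le> k * (p * a)" using k0 a p by simp
      then have "real 1 \<le> real (k * (p * a))" unfolding of_nat_le_iff .
      then show ?thesis by (simp add: mult_ac)
    qed
    finally have "real r \<le> 32 * (k * real (p * a))" using r by linarith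
    also have "\<dots> = real (32 * (k * (p * a)))" by simp
    finally have "real r \<le> real (32 * (k * (p * a)))" .
    then have "r \<le> 32 * (k * (p * a))" unfolding of_nat_le_iff .
    also have "\<dots> \<le> C * a ^ 4"
    proof -
      have "l \<le> (p + 3) * a" using a by (simp add: l_def algebra_simps)
      then have "(64 * l) ^ 2 \<le> (64 * ((p + 3) * a)) ^ 2" by (intro power_mono) auto
      then have "32 * (k * (p * a)) \<le> 32 * (16 * p * a * (64 * ((p + 3) * a)) ^ 2 * (p * a))"
        unfolding k_def by (intro mult_le_mono) auto
      also have "\<dots> = (512 * p ^ 2 * (64 * (p + 3)) ^ 2) * a ^ 4"
      proof -
        define q where "q = (64 * (p + 3)) ^ 2"
        have "(64 * ((p + 3) * a)) ^ 2 = q * a ^ 2" unfolding q_def power_mult_distrib by (simp only: mult.assoc)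
        then show ?thesis by (simp add: q_def[symmetric] power2_eq_square power4_eq_xxxx mult_ac)
      qed
      also have "\<dots> \<le> C * a ^ 4" unfolding C_def by (intro mult_le_mono1) simp
      finally show ?thesis .
    qed
    finally have rC: "r \<le> C * a ^ 4" .
    have "p ^ n \<le> card V * p ^ (C * a ^ 4)"
      unfolding V(3)[symmetric] using rC p by (intro mult_le_mono2 power_increasing) auto
    moreover have "p ^ (3 * n) \<le> p ^ (C * a) * card {(x1, x2, x3). x1 \<in> A \<and> x2 \<in> A \<and> x3 \<in> A \<and> x1 + x2 - x3 - v \<in> A}"
      if "v \<in> V" for v
    proof -
      let ?c = "card {(x1, x2, x3). x1 \<in> A \<and> x2 \<in> A \<and> x3 \<in> A \<and> x1 + x2 - x3 - v \<in> A}"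
      have "1024 * K ^ 5 = 2 ^ 10 * real p ^ (5 * a)" by (simp add: K_def power_mult mult.commute flip: power_mult)
      also have "\<dots> \<le> real p ^ (10 * a) * real p ^ (5 * a)"
      proof (rule mult_right_mono)
        have "(2 :: real) ^ 10 \<le> 2 ^ (10 * a)" using a by (intro power_increasing) auto
        also have "\<dots> \<le> real p ^ (10 * a)" using p by (intro power_mono) auto
        finally show "(2 :: real) ^ 10 \<le> real p ^ (10 * a)" .
      qed simp
      also have "\<dots> = real p ^ (15 * a)" by (simp flip: power_add)
      also have "\<dots> \<le> real p ^ (C * a)" using p by (intro power_increasing) (auto simp: C_def)
      finally have "1024 * K ^ 5 * ?c \<le> real p ^ (C * a) * ?c" by (intro mult_right_mono) auto
      then have "real (p ^ (3 * n)) \<le> real (p ^ (C * a) * ?c)" using reps[OF that] by simp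
      then show ?thesis unfolding of_nat_le_iff .
    qed
    ultimately show "\<exists>V. add_subgroup V \<and> V \<subseteq> vecs n \<and> p ^ n \<le> card V * p ^ (C * a ^ 4) \<and>
      (\<forall>v\<in>V. p ^ (3 * n) \<le> p ^ (C * a) *
        card {(x1, x2, x3). x1 \<in> A \<and> x2 \<in> A \<and> x3 \<in> A \<and> x1 + x2 - x3 - v \<in> A})"
      using V by blast
  qed
qed

subsection \<open>Functions whose graph has large energy\<close>

interpretation fv: vector_space "smul :: 'p::prime_card mod_ring \<Rightarrow> (nat \<Rightarrow> 'p mod_ring) \<Rightarrow> nat \<Rightarrow> 'p mod_ring"
  by standard (auto simp: smul_def fun_eq_iff algebra_simps)

interpretation fvp: vector_space_pair
  "smul :: 'p::prime_card mod_ring \<Rightarrow> (nat \<Rightarrow> 'p mod_ring) \<Rightarrow> nat \<Rightarrow> 'p mod_ring"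
  "smul :: 'p::prime_card mod_ring \<Rightarrow> (nat \<Rightarrow> 'p mod_ring) \<Rightarrow> nat \<Rightarrow> 'p mod_ring" ..

text \<open>Composition with \<open>g\<close> extends a map that is additive on \<open>W\<close>
  alone to all sequences, without changing its values on \<open>W\<close>.\<close>

lemma ex_projection:
  fixes W :: "(nat \<Rightarrow> 'p::prime_card mod_ring) set"
  assumes "add_subgroup W"
  obtains g where "additive g" "range g \<subseteq> W" "\<And>w. w \<in> W \<Longrightarrow> g w = w"
proof -
  have "fv.subspace W"
    unfolding fv.subspace_def using assms by (auto intro: add_subgroup_zero add_subgroup_add add_subgroup_smul)
  moreover have "Vector_Spaces.linear smul smul (id :: (nat \<Rightarrow> 'p mod_ring) \<Rightarrow> _)"
    unfolding id_def by (rule fv.linear_ident)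
  ultimately obtain g where g: "range g \<subseteq> W" "Vector_Spaces.linear smul smul g" "\<And>w. w \<in> W \<Longrightarrow> g (id w) = w"
    using fvp.linear_exists_left_inverse_on[of id W] by auto
  have "additive g" using g(2) fvp.linear_add[of g] by (unfold_locales) blast
  then show ?thesis using that g by auto
qed

text \<open>Take \<open>Z\<close> maximal. A vector \<open>x\<close> outside \<open>Z\<close> cannot
  be adjoined, so some nonzero element of \<open>D\<close> is \<open>z + smul c x\<close> with
  \<open>c \<noteq> 0\<close>; solving for \<open>x\<close> shows that translates of
  \<open>Z\<close> by multiples of elements of \<open>D\<close> cover everything.\<close>

lemma subgroup_avoiding:
  fixes D :: "(nat \<Rightarrow> 'p::prime_card mod_ring) set"
  assumes D: "finite D"
  obtains Z where "add_subgroup Z" "Z \<subseteq> vecs n" "Z \<inter> D \<subseteq> {0}" "CARD('p) ^ n \<le> card Z * (1 + CARD('p) * card D)"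
proof -
  define S where "S = {Z. add_subgroup Z \<and> Z \<subseteq> (vecs n :: (nat \<Rightarrow> 'p mod_ring) set) \<and> Z \<inter> D \<subseteq> {0}}"
  have "finite S" unfolding S_def by (rule finite_subset[of _ "Pow (vecs n)"]) auto
  moreover have "{0} \<in> S" by (auto simp: S_def add_subgroup_def vecs_def)
  ultimately obtain Z where Z: "Z \<in> S" and max: "\<And>Z'. Z' \<in> S \<Longrightarrow> Z \<subseteq> Z' \<Longrightarrow> Z' = Z"
    using finite_has_maximal[of S] by blast
  have ZS: "add_subgroup Z" "Z \<subseteq> vecs n" "Z \<inter> D \<subseteq> {0}" using Z by (auto simp: S_def)
  have fZ: "finite Z" using ZS(2) by (rule finite_subset) simp
  define I where "I = (\<lambda>(z, c, d). z + smul c d) ` (Z \<times> (UNIV :: 'p mod_ring set) \<times> D)"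
  have "vecs n \<subseteq> Z \<union> I"
  proof
    fix x :: "nat \<Rightarrow> 'p mod_ring" assume x: "x \<in> vecs n"
    show "x \<in> Z \<union> I"
    proof (rule ccontr)
      assume nx: "x \<notin> Z \<union> I"
      define Z' where "Z' = Z + range (\<lambda>c. smul c x)"
      have "add_subgroup (range (\<lambda>c. smul c x))"
        unfolding add_subgroup_def
      proof (intro conjI ballI)
        show "0 \<in> range (\<lambda>c. smul c x)" by (rule range_eqI[of _ _ 0]) (simp add: fun_eq_iff)
        fix u v assume "u \<in> range (\<lambda>c. smul c x)" "v \<in> range (\<lambda>c. smul c x)"
        then obtain a b where "u = smul a x" "v = smul b x" by blast
        then show "u - v \<in> range (\<lambda>c. smul c x)"
          by (intro range_eqI[of _ _ "a - b"]) (simp add: fun_eq_iff left_diff_distrib)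
      qed
      then have "add_subgroup Z'" unfolding Z'_def by (intro add_subgroup_set_plus ZS)
      moreover have "Z' \<subseteq> vecs n" unfolding Z'_def
        using ZS x by (intro set_plus_subset_vecs) (auto intro: smul_in_vecs)
      moreover have "0 = smul 0 x" by (auto simp: fun_eq_iff)
      then have "0 \<in> range (\<lambda>c. smul c x)" by (rule range_eqI)
      then have "Z \<subseteq> Z'" unfolding Z'_def by (metis add.commute set_zero_plus2)
      moreover have "0 + smul 1 x \<in> Z'"
        unfolding Z'_def by (intro set_plus_intro add_subgroup_zero[OF ZS(1)] rangeI)
      then have "x \<in> Z'" by simp
      ultimately have "\<not> Z' \<inter> D \<subseteq> {0}" using max[of Z'] nx by (auto simp: S_def)
      then obtain d z c where d: "d \<in> D" "d \<noteq> 0" "z \<in> Z" "d = z + smul c x"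
        by (auto simp: Z'_def elim!: set_plus_elim)
      have "smul 0 x = 0" by (auto simp: fun_eq_iff)
      then have c: "c \<noteq> 0" using d ZS(3) by auto
      have "x = smul (- 1 / c) z + smul (1 / c) d"
        using c by (auto simp: d(4) fun_eq_iff field_simps)
      then have "x \<in> I" unfolding I_def
        using d(1) add_subgroup_smul[OF ZS(1) d(3), of "- 1 / c"]
        by (intro image_eqI[of _ _ "(smul (- 1 / c) z, 1 / c, d)"]) auto
      then show False using nx by simp
    qed
  qed
  then have "card (vecs n :: (nat \<Rightarrow> 'p mod_ring) set) \<le> card (Z \<union> I)"
    by (rule card_mono[rotated]) (use fZ D in \<open>auto simp: I_def\<close>)
  also have "\<dots> \<le> card Z + card I" by (rule card_Un_le)
  also have "card I \<le> card (Z \<times> (UNIV :: 'p mod_ring set) \<times> D)"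
    unfolding I_def by (rule card_image_le) (use fZ D in auto)
  finally have "CARD('p) ^ n \<le> card Z * (1 + CARD('p) * card D)"
    by (simp add: card_vecs card_cartesian_product algebra_simps)
  then show ?thesis using that ZS by blast
qed

text \<open>Averaging over \<open>c\<close>: each value \<open>f y\<close> lies in exactly
  \<open>card Z\<close> of the translates of \<open>Z\<close>.\<close>

lemma popular_coset:
  fixes f :: "'b \<Rightarrow> nat \<Rightarrow> 'p::prime_card mod_ring"
  assumes Z: "add_subgroup Z" "Z \<subseteq> vecs n" and S: "finite S" "\<And>y. y \<in> S \<Longrightarrow> f y \<in> vecs n"
  obtains c where "c \<in> vecs n" "card S * card Z \<le> card {y \<in> S. f y - c \<in> Z} * CARD('p) ^ n"
proof -
  have fZ: "finite Z" using Z(2) by (rule finite_subset) simp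
  have "card {c \<in> vecs n. f y - c \<in> Z} = card Z" if "y \<in> S" for y
    by (rule bij_betw_same_card[of "\<lambda>c. f y - c"], rule bij_betw_byWitness[where f' = "\<lambda>z. f y - z"])
      (use S(2)[OF that] Z in \<open>auto intro!: add_subgroup_diff[OF add_subgroup_vecs]\<close>)
  then have "card S * card Z = (\<Sum>y\<in>S. card {c \<in> vecs n. f y - c \<in> Z})" by simp
  also have "\<dots> = (\<Sum>c\<in>vecs n. card {y \<in> S. f y - c \<in> Z})"
    using S by (intro sum_card_swap) auto
  finally have eq: "card S * card Z = (\<Sum>c\<in>vecs n. card {y \<in> S. f y - c \<in> Z})" .
  have "\<exists>c\<in>vecs n. card S * card Z \<le> card {y \<in> S. f y - c \<in> Z} * CARD('p) ^ n"
  proof (rule ccontr)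
    assume "\<not> ?thesis"
    then have "(\<Sum>c\<in>vecs n. card {y \<in> S. f y - c \<in> Z} * CARD('p) ^ n)
        < (\<Sum>c\<in>(vecs n :: (nat \<Rightarrow> 'p mod_ring) set). card S * card Z)"
      by (intro sum_strict_mono) (auto simp: not_le)
    then show False using eq by (simp add: sum_distrib_left card_vecs mult.commute)
  qed
  then show ?thesis using that by blast
qed

lemma energy_le_cube:
  assumes "finite A"
  shows "energy A \<le> card A ^ 3"
proof -
  have "energy A \<le> card (A \<times> A \<times> A)"
    unfolding energy_def
    by (rule card_inj_on_le[of "\<lambda>(a, b, c, d). (a, b, c)"]) (use assms in \<open>auto simp: inj_on_def\<close>)
  then show ?thesis by (simp add: card_cartesian_product power3_eq_cube)
qed

lemma set_plus_iterated_6: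
  fixes B :: "'a::ab_group_add set"
  assumes "a1 \<in> B" "a2 \<in> B" "a3 \<in> B" "a4 \<in> B" "a5 \<in> B" "a6 \<in> B"
  shows "a1 + a2 + a3 + a4 + a5 + a6 \<in> (\<Sum>i<(6::nat). B)"
proof -
  have "(\<Sum>i<(6::nat). B) = {0} + B + B + B + B + B + B"
    by (simp add: eval_nat_numeral set_zero)
  moreover have "0 + a1 + a2 + a3 + a4 + a5 + a6 \<in> {0} + B + B + B + B + B + B"
    using assms by (intro set_plus_intro) auto
  ultimately show ?thesis by simp
qed

text \<open>
  Six summands on each side are what the additivity of the map induced on \<open>W\<close> needs: every element
  of \<open>W\<close> is a combination of four elements of the domain.
\<close>

theorem energy_imp_affine:
  "\<exists>C::nat. \<forall>n k. \<forall>\<Gamma> :: ((nat \<Rightarrow> 'p::prime_card mod_ring) \<times> (nat \<Rightarrow> 'p mod_ring)) set.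
    0 < k \<longrightarrow> \<Gamma> \<subseteq> vecs n \<times> vecs n \<longrightarrow> (\<forall>y. card {u. (y, u) \<in> \<Gamma>} \<le> CARD('p) ^ k) \<longrightarrow>
    CARD('p) ^ (3 * n) \<le> energy \<Gamma> * CARD('p) ^ k \<longrightarrow>
    (\<exists>L c. additive L \<and> L ` vecs n \<subseteq> vecs n \<and> c \<in> vecs n \<and>
      CARD('p) ^ n \<le> CARD('p) ^ (C * k ^ 4) * card {(y, u) \<in> \<Gamma>. u = L y + c})"
proof -
  define p where "p = CARD('p)"
  have p: "2 \<le> p" using prime_card[where 'a = 'p] prime_ge_2_nat by (simp add: p_def)
  obtain C0 :: nat where C0: "\<And>n a (A :: (nat \<Rightarrow> 'p mod_ring) set). 0 < a \<Longrightarrow> A \<subseteq> vecs n \<Longrightarrow> p ^ n \<le> card A * p ^ a \<Longrightarrow>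
    (\<exists>V. add_subgroup V \<and> V \<subseteq> vecs n \<and> p ^ n \<le> card V * p ^ (C0 * a ^ 4) \<and>
      (\<forall>v\<in>V. p ^ (3 * n) \<le> p ^ (C0 * a) *
        card {(x1, x2, x3). x1 \<in> A \<and> x2 \<in> A \<and> x3 \<in> A \<and> x1 + x2 - x3 - v \<in> A}))"
    using sanders[where 'p = 'p] unfolding p_def by blast
  \<comment> \<open>The set \<open>S2\<close> below has density \<open>p ^ (- 801 * k)\<close>,
    where \<open>801 = 9 + 792\<close> counts the passage to a domain and to a coset of
    \<open>Z\<close>. The second summand pays for restricting to a coset of the space
    \<open>W\<close> that Sanders' theorem finds for \<open>S2\<close>.\<close>
  define C where "C = 801 + C0 * 801 ^ 4"
  show ?thesis unfolding p_def[symmetric]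
  proof (intro exI[of _ C] allI impI)
    fix n k and \<Gamma> :: "((nat \<Rightarrow> 'p mod_ring) \<times> (nat \<Rightarrow> 'p mod_ring)) set"
    assume k: "0 < k" and \<Gamma>: "\<Gamma> \<subseteq> vecs n \<times> vecs n" and fib: "\<forall>y. card {u. (y, u) \<in> \<Gamma>} \<le> p ^ k"
      and en: "p ^ (3 * n) \<le> energy \<Gamma> * p ^ k"
    have f\<Gamma>: "finite \<Gamma>" by (rule finite_subset[OF \<Gamma>]) simp
    have pn: "card (vecs n :: (nat \<Rightarrow> 'p mod_ring) set) = p ^ n" by (simp add: card_vecs p_def)
    have c\<Gamma>: "card \<Gamma> \<le> p ^ (n + k)"
    proof -
      have "\<Gamma> = (SIGMA y:vecs n. {u. (y, u) \<in> \<Gamma>})" using \<Gamma> by auto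
      moreover have "finite {u. (y, u) \<in> \<Gamma>}" for y
        by (rule finite_subset[of _ "vecs n"]) (use \<Gamma> in auto)
      then have "card (SIGMA y:vecs n. {u. (y, u) \<in> \<Gamma>}) = (\<Sum>y\<in>vecs n. card {u. (y, u) \<in> \<Gamma>})"
        by (intro card_SigmaI) auto
      ultimately have "card \<Gamma> = (\<Sum>y\<in>vecs n. card {u. (y, u) \<in> \<Gamma>})" by simp
      also have "\<dots> \<le> (\<Sum>y\<in>(vecs n :: (nat \<Rightarrow> 'p mod_ring) set). p ^ k)" by (rule sum_mono) (use fib in auto)
      finally show ?thesis by (simp add: pn power_add)
    qed
    have \<Gamma>n: "p ^ n \<le> card \<Gamma> * p ^ k"
    proof -
      have "(p ^ n) ^ 3 = p ^ (3 * n)" by (simp add: power_mult[symmetric] mult.commute)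
      also have "\<dots> \<le> card \<Gamma> ^ 3 * p ^ k" using en energy_le_cube[OF f\<Gamma>] mult_le_mono1 order_trans by blast
      also have "\<dots> \<le> card \<Gamma> ^ 3 * (p ^ k) ^ 3" using p by (intro mult_le_mono2 self_le_power) auto
      finally show ?thesis by (simp add: power_mult_distrib[symmetric] power_mono_iff)
    qed
    have \<Gamma>ne: "\<Gamma> \<noteq> {}" using \<Gamma>n p by auto
    \<comment> \<open>The graph may have \<open>p ^ (n + k)\<close> points, so its cube exceeds
      \<open>p ^ (3 * n)\<close> by up to \<open>p ^ (3 * k)\<close>; the energy hypothesis adds one
      more \<open>p ^ k\<close>.\<close>
    define K where "K = real (p ^ (4 * k))"
    have "card \<Gamma> ^ 3 \<le> (p ^ (n + k)) ^ 3" using c\<Gamma> by (intro power_mono) auto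
    also have "\<dots> = p ^ (3 * n) * p ^ (3 * k)" by (simp add: power_mult[symmetric] power_add[symmetric] algebra_simps)
    also have "\<dots> \<le> energy \<Gamma> * p ^ k * p ^ (3 * k)" using en by (rule mult_le_mono1)
    also have "\<dots> = p ^ (4 * k) * energy \<Gamma>" by (simp add: power_add[symmetric])
    finally have "real (card \<Gamma> ^ 3) \<le> real (p ^ (4 * k) * energy \<Gamma>)" unfolding of_nat_le_iff .
    then have EK: "real (card \<Gamma> ^ 3) \<le> K * energy \<Gamma>" by (simp add: K_def)
    have K0: "K > 0" using p by (simp add: K_def)
    obtain B where B: "B \<subseteq> \<Gamma>" "card \<Gamma> \<le> 8 * K * card B"
      and iter: "\<And>i j :: nat. card ((\<Sum>l<i. B) + uminus ` (\<Sum>l<j. B)) \<le> (9437184 * K ^ 9) ^ (i + j) * card \<Gamma>"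
      using energy_imp_small_iterated_difference[OF f\<Gamma> \<Gamma>ne K0 EK] by metis
    have fB: "finite B" using B f\<Gamma> finite_subset by blast
    have K8: "8 * K \<le> p ^ (7 * k)"
    proof -
      have "(2 :: nat) ^ 3 \<le> p ^ (3 * k)" using p k power_mono[of 2 p 3] power_increasing[of 3 "3 * k" p] by linarith
      then have "2 ^ 3 * p ^ (4 * k) \<le> p ^ (3 * k) * p ^ (4 * k)" by (rule mult_le_mono1)
      also have "\<dots> = p ^ (7 * k)" by (simp add: power_add[symmetric])
      finally have "real (2 ^ 3 * p ^ (4 * k)) \<le> real (p ^ (7 * k))" unfolding of_nat_le_iff .
      then show ?thesis by (simp add: K_def)
    qed
    have M: "9437184 * K ^ 9 \<le> p ^ (60 * k)"
    proof -
      have "(2 :: nat) ^ 24 \<le> p ^ (24 * k)"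
        using p k power_mono[of 2 p 24] power_increasing[of 24 "24 * k" p] by linarith
      then have "9437184 \<le> p ^ (24 * k)" by simp
      then have "9437184 * p ^ (36 * k) \<le> p ^ (24 * k) * p ^ (36 * k)" by (rule mult_le_mono1)
      also have "\<dots> = p ^ (60 * k)" by (simp add: power_add[symmetric])
      finally have "real (9437184 * p ^ (36 * k)) \<le> real (p ^ (60 * k))" unfolding of_nat_le_iff .
      moreover have "K ^ 9 = real (p ^ (36 * k))" by (simp add: K_def power_mult[symmetric])
      ultimately show ?thesis by simp
    qed

    define S1 where "S1 = fst ` B"
    \<comment> \<open>One value is chosen in each fibre of \<open>B\<close>. Fibres have at most
      \<open>p ^ k\<close> elements, so the domain \<open>S1\<close> is still dense.\<close>
    define f where "f y = (SOME u. (y, u) \<in> B)" for y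
    have fB': "(y, f y) \<in> B" if "y \<in> S1" for y
    proof -
      have "\<exists>u. (y, u) \<in> B" using that by (auto simp: S1_def)
      then show ?thesis unfolding f_def by (rule someI_ex)
    qed
    have fS1: "finite S1" using fB by (simp add: S1_def)
    have S1v: "S1 \<subseteq> vecs n" "\<And>y. y \<in> S1 \<Longrightarrow> f y \<in> vecs n" using fB' B \<Gamma> by (auto simp: S1_def)
    have cB: "card B \<le> card S1 * p ^ k"
    proof -
      have fi: "finite {u. (y, u) \<in> \<Gamma>}" for y
        by (rule finite_subset[of _ "vecs n"]) (use \<Gamma> in auto)
      have "B \<subseteq> (SIGMA y:S1. {u. (y, u) \<in> \<Gamma>})" using B by (force simp: S1_def)
      then have "card B \<le> card (SIGMA y:S1. {u. (y, u) \<in> \<Gamma>})"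
        by (rule card_mono[rotated]) (use fS1 fi in auto)
      also have "\<dots> = (\<Sum>y\<in>S1. card {u. (y, u) \<in> \<Gamma>})" using fS1 fi by simp
      also have "\<dots> \<le> (\<Sum>y\<in>S1. p ^ k)" by (rule sum_mono) (use fib in auto)
      finally show ?thesis by simp
    qed
    have S1n: "p ^ n \<le> card S1 * p ^ (9 * k)"
    proof -
      have "real (card \<Gamma>) \<le> p ^ (7 * k) * card B"
        using B(2) mult_right_mono[OF K8, of "card B"] by simp
      then have "real (card \<Gamma>) \<le> real (p ^ (7 * k) * card B)" by simp
      then have "card \<Gamma> \<le> p ^ (7 * k) * card B" unfolding of_nat_le_iff .
      also have "\<dots> \<le> p ^ (7 * k) * (card S1 * p ^ k)" using cB by (rule mult_le_mono2)
      finally have "card \<Gamma> * p ^ k \<le> p ^ (7 * k) * (card S1 * p ^ k) * p ^ k" by (rule mult_le_mono1)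
      also have "\<dots> = card S1 * p ^ (9 * k)"
        by (simp add: power_add[symmetric] mult.assoc mult.left_commute[of _ "card S1"])
      finally show ?thesis using \<Gamma>n by linarith
    qed

    define D6 where "D6 = (\<Sum>l<(6::nat). B) + uminus ` (\<Sum>l<(6::nat). B)"
    \<comment> \<open>The possible discrepancies between two sums of six values of \<open>f\<close>
      whose arguments have the same sum: \<open>f\<close> is a Freiman homomorphism of order six as
      soon as they vanish.\<close>
    define D where "D = {u. (0, u) \<in> D6}"
    have fD6: "finite D6" unfolding D6_def using fB by (intro finite_set_plus finite_imageI finite_iterated_set_plus)
    have fD: "finite D"
      by (rule finite_subset[of _ "snd ` D6"]) (use fD6 in \<open>force simp: D_def\<close>, use fD6 in simp)
    \<comment> \<open>Shifting the graph of \<open>f\<close> vertically by the elements of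
      \<open>D\<close> gives disjoint subsets of \<open>D7\<close>, where thirteen copies of
      \<open>B\<close> are combined: \<open>790 = 13 * 60 + 1 + 9\<close>.\<close>
    have cD: "card D \<le> p ^ (790 * k)"
    proof -
      define D7 where "D7 = (\<Sum>l<(7::nat). B) + uminus ` (\<Sum>l<(6::nat). B)"
      have D7: "D7 = B + D6"
        using sum.lessThan_Suc[of "\<lambda>_. B" 6] by (simp add: D7_def D6_def add_ac)
      have "card (D \<times> S1) \<le> card D7"
      proof (rule card_inj_on_le[of "\<lambda>(u, y). (y, f y) + (0, u)"])
        show "finite D7" unfolding D7 using fB fD6 by (rule finite_set_plus)
        show "(\<lambda>(u, y). (y, f y) + (0, u)) ` (D \<times> S1) \<subseteq> D7"
          unfolding D7 using fB' by (auto simp: D_def simp del: add_Pair intro!: set_plus_intro)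
      qed (auto simp: inj_on_def)
      then have "real (card D * card S1) \<le> real (card D7)" by (simp only: card_cartesian_product of_nat_le_iff)
      also have "\<dots> \<le> (9437184 * K ^ 9) ^ 13 * card \<Gamma>" using iter[of 7 6] by (simp add: D7_def)
      also have "\<dots> \<le> real ((p ^ (60 * k)) ^ 13) * real (p ^ (n + k))"
      proof (intro mult_mono)
        show "(9437184 * K ^ 9) ^ 13 \<le> real ((p ^ (60 * k)) ^ 13)"
          unfolding of_nat_power[of "p ^ (60 * k)"] by (rule power_mono[OF M]) (use K0 in simp)
        show "real (card \<Gamma>) \<le> real (p ^ (n + k))" using c\<Gamma> unfolding of_nat_le_iff .
      qed auto
      also have "\<dots> = real (p ^ (781 * k + n))" by (simp add: power_mult[symmetric] power_add[symmetric] algebra_simps)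
      finally have "card D * card S1 \<le> p ^ (781 * k + n)" unfolding of_nat_le_iff .
      then have "card D * card S1 * p ^ (9 * k) \<le> p ^ (781 * k + n) * p ^ (9 * k)" by (rule mult_le_mono1)
      also have "\<dots> = p ^ (790 * k) * p ^ n" by (simp add: power_add[symmetric])
      finally have "card D * (card S1 * p ^ (9 * k)) \<le> p ^ (790 * k) * p ^ n" by (simp add: mult.assoc)
      moreover have "card D * p ^ n \<le> card D * (card S1 * p ^ (9 * k))" using S1n by (rule mult_le_mono2)
      ultimately have "card D * p ^ n \<le> p ^ (790 * k) * p ^ n" by linarith
      then show ?thesis using p by simp
    qed
    obtain Z where Z: "add_subgroup Z" "Z \<subseteq> vecs n" "Z \<inter> D \<subseteq> {0}" "p ^ n \<le> card Z * (1 + p * card D)"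
      using subgroup_avoiding[OF fD, of n] unfolding p_def by blast
    have Zn: "p ^ n \<le> card Z * p ^ (792 * k)"
    proof -
      have "1 + p * card D \<le> 1 + p * p ^ (790 * k)" using cD by simp
      also have "\<dots> \<le> p * p ^ (790 * k) + p * p ^ (790 * k)" using p by simp
      also have "\<dots> \<le> p * (p * p ^ (790 * k))" using p by (simp add: mult_2[symmetric] mult_le_mono)
      also have "\<dots> = p ^ (790 * k + 2)" by (simp add: power_add power2_eq_square mult_ac)
      also have "\<dots> \<le> p ^ (792 * k)" using p k by (intro power_increasing) auto
      finally show ?thesis using Z(4) mult_le_mono2 order_trans by blast
    qed
    \<comment> \<open>When all values lie in one coset of \<open>Z\<close>, every discrepancy lies
      in \<open>Z \<inter> D\<close> and is zero.\<close>
    obtain c where c: "c \<in> vecs n" "card S1 * card Z \<le> card {y \<in> S1. f y - c \<in> Z} * p ^ n"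
      using popular_coset[OF Z(1,2) fS1, of f] S1v(2) unfolding p_def by blast
    define S2 where "S2 = {y \<in> S1. f y - c \<in> Z}"
    have S2: "S2 \<subseteq> S1" "S2 \<subseteq> vecs n" "finite S2" using S1v fS1 by (auto simp: S2_def)
    have S2n: "p ^ n \<le> card S2 * p ^ (801 * k)"
    proof -
      have "p ^ n * p ^ n \<le> (card S1 * p ^ (9 * k)) * (card Z * p ^ (792 * k))"
        by (rule mult_le_mono[OF S1n Zn])
      also have "\<dots> = card S1 * card Z * p ^ (801 * k)" by (simp add: power_add[symmetric] mult_ac)
      also have "\<dots> \<le> card S2 * p ^ n * p ^ (801 * k)" using c(2) unfolding S2_def by (rule mult_le_mono1)
      finally have "p ^ n * p ^ n \<le> card S2 * p ^ (801 * k) * p ^ n" by (simp add: mult_ac)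
      then show ?thesis using p by simp
    qed
    have hom: "f x1 + f x2 + f x3 + f x4 + f x5 + f x6 = f y1 + f y2 + f y3 + f y4 + f y5 + f y6"
      if x: "x1 \<in> S2" "x2 \<in> S2" "x3 \<in> S2" "x4 \<in> S2" "x5 \<in> S2" "x6 \<in> S2"
      and y: "y1 \<in> S2" "y2 \<in> S2" "y3 \<in> S2" "y4 \<in> S2" "y5 \<in> S2" "y6 \<in> S2"
      and eq: "x1 + x2 + x3 + x4 + x5 + x6 = y1 + y2 + y3 + y4 + y5 + y6" for x1 x2 x3 x4 x5 x6 y1 y2 y3 y4 y5 y6
    proof -
      define u where "u = (f x1 + f x2 + f x3 + f x4 + f x5 + f x6) - (f y1 + f y2 + f y3 + f y4 + f y5 + f y6)"
      have fS2: "(y, f y) \<in> B" if "y \<in> S2" for y using that S2 fB' by blast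
      have "(x1, f x1) + (x2, f x2) + (x3, f x3) + (x4, f x4) + (x5, f x5) + (x6, f x6) \<in> (\<Sum>l<(6::nat). B)"
        "(y1, f y1) + (y2, f y2) + (y3, f y3) + (y4, f y4) + (y5, f y5) + (y6, f y6) \<in> (\<Sum>l<(6::nat). B)"
        using set_plus_iterated_6[OF fS2[OF x(1)] fS2[OF x(2)] fS2[OF x(3)] fS2[OF x(4)] fS2[OF x(5)] fS2[OF x(6)]]
          set_plus_iterated_6[OF fS2[OF y(1)] fS2[OF y(2)] fS2[OF y(3)] fS2[OF y(4)] fS2[OF y(5)] fS2[OF y(6)]]
        by blast+
      then have "(x1, f x1) + (x2, f x2) + (x3, f x3) + (x4, f x4) + (x5, f x5) + (x6, f x6) +
          - ((y1, f y1) + (y2, f y2) + (y3, f y3) + (y4, f y4) + (y5, f y5) + (y6, f y6)) \<in> D6"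
        unfolding D6_def by (intro set_plus_intro imageI)
      then have "(x1 + x2 + x3 + x4 + x5 + x6 - (y1 + y2 + y3 + y4 + y5 + y6), u) \<in> D6"
        unfolding u_def diff_conv_add_uminus by (simp only: add_Pair uminus_Pair)
      then have "u \<in> D" unfolding eq by (simp add: D_def)
      have Zm: "f y - c \<in> Z" if "y \<in> S2" for y using that by (simp add: S2_def)
      have "u = (f x1 - c) + (f x2 - c) + (f x3 - c) + (f x4 - c) + (f x5 - c) + (f x6 - c)
          - ((f y1 - c) + (f y2 - c) + (f y3 - c) + (f y4 - c) + (f y5 - c) + (f y6 - c))"
        by (simp add: u_def)
      also have "\<dots> \<in> Z"
        by (intro add_subgroup_diff[OF Z(1)] add_subgroup_add[OF Z(1)] Zm x y)
      finally have "u = 0" using \<open>u \<in> D\<close> Z(3) by blast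
      then show ?thesis by (simp add: u_def)
    qed

    obtain W where W: "add_subgroup W" "W \<subseteq> vecs n" "p ^ n \<le> card W * p ^ (C0 * (801 * k) ^ 4)"
      and reps: "\<forall>v\<in>W. p ^ (3 * n) \<le> p ^ (C0 * (801 * k)) *
        card {(x1, x2, x3). x1 \<in> S2 \<and> x2 \<in> S2 \<and> x3 \<in> S2 \<and> x1 + x2 - x3 - v \<in> S2}"
      using C0[OF _ S2(2) S2n] k by auto
    have "\<exists>x. fst x \<in> S2 \<and> fst (snd x) \<in> S2 \<and> fst (snd (snd x)) \<in> S2 \<and> snd (snd (snd x)) \<in> S2 \<and>
        fst x + fst (snd x) = w + fst (snd (snd x)) + snd (snd (snd x))" if "w \<in> W" for w
    proof -
      have "card {(x1, x2, x3). x1 \<in> S2 \<and> x2 \<in> S2 \<and> x3 \<in> S2 \<and> x1 + x2 - x3 - w \<in> S2} \<noteq> 0"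
        using reps that p by (intro notI) auto
      then obtain x1 x2 x3 where "x1 \<in> S2" "x2 \<in> S2" "x3 \<in> S2" "x1 + x2 - x3 - w \<in> S2"
        by (metis (no_types, lifting) card.empty case_prodE empty_Collect_eq)
      then show ?thesis by (intro exI[of _ "(x1, x2, x3, x1 + x2 - x3 - w)"]) (simp add: algebra_simps)
    qed
    then obtain x where x: "\<And>w. w \<in> W \<Longrightarrow> fst (x w) \<in> S2 \<and> fst (snd (x w)) \<in> S2 \<and>
        fst (snd (snd (x w))) \<in> S2 \<and> snd (snd (snd (x w))) \<in> S2 \<and>
        fst (x w) + fst (snd (x w)) = w + fst (snd (snd (x w))) + snd (snd (snd (x w)))"
      by metis
    define x1 x2 x3 x4 where "x1 w = fst (x w)" and "x2 w = fst (snd (x w))"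
      and "x3 w = fst (snd (snd (x w)))" and "x4 w = snd (snd (snd (x w)))" for w
    have xS: "x1 w \<in> S2" "x2 w \<in> S2" "x3 w \<in> S2" "x4 w \<in> S2" and xe: "x1 w + x2 w = w + x3 w + x4 w"
      if "w \<in> W" for w using x[OF that] by (auto simp: x1_def x2_def x3_def x4_def)
    \<comment> \<open>The representation of \<open>w\<close> was chosen arbitrarily; by
      \<open>hom\<close> the value does not depend on it.\<close>
    define T where "T w = f (x1 w) + f (x2 w) - f (x3 w) - f (x4 w)" for w
    have Tadd: "T (w + w') = T w + T w'" if w: "w \<in> W" "w' \<in> W" for w w'
    proof -
      have ww: "w + w' \<in> W" using w by (rule add_subgroup_add[OF W(1)])
      have "f (x1 w) + f (x2 w) + f (x1 w') + f (x2 w') + f (x3 (w + w')) + f (x4 (w + w')) =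
          f (x3 w) + f (x4 w) + f (x3 w') + f (x4 w') + f (x1 (w + w')) + f (x2 (w + w'))"
      proof (intro hom xS w ww)
        have "x1 w + x2 w + x1 w' + x2 w' + x3 (w + w') + x4 (w + w')
            = (x1 w + x2 w) + (x1 w' + x2 w') + (x3 (w + w') + x4 (w + w'))" by (simp add: add_ac)
        also have "\<dots> = x3 w + x4 w + x3 w' + x4 w' + (x1 (w + w') + x2 (w + w'))"
          unfolding xe[OF w(1)] xe[OF w(2)] xe[OF ww] by (simp add: add_ac)
        finally show "x1 w + x2 w + x1 w' + x2 w' + x3 (w + w') + x4 (w + w') =
            x3 w + x4 w + x3 w' + x4 w' + x1 (w + w') + x2 (w + w')" by (simp add: add_ac)
      qed
      then show ?thesis unfolding T_def by (simp add: algebra_simps)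
    qed
    have Tdiff: "T (y - y0) = f y - f y0" if y: "y \<in> S2" "y0 \<in> S2" "y - y0 \<in> W" for y y0
    proof -
      let ?w = "y - y0"
      \<comment> \<open>Three copies of \<open>f y\<close> on either side fill the sums up to the
        six terms of \<open>hom\<close>.\<close>
      have "f (x1 ?w) + f (x2 ?w) + f y0 + f y + f y + f y = f (x3 ?w) + f (x4 ?w) + f y + f y + f y + f y"
      proof (intro hom xS y)
        have "x1 ?w + x2 ?w + y0 = x3 ?w + x4 ?w + y" unfolding xe[OF y(3)] by (simp add: algebra_simps)
        then show "x1 ?w + x2 ?w + y0 + y + y + y = x3 ?w + x4 ?w + y + y + y + y" by (simp only:)
      qed
      then show ?thesis unfolding T_def by (simp add: algebra_simps)
    qed
    obtain g where g: "additive g" "range g \<subseteq> W" "\<And>w. w \<in> W \<Longrightarrow> g w = w"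
      using ex_projection[OF W(1)] by blast
    define L where "L y = T (g y)" for y
    have gW: "g y \<in> W" for y using g(2) by auto
    have addL: "additive L"
      by unfold_locales (simp add: L_def additive.add[OF g(1)] Tadd gW)
    have Tv: "T w \<in> vecs n" if "w \<in> W" for w
      unfolding T_def using xS[OF that] S2 S1v
      by (intro add_subgroup_diff[OF add_subgroup_vecs] add_subgroup_add[OF add_subgroup_vecs]) blast+
    have Lv: "L y \<in> vecs n" for y unfolding L_def by (rule Tv[OF gW])
    \<comment> \<open>Within one coset of \<open>W\<close> the differences of arguments lie in
      \<open>W\<close>, where \<open>L\<close> agrees with \<open>T\<close> and \<open>Tdiff\<close>
      applies.\<close>
    obtain c0 where c0: "c0 \<in> vecs n" "card S2 * card W \<le> card {y \<in> S2. y - c0 \<in> W} * p ^ n"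
      using popular_coset[OF W(1,2) S2(3), of "\<lambda>y. y"] S2(2) unfolding p_def by blast
    define S3 where "S3 = {y \<in> S2. y - c0 \<in> W}"
    have S3n: "p ^ n \<le> p ^ (C * k ^ 4) * card S3"
    proof -
      have "p ^ n * p ^ n \<le> (card S2 * p ^ (801 * k)) * (card W * p ^ (C0 * (801 * k) ^ 4))"
        by (rule mult_le_mono[OF S2n W(3)])
      also have "\<dots> = card S2 * card W * p ^ (801 * k + C0 * (801 * k) ^ 4)" by (simp add: power_add mult_ac)
      also have "\<dots> \<le> card S3 * p ^ n * p ^ (801 * k + C0 * (801 * k) ^ 4)"
        using c0(2) unfolding S3_def by (rule mult_le_mono1)
      also have "\<dots> \<le> card S3 * p ^ n * p ^ (C * k ^ 4)"
      proof (intro mult_le_mono2 power_increasing)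
        have "k * 1 \<le> k * k ^ 3" using k by (intro mult_le_mono2) simp
        also have "k * k ^ 3 = k ^ 4" by (simp add: eval_nat_numeral)
        finally show "801 * k + C0 * (801 * k) ^ 4 \<le> C * k ^ 4"
          by (simp add: C_def power_mult_distrib algebra_simps)
      qed (use p in simp)
      finally have "p ^ n * p ^ n \<le> p ^ (C * k ^ 4) * card S3 * p ^ n" by (simp add: mult_ac)
      then show ?thesis using p by simp
    qed
    then have "S3 \<noteq> {}" using p by auto
    then obtain y0 where y0: "y0 \<in> S3" by blast
    have aff: "f y = L y + (f y0 - L y0)" if "y \<in> S3" for y
    proof -
      have "y - y0 = (y - c0) - (y0 - c0)" by simp
      also have "\<dots> \<in> W" by (rule add_subgroup_diff[OF W(1)]) (use that y0 in \<open>auto simp: S3_def\<close>)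
      finally have w: "y - y0 \<in> W" .
      have "L y - L y0 = L (y - y0)" using additive.diff[OF addL] by simp
      also have "\<dots> = T (y - y0)" by (simp add: L_def g(3)[OF w])
      also have "\<dots> = f y - f y0" using that y0 w by (intro Tdiff) (auto simp: S3_def)
      finally show ?thesis by (simp add: algebra_simps)
    qed
    have "card S3 \<le> card {(y, u) \<in> \<Gamma>. u = L y + (f y0 - L y0)}"
    proof (rule card_inj_on_le[of "\<lambda>y. (y, f y)"])
      show "finite {(y, u) \<in> \<Gamma>. u = L y + (f y0 - L y0)}"
        by (rule finite_subset[OF _ f\<Gamma>]) auto
      show "(\<lambda>y. (y, f y)) ` S3 \<subseteq> {(y, u) \<in> \<Gamma>. u = L y + (f y0 - L y0)}"
      proof (rule image_subsetI)
        fix y assume y: "y \<in> S3"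
        then have "(y, f y) \<in> \<Gamma>" using fB' B S2 by (auto simp: S3_def)
        then show "(y, f y) \<in> {(y, u) \<in> \<Gamma>. u = L y + (f y0 - L y0)}" using aff[OF y] by blast
      qed
    qed (auto simp: inj_on_def)
    then have "p ^ n \<le> p ^ (C * k ^ 4) * card {(y, u) \<in> \<Gamma>. u = L y + (f y0 - L y0)}"
      using S3n mult_le_mono2 order_trans by blast
    moreover have "f y0 - L y0 \<in> vecs n"
      using y0 S2 S1v Lv by (intro add_subgroup_diff[OF add_subgroup_vecs]) (auto simp: S3_def)
    ultimately show "\<exists>L c. additive L \<and> L ` vecs n \<subseteq> vecs n \<and> c \<in> vecs n \<and>
        p ^ n \<le> p ^ (C * k ^ 4) * card {(y, u) \<in> \<Gamma>. u = L y + c}"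
      using addL Lv by blast
  qed
qed

subsection \<open>Spans and ranks\<close>

text \<open>Generators are an indexed and possibly dependent family, so the same coefficients can be
  applied to the values of \<open>k\<close> maps at any point; \<open>k\<close> only bounds the
  dimension.\<close>

definition lspan :: "nat \<Rightarrow> (nat \<Rightarrow> nat \<Rightarrow> 'p::prime_card mod_ring) \<Rightarrow> (nat \<Rightarrow> 'p mod_ring) set" where
  "lspan k b = {\<Sum>i<k. smul (a i) (b i) | a. True}"

lemma smul_diff_left: "smul (a - b) (x :: 'b \<Rightarrow> 'a::ring) = smul a x - smul b x"
  by (simp add: fun_eq_iff left_diff_distrib)

lemma smul_add_left: "smul (a + b) (x :: 'b \<Rightarrow> 'a::ring) = smul a x + smul b x"
  by (simp add: fun_eq_iff distrib_right)

lemma add_subgroup_lspan: "add_subgroup (lspan k b)"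
  unfolding add_subgroup_def
proof (intro conjI ballI)
  show "0 \<in> lspan k b" unfolding lspan_def by (rule CollectI, rule exI[of _ "\<lambda>_. 0"]) simp
  fix x y assume "x \<in> lspan k b" "y \<in> lspan k b"
  then obtain a a' where "x = (\<Sum>i<k. smul (a i) (b i))" "y = (\<Sum>i<k. smul (a' i) (b i))"
    by (auto simp: lspan_def)
  then have "x - y = (\<Sum>i<k. smul (a i - a' i) (b i))" by (simp add: smul_diff_left sum_subtractf)
  then show "x - y \<in> lspan k b" by (auto simp: lspan_def)
qed

lemma lspan_member: "i < k \<Longrightarrow> b i \<in> lspan k b"
  unfolding lspan_def
  by (rule CollectI, rule exI[of _ "\<lambda>j. if j = i then 1 else 0"])
    (simp add: if_distrib[of "\<lambda>c. smul c _"] sum.delta cong: if_cong)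

lemma lspan_subset:
  assumes "add_subgroup G" "\<And>i. i < k \<Longrightarrow> b i \<in> G"
  shows "lspan k b \<subseteq> G"
proof
  fix x assume "x \<in> lspan k b"
  then obtain a where x: "x = (\<Sum>i<k. smul (a i) (b i))" by (auto simp: lspan_def)
  show "x \<in> G" unfolding x
    by (intro add_subgroup_sum[OF assms(1)] add_subgroup_smul[OF assms(1)] assms(2)) simp
qed

lemma lspan_restrict:
  "lspan k b = (\<lambda>a. \<Sum>i<k. smul (a i) (b i)) ` ({..<k} \<rightarrow>\<^sub>E UNIV)"
proof
  show "lspan k b \<subseteq> (\<lambda>a. \<Sum>i<k. smul (a i) (b i)) ` ({..<k} \<rightarrow>\<^sub>E UNIV)"
  proof
    fix x assume "x \<in> lspan k b"
    then obtain a where "x = (\<Sum>i<k. smul (a i) (b i))" by (auto simp: lspan_def)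
    then show "x \<in> (\<lambda>a. \<Sum>i<k. smul (a i) (b i)) ` ({..<k} \<rightarrow>\<^sub>E UNIV)"
      by (intro image_eqI[of _ _ "restrict a {..<k}"]) auto
  qed
qed (auto simp: lspan_def)

lemma finite_lspan: "finite (lspan k b)"
  unfolding lspan_restrict by (intro finite_imageI finite_PiE) auto

lemma card_lspan_le: "card (lspan k (b :: nat \<Rightarrow> nat \<Rightarrow> 'p::prime_card mod_ring)) \<le> CARD('p) ^ k"
proof -
  have "card (lspan k b) \<le> card ({..<k} \<rightarrow>\<^sub>E (UNIV :: 'p mod_ring set))"
    unfolding lspan_restrict by (intro card_image_le finite_PiE) auto
  then show ?thesis by (simp add: card_PiE)
qed

text \<open>Gaussian elimination by sizes: the vectors of \<open>I\<close> that vanish in a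
  coordinate not identically zero on \<open>I\<close> form a subgroup smaller by the factor
  \<open>CARD('p)\<close>. Zero vectors fill the family up to exactly \<open>m\<close>
  members.\<close>

lemma ex_generators:
  fixes I :: "(nat \<Rightarrow> 'p::prime_card mod_ring) set"
  assumes "add_subgroup I" "finite I" "card I \<le> CARD('p) ^ m"
  obtains b where "\<And>i. i < m \<Longrightarrow> b i \<in> I" "I \<subseteq> lspan m b"
  using assms
proof (induction m arbitrary: I thesis)
  case 0
  have "I = {0}"
    using card_le_Suc0_iff_eq[OF 0(3)] 0(4) add_subgroup_zero[OF 0(2)] by auto
  then show ?case using 0(1)[of "\<lambda>_. 0"] by (simp add: lspan_def)
next
  case (Suc m)
  show ?case
  proof (cases "I = {0}")
    case True
    show ?thesis
      by (rule Suc.prems(1)[of "\<lambda>_. 0"]) (use True add_subgroup_zero[OF add_subgroup_lspan] in \<open>simp_all add: fun_eq_iff\<close>)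
  next
    case False
    then obtain v where v: "v \<in> I" "v \<noteq> 0" using add_subgroup_zero[OF Suc.prems(2)] by blast
    then obtain j where j: "v j \<noteq> 0" by (auto simp: fun_eq_iff)
    define I0 where "I0 = {x \<in> I. x j = 0}"
    have "card I = CARD('p) * card I0"
      unfolding I0_def by (rule card_kernel_functional[OF Suc.prems(2) v(1)]) (auto simp: j)
    then have "card I0 \<le> CARD('p) ^ m" using Suc.prems(4) by simp
    moreover have "add_subgroup I0" using Suc.prems(2) by (auto simp: I0_def add_subgroup_def)
    moreover have "finite I0" using Suc.prems(3) by (simp add: I0_def)
    ultimately obtain b where b: "\<And>i. i < m \<Longrightarrow> b i \<in> I0" "I0 \<subseteq> lspan m b" using Suc.IH by metis
    define b' where "b' = b(m := v)"
    show ?thesis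
    proof (rule Suc.prems(1))
      show "b' i \<in> I" if "i < Suc m" for i
        using that b(1)[of i] v by (cases "i = m") (auto simp: b'_def I0_def)
      have sub: "lspan m b \<subseteq> lspan (Suc m) b'"
        by (rule lspan_subset[OF add_subgroup_lspan])
          (metis b'_def fun_upd_other less_SucI lspan_member nat_neq_iff)
      show "I \<subseteq> lspan (Suc m) b'"
      proof
        fix x assume x: "x \<in> I"
        have "x - smul (x j / v j) v \<in> I0"
          using x v j by (auto simp: I0_def intro!: add_subgroup_diff[OF Suc.prems(2)] add_subgroup_smul[OF Suc.prems(2)])
        then have 1: "x - smul (x j / v j) v \<in> lspan (Suc m) b'" using b sub by blast
        have "b' m \<in> lspan (Suc m) b'" by (rule lspan_member) simp
        then have "smul (x j / v j) v \<in> lspan (Suc m) b'"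
          by (intro add_subgroup_smul[OF add_subgroup_lspan]) (simp add: b'_def)
        from add_subgroup_add[OF add_subgroup_lspan 1 this] show "x \<in> lspan (Suc m) b'" by simp
      qed
    qed
  qed
qed

text \<open>With \<open>C = {0}\<close> the hypothesis says that \<open>M\<close> has rank at least \<open>R\<close>.\<close>

lemma card_preimage_coset:
  fixes M :: "(nat \<Rightarrow> 'p::prime_card mod_ring) \<Rightarrow> nat \<Rightarrow> 'p mod_ring"
  assumes M: "additive M" and C: "add_subgroup C" "finite C"
    and big: "CARD('p) ^ R * card C \<le> card (M ` vecs n + C)"
  shows "card {y \<in> vecs n. M y + e \<in> C} * CARD('p) ^ R \<le> CARD('p) ^ n"
proof (cases "{y \<in> vecs n. M y + e \<in> C} = {}")
  case True
  then show ?thesis by (simp only: True card.empty mult_0 zero_le)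
next
  case False
  define F where "F = {y \<in> vecs n. M y + e \<in> C}"
  obtain y1 where y1: "y1 \<in> F" using False by (auto simp: F_def)
  have fF: "finite F" by (rule finite_subset[of _ "vecs n"]) (auto simp: F_def)
  have C0: "card C > 0" using C add_subgroup_zero by (auto simp: card_gt_0_iff)
  define I where "I = M ` vecs n + C"
  have fI: "finite I" unfolding I_def using C by (intro finite_set_plus) auto
  \<comment> \<open>Differences of elements of \<open>F\<close> yield pairs on which
    \<open>M y + c\<close> is zero. Adding these to one pair over \<open>x\<close> gives at least
    \<open>card F\<close> pairs over every \<open>x\<close> in the image.\<close>
  define fib where "fib x = {q \<in> vecs n \<times> C. M (fst q) + snd q = x}" for x
  have ffib: "finite (fib x)" for x
    by (rule finite_subset[of _ "vecs n \<times> C"]) (use C in \<open>auto simp: fib_def\<close>)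
  have "card F \<le> card (fib x)" if x: "x \<in> I" for x
  proof -
    obtain y0 c0 where x0: "y0 \<in> vecs n" "c0 \<in> C" "x = M y0 + c0"
      using x by (auto simp: I_def elim!: set_plus_elim)
    show ?thesis
    proof (rule card_inj_on_le[of "\<lambda>y. (y0 + (y - y1), c0 - (M y - M y1))"])
      show "(\<lambda>y. (y0 + (y - y1), c0 - (M y - M y1))) ` F \<subseteq> fib x"
      proof clarify
        fix y assume y: "y \<in> F"
        have "M y - M y1 = (M y + e) - (M y1 + e)" by simp
        also have "\<dots> \<in> C" by (rule add_subgroup_diff[OF C(1)]) (use y y1 in \<open>auto simp: F_def\<close>)
        finally have "M y - M y1 \<in> C" .
        then have "c0 - (M y - M y1) \<in> C" by (rule add_subgroup_diff[OF C(1) x0(2)])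
        moreover have "y - y1 \<in> vecs n"
          by (rule add_subgroup_diff[OF add_subgroup_vecs]) (use y y1 in \<open>auto simp: F_def\<close>)
        then have "y0 + (y - y1) \<in> vecs n" by (rule add_subgroup_add[OF add_subgroup_vecs x0(1)])
        ultimately show "(y0 + (y - y1), c0 - (M y - M y1)) \<in> fib x"
          using x0(3) by (simp add: fib_def additive.add[OF M] additive.diff[OF M])
      qed
    qed (use ffib in \<open>auto simp: inj_on_def\<close>)
  qed
  then have "card I * card F \<le> (\<Sum>x\<in>I. card (fib x))" using sum_mono[of I "\<lambda>_. card F"] by simp
  also have "\<dots> = card (SIGMA x:I. fib x)" using fI ffib by simp
  also have "\<dots> \<le> card ((vecs n :: (nat \<Rightarrow> 'p mod_ring) set) \<times> C)"
    by (rule card_inj_on_le[of snd]) (use C in \<open>auto simp: inj_on_def fib_def\<close>)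
  finally have 1: "card I * card F \<le> CARD('p) ^ n * card C" by (simp add: card_cartesian_product card_vecs)
  have "(card F * CARD('p) ^ R) * card C = CARD('p) ^ R * card C * card F" by (simp add: mult_ac)
  also have "\<dots> \<le> card I * card F" using big unfolding I_def by (rule mult_le_mono1)
  also note 1
  finally have "(card F * CARD('p) ^ R) * card C \<le> CARD('p) ^ n * card C" .
  then show ?thesis using C0 by (simp add: F_def)
qed

lemma additive_combination:
  assumes "\<And>i. i < k \<Longrightarrow> additive (L i)"
  shows "additive (\<lambda>y. \<Sum>i<k. smul (a i :: 'p::prime_card mod_ring) (L i y :: nat \<Rightarrow> 'p mod_ring))"
proof
  fix x y
  have "smul (a i) (L i (x + y)) = smul (a i) (L i x) + smul (a i) (L i y)" if "i < k" for i
    using additive.add[OF assms[OF that]] by (simp add: fun_eq_iff distrib_left)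
  then have "(\<Sum>i<k. smul (a i) (L i (x + y))) = (\<Sum>i<k. smul (a i) (L i x) + smul (a i) (L i y))"
    by (intro sum.cong) auto
  then show "(\<Sum>i<k. smul (a i) (L i (x + y))) = (\<Sum>i<k. smul (a i) (L i x)) + (\<Sum>i<k. smul (a i) (L i y))"
    by (simp only: sum.distrib)
qed

text \<open>
  As long as some nontrivial combination of the maps has small rank modulo \<open>C\<close>, its image is added
  to \<open>C\<close> and one of the maps becomes redundant.
\<close>

lemma rank_reduction:
  fixes L :: "nat \<Rightarrow> (nat \<Rightarrow> 'p::prime_card mod_ring) \<Rightarrow> nat \<Rightarrow> 'p mod_ring"
  assumes "\<And>i. i < k \<Longrightarrow> additive (L i) \<and> L i ` vecs n \<subseteq> vecs n"
    and "add_subgroup C" "C \<subseteq> vecs n"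
  obtains k' L' C' where "k' \<le> k" "add_subgroup C'" "C' \<subseteq> vecs n" "C \<subseteq> C'" "card C' \<le> card C * CARD('p) ^ (k * R)"
    "\<And>i. i < k' \<Longrightarrow> additive (L' i) \<and> L' i ` vecs n \<subseteq> vecs n"
    "\<And>i z. i < k \<Longrightarrow> z \<in> vecs n \<Longrightarrow> L i z \<in> C' + lspan k' (\<lambda>j. L' j z)"
    "\<And>a i. i < k' \<Longrightarrow> a i \<noteq> 0 \<Longrightarrow>
       CARD('p) ^ R * card C' \<le> card ((\<lambda>y. \<Sum>j<k'. smul (a j) (L' j y)) ` vecs n + C')"
  using assms
proof (induction k arbitrary: L C thesis)
  case 0
  show ?case by (rule 0(1)[of 0 C]) (use 0 in auto)
next
  case (Suc k)
  show ?case
  proof (cases "\<forall>a i. i < Suc k \<longrightarrow> a i \<noteq> 0 \<longrightarrow>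
       CARD('p) ^ R * card C \<le> card ((\<lambda>y. \<Sum>j<Suc k. smul (a j) (L j y)) ` vecs n + C)")
    case True
    show ?thesis
    proof (rule Suc.prems(1)[of "Suc k" C L])
      have "1 \<le> CARD('p) ^ (Suc k * R)" by simp
      then show "card C \<le> card C * CARD('p) ^ (Suc k * R)" by simp
      show "L i z \<in> C + lspan (Suc k) (\<lambda>j. L j z)" if "i < Suc k" for i z
        using set_plus_intro[OF add_subgroup_zero[OF Suc.prems(3)] lspan_member[OF that, of "\<lambda>j. L j z"]] by simp
      show "CARD('p) ^ R * card C \<le> card ((\<lambda>y. \<Sum>j<Suc k. smul (a j) (L j y)) ` vecs n + C)"
        if "i < Suc k" "a i \<noteq> 0" for a i using True that by blast
    qed (use Suc.prems in auto)
  next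
    case False
    then obtain a j where j: "j < Suc k" "a j \<noteq> 0"
      and "\<not> CARD('p) ^ R * card C \<le> card ((\<lambda>y. \<Sum>j<Suc k. smul (a j) (L j y)) ` vecs n + C)"
      by blast
    then have small: "card ((\<lambda>y. \<Sum>j<Suc k. smul (a j) (L j y)) ` vecs n + C) \<le> CARD('p) ^ R * card C"
      by linarith
    define M where "M y = (\<Sum>j<Suc k. smul (a j) (L j y))" for y
    have addM: "additive M" unfolding M_def[abs_def] by (rule additive_combination) (use Suc.prems(2) in auto)
    have Mv: "M ` vecs n \<subseteq> vecs n"
    proof (rule image_subsetI)
      fix y :: "nat \<Rightarrow> 'p mod_ring" assume y: "y \<in> vecs n"
      have "L i y \<in> vecs n" if "i < Suc k" for i using Suc.prems(2)[OF that] y by blast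
      then show "M y \<in> vecs n" unfolding M_def
        by (intro add_subgroup_sum[OF add_subgroup_vecs] smul_in_vecs) auto
    qed
    define C1 where "C1 = M ` vecs n + C"
    have MG: "add_subgroup (M ` vecs n)"
      unfolding add_subgroup_def
    proof (intro conjI ballI)
      show "0 \<in> M ` vecs n"
        by (rule image_eqI[of _ _ 0]) (auto simp: additive.zero[OF addM] add_subgroup_zero[OF add_subgroup_vecs])
      fix x y assume "x \<in> M ` vecs n" "y \<in> M ` vecs n"
      then obtain u v where "u \<in> vecs n" "v \<in> vecs n" "x = M u" "y = M v" by blast
      then show "x - y \<in> M ` vecs n"
        by (intro image_eqI[of _ _ "u - v"]) (auto simp: additive.diff[OF addM] intro: add_subgroup_diff[OF add_subgroup_vecs])
    qed
    have C1: "add_subgroup C1" "C1 \<subseteq> vecs n"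
      unfolding C1_def using MG Mv Suc.prems by (auto intro: add_subgroup_set_plus set_plus_subset_vecs[THEN subsetD])
    have CC1: "C \<subseteq> C1" unfolding C1_def by (rule set_zero_plus2[OF add_subgroup_zero[OF MG]])
    have MC1: "M z \<in> C1" if "z \<in> vecs n" for z
      unfolding C1_def using set_plus_intro[of "M z" "M ` vecs n" 0 C] that add_subgroup_zero[OF Suc.prems(3)] by auto
    \<comment> \<open>The last map moves into the place of the eliminated one, which keeps the
      indices below \<open>k\<close>.\<close>
    define L1 where "L1 = L(j := L k)"
    have L1: "additive (L1 i) \<and> L1 i ` vecs n \<subseteq> vecs n" if "i < k" for i
      using Suc.prems(2)[of i] Suc.prems(2)[of k] that by (cases "i = j") (auto simp: L1_def)
    obtain k' L' C' where *: "k' \<le> k" "add_subgroup C'" "C' \<subseteq> vecs n" "C1 \<subseteq> C'" "card C' \<le> card C1 * CARD('p) ^ (k * R)"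
      "\<And>i. i < k' \<Longrightarrow> additive (L' i) \<and> L' i ` vecs n \<subseteq> vecs n"
      "\<And>i z. i < k \<Longrightarrow> z \<in> vecs n \<Longrightarrow> L1 i z \<in> C' + lspan k' (\<lambda>j. L' j z)"
      "\<And>a i. i < k' \<Longrightarrow> a i \<noteq> 0 \<Longrightarrow>
         CARD('p) ^ R * card C' \<le> card ((\<lambda>y. \<Sum>j<k'. smul (a j) (L' j y)) ` vecs n + C')"
      by (rule Suc.IH[where L = L1 and C = C1], (rule that; assumption), rule L1, assumption, rule C1(1), rule C1(2))
    show ?thesis
    proof (rule Suc.prems(1)[of k' C' L'])
      show "k' \<le> Suc k" using * by simp
      show "CARD('p) ^ R * card C' \<le> card ((\<lambda>y. \<Sum>j<k'. smul (a j) (L' j y)) ` vecs n + C')"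
        if "i < k'" "a i \<noteq> 0" for a i using that by (rule *(8))
      show "C \<subseteq> C'" using CC1 * by blast
      have "card C' \<le> (CARD('p) ^ R * card C) * CARD('p) ^ (k * R)"
        using *(5) small unfolding C1_def M_def[abs_def] using mult_le_mono1 order_trans by blast
      then show "card C' \<le> card C * CARD('p) ^ (Suc k * R)" by (simp add: power_add mult_ac)
      fix i z assume i: "i < Suc k" and z: "z \<in> (vecs n :: (nat \<Rightarrow> 'p mod_ring) set)"
      define G where "G = C' + lspan k' (\<lambda>j. L' j z)"
      have G: "add_subgroup G" unfolding G_def using *(2) add_subgroup_lspan by (rule add_subgroup_set_plus)
      have CG: "C' \<subseteq> G" unfolding G_def
        using set_zero_plus2[OF add_subgroup_zero[OF add_subgroup_lspan], of C'] by (simp add: add.commute)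
      have other: "L i z \<in> G" if "i < Suc k" "i \<noteq> j" for i
      proof (cases "i = k")
        case True
        then have "j < k" using j that by simp
        then show ?thesis using *(7)[of j z] z True by (simp add: L1_def G_def)
      next
        case False
        then show ?thesis using *(7)[of i z] z that by (simp add: L1_def G_def)
      qed
      \<comment> \<open>As \<open>a j\<close> is invertible, \<open>L j z\<close> is recovered from
        the other maps and \<open>M z\<close>, and the latter belongs to the enlarged space of
        constants.\<close>
      have "M z = smul (a j) (L j z) + (\<Sum>i\<in>{..<Suc k} - {j}. smul (a i) (L i z))"
        unfolding M_def using j(1) by (intro sum.remove) auto
      then have "smul (a j) (L j z) = M z - (\<Sum>i\<in>{..<Suc k} - {j}. smul (a i) (L i z))" by simp
      also have "\<dots> \<in> G"
      proof (rule add_subgroup_diff[OF G])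
        show "M z \<in> G" using MC1[OF z] *(4) CG by blast
        show "(\<Sum>i\<in>{..<Suc k} - {j}. smul (a i) (L i z)) \<in> G"
          by (intro add_subgroup_sum[OF G] add_subgroup_smul[OF G] other) auto
      qed
      finally have "smul (1 / a j) (smul (a j) (L j z)) \<in> G" by (rule add_subgroup_smul[OF G])
      moreover have "smul (1 / a j) (smul (a j) (L j z)) = L j z" using j(2) by (simp add: fun_eq_iff)
      ultimately have "L j z \<in> G" by simp
      then show "L i z \<in> C' + lspan k' (\<lambda>j. L' j z)" using other[OF i] by (cases "i = j") (auto simp: G_def)
    qed (use * in auto)
  qed
qed

subsection \<open>Removing the graphs of affine maps\<close>

definition affine_maps :: "nat \<Rightarrow> (((nat \<Rightarrow> 'p::prime_card mod_ring) \<Rightarrow> nat \<Rightarrow> 'p mod_ring) \<times> (nat \<Rightarrow> 'p mod_ring)) set" where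
  "affine_maps n = {(L, c). additive L \<and> L ` vecs n \<subseteq> vecs n \<and> c \<in> vecs n}"

text \<open>Every graph taken into \<open>F\<close> removes at least \<open>N\<close> points not
  removed before, which bounds the number of steps and ends the recursion.\<close>

lemma remove_affine_graphs:
  fixes \<Gamma> :: "((nat \<Rightarrow> 'p::prime_card mod_ring) \<times> (nat \<Rightarrow> 'p mod_ring)) set"
  assumes "finite \<Gamma>" "0 < N"
  shows "\<exists>F. finite F \<and> F \<subseteq> affine_maps n \<and> card F * N \<le> card \<Gamma> \<and>
    (\<forall>(L, c)\<in>affine_maps n. card {(y, u) \<in> \<Gamma>. (\<forall>(L', c')\<in>F. u \<noteq> L' y + c') \<and> u = L y + c} < N)"
  using assms
proof (induction "card \<Gamma>" arbitrary: \<Gamma> rule: less_induct)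
  case less
  show ?case
  proof (cases "\<exists>L c. (L, c) \<in> affine_maps n \<and> N \<le> card {(y, u) \<in> \<Gamma>. u = L y + c}")
    case False
    show ?thesis by (rule exI[of _ "{}"]) (use False in \<open>auto simp: not_le\<close>)
  next
    case True
    then obtain L c where L: "(L, c) \<in> affine_maps n" "N \<le> card {(y, u) \<in> \<Gamma>. u = L y + c}" by blast
    define H where "H = {(y, u) \<in> \<Gamma>. u = L y + c}"
    have H: "H \<subseteq> \<Gamma>" by (auto simp: H_def)
    have fH: "finite H" "card H \<le> card \<Gamma>"
      using less.prems(1) H by (auto intro: finite_subset card_mono)
    have c: "card (\<Gamma> - H) = card \<Gamma> - card H" using H fH by (simp add: card_Diff_subset)
    then have "card (\<Gamma> - H) < card \<Gamma>" using L(2) less.prems(2) fH by (simp add: H_def)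
    then have "\<exists>F. finite F \<and> F \<subseteq> affine_maps n \<and> card F * N \<le> card (\<Gamma> - H) \<and>
      (\<forall>(L, c)\<in>affine_maps n. card {(y, u) \<in> \<Gamma> - H. (\<forall>(L', c')\<in>F. u \<noteq> L' y + c') \<and> u = L y + c} < N)"
      using less.prems by (intro less.hyps) auto
    then obtain F where F: "finite F" "F \<subseteq> affine_maps n" "card F * N \<le> card (\<Gamma> - H)"
      "\<And>L c. (L, c) \<in> affine_maps n \<Longrightarrow>
         card {(y, u) \<in> \<Gamma> - H. (\<forall>(L', c')\<in>F. u \<noteq> L' y + c') \<and> u = L y + c} < N"
      by blast
    show ?thesis
    proof (intro exI[of _ "insert (L, c) F"] conjI)
      have "card (insert (L, c) F) * N \<le> (card F + 1) * N" by (intro mult_le_mono1) (simp add: card_insert_if F(1))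
      also have "\<dots> \<le> card \<Gamma>" using F(3) c L(2) fH(2) by (simp add: H_def)
      finally show "card (insert (L, c) F) * N \<le> card \<Gamma>" .
      have eq: "{(y, u) \<in> \<Gamma>. (\<forall>(L', c')\<in>insert (L, c) F. u \<noteq> L' y + c') \<and> u = L1 y + c1} =
          {(y, u) \<in> \<Gamma> - H. (\<forall>(L', c')\<in>F. u \<noteq> L' y + c') \<and> u = L1 y + c1}" for L1 c1
        by (auto simp: H_def)
      show "\<forall>(L1, c1)\<in>affine_maps n.
          card {(y, u) \<in> \<Gamma>. (\<forall>(L', c')\<in>insert (L, c) F. u \<noteq> L' y + c') \<and> u = L1 y + c1} < N"
        unfolding eq using F(4) by blast
    qed (use L F in auto)
  qed
qed

subsection \<open>Mixed energies\<close>

definition mixed_energy :: "'a::ab_group_add set \<Rightarrow> 'a set \<Rightarrow> 'a set \<Rightarrow> 'a set \<Rightarrow> nat" where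
  "mixed_energy A B C D = card {(a, b, c, d). a \<in> A \<and> b \<in> B \<and> c \<in> C \<and> d \<in> D \<and> a - b = c - d}"

lemma sum_mult_squared_le:
  fixes f g :: "'a \<Rightarrow> nat"
  assumes "finite A"
  shows "(\<Sum>x\<in>A. f x * g x) ^ 2 \<le> (\<Sum>x\<in>A. f x ^ 2) * (\<Sum>x\<in>A. g x ^ 2)"
proof -
  define F G where "F x = real (f x)" and "G x = real (g x)" for x
  have "0 \<le> (\<Sum>x\<in>A. \<Sum>y\<in>A. (F x * G y - F y * G x) ^ 2)" by (intro sum_nonneg) auto
  also have "\<dots> = (\<Sum>x\<in>A. \<Sum>y\<in>A. F x ^ 2 * G y ^ 2 + F y ^ 2 * G x ^ 2 - 2 * ((F x * G x) * (F y * G y)))"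
    by (intro sum.cong refl) (simp add: power2_eq_square algebra_simps)
  also have "\<dots> = 2 * ((\<Sum>x\<in>A. F x ^ 2) * (\<Sum>x\<in>A. G x ^ 2)) - 2 * (\<Sum>x\<in>A. F x * G x) ^ 2"
  proof -
    have "(\<Sum>x\<in>A. \<Sum>y\<in>A. F x ^ 2 * G y ^ 2) = (\<Sum>x\<in>A. F x ^ 2) * (\<Sum>x\<in>A. G x ^ 2)"
      by (simp only: sum_product)
    moreover have "(\<Sum>x\<in>A. \<Sum>y\<in>A. F y ^ 2 * G x ^ 2) = (\<Sum>x\<in>A. \<Sum>y\<in>A. F x ^ 2 * G y ^ 2)"
      by (rule sum.swap)
    moreover have "(\<Sum>x\<in>A. \<Sum>y\<in>A. 2 * ((F x * G x) * (F y * G y))) = 2 * (\<Sum>x\<in>A. F x * G x) ^ 2"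
    proof -
      have "(\<Sum>x\<in>A. F x * G x) ^ 2 = (\<Sum>x\<in>A. \<Sum>y\<in>A. (F x * G x) * (F y * G y))"
        by (simp only: power2_eq_square sum_product)
      then show ?thesis by (simp only: sum_distrib_left)
    qed
    ultimately show ?thesis by (simp only: sum.distrib sum_subtractf)
  qed
  finally have "(\<Sum>x\<in>A. F x * G x) ^ 2 \<le> (\<Sum>x\<in>A. F x ^ 2) * (\<Sum>x\<in>A. G x ^ 2)" by simp
  then have "real ((\<Sum>x\<in>A. f x * g x) ^ 2) \<le> real ((\<Sum>x\<in>A. f x ^ 2) * (\<Sum>x\<in>A. g x ^ 2))"
    by (simp add: F_def G_def)
  then show ?thesis unfolding of_nat_le_iff .
qed

lemma mixed_energy_squared_le:
  fixes A B C D :: "'a::ab_group_add set"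
  assumes fin: "finite A" "finite B" "finite C" "finite D"
  shows "mixed_energy A B C D ^ 2 \<le> mixed_energy A B A B * mixed_energy C D C D"
proof -
  define r where "r X Y x = card {(a, b) \<in> X \<times> Y. a - b = x}" for X Y :: "'a set" and x
  define S where "S = (\<lambda>(a, b). a - b) ` (A \<times> B) \<union> (\<lambda>(a, b). a - b) ` (C \<times> D)"
  have fS: "finite S" using fin by (auto simp: S_def)
  have me: "mixed_energy X Y Z W = (\<Sum>x\<in>S. r X Y x * r Z W x)"
    if "finite X" "finite Y" "finite Z" "finite W" "(\<lambda>(a, b). a - b) ` (X \<times> Y) \<subseteq> S" for X Y Z W
  proof -
    have f: "finite {(a, b) \<in> X \<times> Y. a - b = x}" if "finite X" "finite Y" for X Y :: "'a set" and x
      by (rule finite_subset[of _ "X \<times> Y"]) (use that in auto)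
    have "mixed_energy X Y Z W = card (SIGMA x:S. {(a, b) \<in> X \<times> Y. a - b = x} \<times> {(a, b) \<in> Z \<times> W. a - b = x})"
      unfolding mixed_energy_def
      by (rule bij_betw_same_card[of "\<lambda>(a, b, c, d). (a - b, (a, b), (c, d))"],
          rule bij_betw_byWitness[where f' = "\<lambda>(x, (a, b), (c, d)). (a, b, c, d)"])
        (use that(5) in auto)
    also have "\<dots> = (\<Sum>x\<in>S. r X Y x * r Z W x)"
      using fS f that by (simp add: r_def card_cartesian_product)
    finally show ?thesis .
  qed
  have "mixed_energy A B C D = (\<Sum>x\<in>S. r A B x * r C D x)" using fin by (intro me) (auto simp: S_def)
  moreover have "mixed_energy A B A B = (\<Sum>x\<in>S. r A B x ^ 2)"
    using fin by (simp add: me S_def power2_eq_square)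
  moreover have "mixed_energy C D C D = (\<Sum>x\<in>S. r C D x ^ 2)"
    using fin by (simp add: me S_def power2_eq_square)
  ultimately show ?thesis using sum_mult_squared_le[OF fS] by simp
qed

lemma mixed_energy_swap: "mixed_energy A B A B = mixed_energy A A B B"
proof -
  have "a - b = c - d \<longleftrightarrow> a - c = b - d" for a b c d :: 'a
  proof -
    have "(a - b) - (c - d) = (a - c) - (b - d)" by simp
    then show ?thesis by (metis right_minus_eq)
  qed
  then show ?thesis
    unfolding mixed_energy_def
    by (intro bij_betw_same_card[of "\<lambda>(a, b, c, d). (a, c, b, d)"]
        bij_betw_byWitness[where f' = "\<lambda>(a, b, c, d). (a, c, b, d)"]) auto
qed

lemma mixed_energy_eq_energy: "mixed_energy A A A A = energy A"
  by (simp add: mixed_energy_def energy_def)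

text \<open>Cauchy-Schwarz twice, with an exchange of variables in between. Many quadruples having a
  single prescribed corner in \<open>A\<close> thus force \<open>A\<close> itself to have large
  energy.\<close>

lemma mixed_energy_power4_le:
  assumes "finite A" "finite B"
  shows "mixed_energy A B B B ^ 4 \<le> energy A * energy B ^ 3"
proof -
  have "mixed_energy A B B B ^ 2 \<le> mixed_energy A B A B * energy B"
    using mixed_energy_squared_le[of A B B B] assms by (simp add: mixed_energy_eq_energy)
  then have "(mixed_energy A B B B ^ 2) ^ 2 \<le> (mixed_energy A B A B * energy B) ^ 2"
    by (rule power_mono) simp
  also have "\<dots> = mixed_energy A A B B ^ 2 * energy B ^ 2" by (simp add: power_mult_distrib mixed_energy_swap)
  also have "\<dots> \<le> (energy A * energy B) * energy B ^ 2"
    using mixed_energy_squared_le[of A A B B] assms by (intro mult_le_mono1) (simp add: mixed_energy_eq_energy)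
  finally have "(mixed_energy A B B B ^ 2) ^ 2 \<le> energy A * energy B * energy B ^ 2" .
  moreover have "(mixed_energy A B B B ^ 2) ^ 2 = mixed_energy A B B B ^ 4" by (simp flip: power_mult)
  moreover have "energy A * energy B * energy B ^ 2 = energy A * energy B ^ 3"
    by (simp add: power3_eq_cube power2_eq_square)
  ultimately show ?thesis by simp
qed

subsection \<open>Annihilators along a dense set of rows\<close>

text \<open>Cauchy-Schwarz for the numbers of representations of differences, which take at most
  \<open>card (vecs n)\<close> values.\<close>

lemma card_power4_le_energy:
  fixes S :: "(nat \<Rightarrow> 'a::{finite, ab_group_add}) set"
  assumes S: "S \<subseteq> vecs n"
  shows "card S ^ 4 \<le> card (vecs n :: (nat \<Rightarrow> 'a) set) * energy S"
proof -
  have fS: "finite S" using S by (rule finite_subset) simp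
  define r where "r x = {(a, b) \<in> S \<times> S. a - b = x}" for x
  have fr: "finite (r x)" for x unfolding r_def by (rule finite_subset[of _ "S \<times> S"]) (use fS in auto)
  have dv: "a - b \<in> vecs n" if "a \<in> S" "b \<in> S" for a b
    using that S add_subgroup_diff[OF add_subgroup_vecs] by blast
  have "card S ^ 2 = card (S \<times> S)" by (simp add: card_cartesian_product power2_eq_square)
  also have "\<dots> = card (SIGMA x:vecs n. r x)"
    by (rule bij_betw_same_card[of "\<lambda>(a, b). (a - b, (a, b))"], rule bij_betw_byWitness[where f' = snd])
      (use dv in \<open>auto simp: r_def\<close>)
  also have "\<dots> = (\<Sum>x\<in>vecs n. card (r x))" using fr by simp
  finally have 1: "card S ^ 2 = (\<Sum>x\<in>vecs n. card (r x) * 1)" by simp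
  have "energy S = card (SIGMA x:vecs n. r x \<times> r x)"
    unfolding energy_def
    by (rule bij_betw_same_card[of "\<lambda>(a, b, c, d). (a - b, (a, b), (c, d))"],
        rule bij_betw_byWitness[where f' = "\<lambda>(x, (a, b), (c, d)). (a, b, c, d)"])
      (use dv in \<open>auto simp: r_def\<close>)
  also have "\<dots> = (\<Sum>x\<in>vecs n. card (r x) ^ 2)"
    using fr by (simp add: card_cartesian_product power2_eq_square)
  finally have 2: "energy S = (\<Sum>x\<in>vecs n. card (r x) ^ 2)" .
  have "(card S ^ 2) ^ 2 \<le> energy S * (\<Sum>x\<in>(vecs n :: (nat \<Rightarrow> 'a) set). 1 ^ 2)"
    unfolding 1 2 by (rule sum_mult_squared_le) simp
  then show ?thesis by (simp add: power_mult[symmetric] mult.commute)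
qed

lemma ex_popular_value:
  assumes "finite A" "finite B" "f ` A \<subseteq> B" "A \<noteq> {}"
  obtains b where "b \<in> B" "card A \<le> card B * card {a \<in> A. f a = b}"
proof -
  have "\<exists>b\<in>B. card A \<le> card B * card {a \<in> A. f a = b}"
  proof (rule ccontr)
    assume no: "\<not> ?thesis"
    have Bne: "B \<noteq> {}" using assms by auto
    have "card A * card B = (\<Sum>b\<in>B. card {a \<in> A. f a = b}) * card B"
      using sum.group[OF assms(1,2,3), of "\<lambda>_. 1 :: nat"] by simp
    also have "\<dots> = (\<Sum>b\<in>B. card B * card {a \<in> A. f a = b})"
      by (simp add: sum_distrib_left mult.commute)
    also have "\<dots> < (\<Sum>b\<in>B. card A)" using no assms Bne by (intro sum_strict_mono) (auto simp: not_le)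
    finally show False by (simp add: mult.commute)
  qed
  then show ?thesis using that by blast
qed

text \<open>If the part left by the greedy removal still occurred in many mixed quadruples,
  \<open>mixed_energy_power4_le\<close> would give it energy at least
  \<open>p ^ (3 * n - 41 * d)\<close>, where \<open>41 = 4 * 8 + 9\<close>: the fourth power of the
  loss \<open>p ^ (8 * d)\<close> and the ninth power of \<open>p ^ d\<close> from
  \<open>energy \<Gamma> ^ 3\<close>. Then \<open>energy_imp_affine\<close> would find one more
  graph to remove.\<close>

lemma ex_affine_cover:
  "\<exists>C::nat. \<forall>n d. \<forall>\<Gamma> :: ((nat \<Rightarrow> 'p::prime_card mod_ring) \<times> (nat \<Rightarrow> 'p mod_ring)) set.
    0 < d \<longrightarrow> \<Gamma> \<subseteq> vecs n \<times> vecs n \<longrightarrow> (\<forall>y. card {u. (y, u) \<in> \<Gamma>} \<le> CARD('p) ^ d) \<longrightarrow>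
    card \<Gamma> \<le> CARD('p) ^ (n + d) \<longrightarrow>
    (\<exists>F. finite F \<and> F \<subseteq> affine_maps n \<and> card F \<le> CARD('p) ^ (C * d ^ 4) \<and>
      mixed_energy {(y, u) \<in> \<Gamma>. \<forall>(L, c)\<in>F. u \<noteq> L y + c} \<Gamma> \<Gamma> \<Gamma> * CARD('p) ^ (8 * d) \<le> CARD('p) ^ (3 * n))"
proof -
  define p where "p = CARD('p)"
  have p: "2 \<le> p" using prime_card[where 'a = 'p] prime_ge_2_nat by (simp add: p_def)
  obtain C1 :: nat where C1: "\<And>n k (\<Gamma> :: ((nat \<Rightarrow> 'p mod_ring) \<times> (nat \<Rightarrow> 'p mod_ring)) set).
    0 < k \<Longrightarrow> \<Gamma> \<subseteq> vecs n \<times> vecs n \<Longrightarrow> \<forall>y. card {u. (y, u) \<in> \<Gamma>} \<le> p ^ k \<Longrightarrow>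
    p ^ (3 * n) \<le> energy \<Gamma> * p ^ k \<Longrightarrow>
    (\<exists>L c. additive L \<and> L ` vecs n \<subseteq> vecs n \<and> c \<in> vecs n \<and>
      p ^ n \<le> p ^ (C1 * k ^ 4) * card {(y, u) \<in> \<Gamma>. u = L y + c})"
    using energy_imp_affine[where 'p = 'p] unfolding p_def by blast
  define C where "C = 1 + C1 * 41 ^ 4"
  show ?thesis unfolding p_def[symmetric]
  proof (intro exI[of _ C] allI impI)
    fix n d and \<Gamma> :: "((nat \<Rightarrow> 'p mod_ring) \<times> (nat \<Rightarrow> 'p mod_ring)) set"
    assume d: "0 < d" and \<Gamma>: "\<Gamma> \<subseteq> vecs n \<times> vecs n" and fib: "\<forall>y. card {u. (y, u) \<in> \<Gamma>} \<le> p ^ d"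
      and c\<Gamma>: "card \<Gamma> \<le> p ^ (n + d)"
    have f\<Gamma>: "finite \<Gamma>" by (rule finite_subset[OF \<Gamma>]) simp
    define e where "e = C1 * (41 * d) ^ 4"
    \<comment> \<open>For \<open>e > n\<close> the truncated exponent makes \<open>N = 1\<close>, so
      that the removal leaves no point on any affine graph; both cases below end in a
      contradiction.\<close>
    define N where "N = p ^ (n - e)"
    have N: "0 < N" using p by (simp add: N_def)
    obtain F where F: "finite F" "F \<subseteq> affine_maps n" "card F * N \<le> card \<Gamma>"
      and Fmax: "\<And>L c. (L, c) \<in> affine_maps n \<Longrightarrow>
         card {(y, u) \<in> \<Gamma>. (\<forall>(L', c')\<in>F. u \<noteq> L' y + c') \<and> u = L y + c} < N"
      using remove_affine_graphs[OF f\<Gamma> N, of n] by blast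
    define \<Gamma>' where "\<Gamma>' = {(y, u) \<in> \<Gamma>. \<forall>(L, c)\<in>F. u \<noteq> L y + c}"
    have sub: "\<Gamma>' \<subseteq> \<Gamma>" by (auto simp: \<Gamma>'_def)
    have f\<Gamma>': "finite \<Gamma>'" using sub f\<Gamma> by (rule finite_subset)
    have "card F \<le> p ^ (d + e)"
    proof (cases "e \<le> n")
      case True
      then have "card F * p ^ (n - e) \<le> p ^ (d + e) * p ^ (n - e)"
        using F(3) c\<Gamma> by (simp add: N_def power_add[symmetric] add.commute)
      then show ?thesis using p by simp
    next
      case False
      then have "card F \<le> p ^ (n + d)" using F(3) c\<Gamma> by (simp add: N_def)
      also have "\<dots> \<le> p ^ (d + e)" using False p by (intro power_increasing) auto
      finally show ?thesis .
    qed
    also have "\<dots> \<le> p ^ (C * d ^ 4)"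
    proof (rule power_increasing)
      have "d * 1 \<le> d * d ^ 3" using d by (intro mult_le_mono2) simp
      also have "d * d ^ 3 = d ^ 4" by (simp add: eval_nat_numeral)
      finally show "d + e \<le> C * d ^ 4" by (simp add: C_def e_def power_mult_distrib algebra_simps)
    qed (use p in simp)
    finally have cF: "card F \<le> p ^ (C * d ^ 4)" .
    define q where "q = mixed_energy \<Gamma>' \<Gamma> \<Gamma> \<Gamma>"
    have "q * p ^ (8 * d) \<le> p ^ (3 * n)"
    proof (rule ccontr)
      assume "\<not> ?thesis"
      then have big: "p ^ (3 * n) \<le> q * p ^ (8 * d)" by simp
      have "p ^ (12 * n) = (p ^ (3 * n)) ^ 4" by (simp add: power_mult[symmetric])
      also have "\<dots> \<le> (q * p ^ (8 * d)) ^ 4" using big by (rule power_mono) simp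
      also have "\<dots> = q ^ 4 * p ^ (32 * d)" by (simp add: power_mult_distrib power_mult[symmetric])
      also have "\<dots> \<le> (energy \<Gamma>' * energy \<Gamma> ^ 3) * p ^ (32 * d)"
        unfolding q_def by (intro mult_le_mono1 mixed_energy_power4_le f\<Gamma> f\<Gamma>')
      also have "\<dots> \<le> (energy \<Gamma>' * ((p ^ (n + d)) ^ 3) ^ 3) * p ^ (32 * d)"
      proof -
        have "card \<Gamma> ^ 3 \<le> (p ^ (n + d)) ^ 3" using c\<Gamma> by (rule power_mono) simp
        then have "energy \<Gamma> \<le> (p ^ (n + d)) ^ 3" using energy_le_cube[OF f\<Gamma>] by linarith
        then show ?thesis by (intro mult_le_mono1 mult_le_mono2 power_mono) auto
      qed
      also have "\<dots> = (energy \<Gamma>' * p ^ (41 * d)) * p ^ (9 * n)"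
        by (simp add: power_mult[symmetric] power_add[symmetric] algebra_simps)
      finally have "p ^ (3 * n) * p ^ (9 * n) \<le> (energy \<Gamma>' * p ^ (41 * d)) * p ^ (9 * n)"
        by (simp add: power_add[symmetric])
      then have en: "p ^ (3 * n) \<le> energy \<Gamma>' * p ^ (41 * d)" using p by simp
      have "card {u. (y, u) \<in> \<Gamma>'} \<le> p ^ (41 * d)" for y
      proof -
        have "finite {u. (y, u) \<in> \<Gamma>}" by (rule finite_subset[of _ "vecs n"]) (use \<Gamma> in auto)
        then have "card {u. (y, u) \<in> \<Gamma>'} \<le> card {u. (y, u) \<in> \<Gamma>}"
          by (rule card_mono) (use sub in auto)
        also have "\<dots> \<le> p ^ d" using fib by blast
        also have "\<dots> \<le> p ^ (41 * d)" using p by (intro power_increasing) auto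
        finally show ?thesis .
      qed
      then have "\<exists>L c. additive L \<and> L ` vecs n \<subseteq> vecs n \<and> c \<in> vecs n \<and>
          p ^ n \<le> p ^ e * card {(y, u) \<in> \<Gamma>'. u = L y + c}"
        unfolding e_def using d en sub \<Gamma> by (intro C1) auto
      then obtain L c where L: "additive L" "L ` vecs n \<subseteq> vecs n" "c \<in> vecs n"
        "p ^ n \<le> p ^ e * card {(y, u) \<in> \<Gamma>'. u = L y + c}" by blast
      have "{(y, u) \<in> \<Gamma>'. u = L y + c} = {(y, u) \<in> \<Gamma>. (\<forall>(L', c')\<in>F. u \<noteq> L' y + c') \<and> u = L y + c}"
        by (auto simp: \<Gamma>'_def)
      then have less: "card {(y, u) \<in> \<Gamma>'. u = L y + c} < N"
        using Fmax[of L c] L by (simp add: affine_maps_def)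
      show False
      proof (cases "e \<le> n")
        case True
        have "p ^ e * card {(y, u) \<in> \<Gamma>'. u = L y + c} < p ^ e * N" using less p by simp
        also have "\<dots> = p ^ n" using True by (simp add: N_def power_add[symmetric])
        finally show False using L(4) by simp
      next
        case False
        then have "card {(y, u) \<in> \<Gamma>'. u = L y + c} = 0" using less by (simp add: N_def)
        then have "p ^ n \<le> 0" using L(4) by simp
        then show False using p by simp
      qed
    qed
    then show "\<exists>F. finite F \<and> F \<subseteq> affine_maps n \<and> card F \<le> p ^ (C * d ^ 4) \<and>
        mixed_energy {(y, u) \<in> \<Gamma>. \<forall>(L, c)\<in>F. u \<noteq> L y + c} \<Gamma> \<Gamma> \<Gamma> * p ^ (8 * d) \<le> p ^ (3 * n)"
      using F cF unfolding q_def \<Gamma>'_def by blast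
  qed
qed

lemma lspan_cong: "(\<And>i. i < k \<Longrightarrow> b i = b' i) \<Longrightarrow> lspan k b = lspan k b'"
  by (simp add: lspan_def)

text \<open>Fix the four maps, the common difference \<open>z\<close> and \<open>y4\<close>. The
  equation then constrains \<open>y2\<close> alone, through the difference of the first two linear
  parts, and its large rank leaves few solutions. Outside \<open>B\<close> only pairs of maps with a
  difference of small rank occur, and such a difference takes few values.\<close>

lemma card_high_rank_quadruples:
  fixes F :: "(((nat \<Rightarrow> 'p::prime_card mod_ring) \<Rightarrow> nat \<Rightarrow> 'p mod_ring) \<times> (nat \<Rightarrow> 'p mod_ring)) set"
    and R :: nat
  assumes F: "finite F" "F \<subseteq> affine_maps n"
  defines "B \<equiv> {(y1, y2, y3, y4). y1 \<in> vecs n \<and> y2 \<in> vecs n \<and> y3 \<in> vecs n \<and> y4 \<in> vecs n \<and> y1 - y2 = y3 - y4 \<and>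
      (\<exists>T1\<in>F. \<exists>T2\<in>F. \<exists>T3\<in>F. \<exists>T4\<in>F.
         CARD('p) ^ R \<le> card ((\<lambda>y. fst T1 y - fst T2 y) ` vecs n) \<and>
         (fst T1 y1 + snd T1) - (fst T2 y2 + snd T2) = (fst T3 y3 + snd T3) - (fst T4 y4 + snd T4))}"
  shows "card B * CARD('p) ^ R \<le> card F ^ 4 * CARD('p) ^ (3 * n)"
proof -
  define X where "X = (vecs n :: (nat \<Rightarrow> 'p mod_ring) set)"
  have X: "finite X" "card X = CARD('p) ^ n" by (simp_all add: X_def card_vecs)
  define J where "J = {q \<in> F \<times> F \<times> F \<times> F. CARD('p) ^ R \<le> card ((\<lambda>y. fst (fst q) y - fst (fst (snd q)) y) ` X)}"
  have J: "J \<subseteq> F \<times> F \<times> F \<times> F" by (auto simp: J_def)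
  have fJ: "finite J" by (rule finite_subset[OF J]) (use F in auto)
  have "card J \<le> card (F \<times> F \<times> F \<times> F)" by (rule card_mono[OF _ J]) (use F in auto)
  then have cJ: "card J \<le> card F ^ 4" by (simp add: card_cartesian_product power4_eq_xxxx)
  define H where "H = (\<lambda>((T1, T2, T3, T4), z, y4).
    {y2 \<in> X. (fst T1 y2 - fst T2 y2) + (fst T1 z + snd T1 - snd T2 - (fst T3 (z + y4) + snd T3) + (fst T4 y4 + snd T4)) \<in> {0 :: nat \<Rightarrow> 'p mod_ring}})"
  have cH: "card (H j) * CARD('p) ^ R \<le> CARD('p) ^ n" if "j \<in> J \<times> X \<times> X" for j
  proof -
    obtain T1 T2 T3 T4 z y4 where j: "j = ((T1, T2, T3, T4), z, y4)" by (metis surj_pair)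
    then have T: "T1 \<in> F" "T2 \<in> F" and rk: "CARD('p) ^ R \<le> card ((\<lambda>y. fst T1 y - fst T2 y) ` X)"
      using that by (auto simp: J_def)
    have a: "additive (fst T1)" "additive (fst T2)" using T F by (auto simp: affine_maps_def)
    have "additive (\<lambda>y. fst T1 y - fst T2 y)"
      by unfold_locales (simp add: additive.add[OF a(1)] additive.add[OF a(2)])
    moreover have "(\<lambda>y. fst T1 y - fst T2 y) ` vecs n + {0} = (\<lambda>y. fst T1 y - fst T2 y) ` vecs n"
      using add_0_right[of "(\<lambda>y. fst T1 y - fst T2 y) ` vecs n"] by (simp only: set_zero)
    ultimately show ?thesis unfolding j H_def X_def split
      by (intro card_preimage_coset) (use rk in \<open>auto simp: X_def add_subgroup_def\<close>)
  qed
  have fH: "finite (H j)" for j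
    by (rule finite_subset[OF _ X(1)]) (auto simp: H_def split: prod.splits)
  have fS: "finite (SIGMA j:J \<times> X \<times> X. H j)" using fJ X fH by (intro finite_SigmaI) auto
  have "B \<subseteq> (\<lambda>((_, z, y4), y2). (z + y2, y2, z + y4, y4)) ` (SIGMA j:J \<times> X \<times> X. H j)"
  proof
    fix q assume "q \<in> B"
    then obtain y1 y2 y3 y4 T1 T2 T3 T4 where q: "q = (y1, y2, y3, y4)"
      and y: "y1 \<in> X" "y2 \<in> X" "y3 \<in> X" "y4 \<in> X" "y1 - y2 = y3 - y4"
      and T: "T1 \<in> F" "T2 \<in> F" "T3 \<in> F" "T4 \<in> F" "CARD('p) ^ R \<le> card ((\<lambda>y. fst T1 y - fst T2 y) ` X)"
      and eq: "(fst T1 y1 + snd T1) - (fst T2 y2 + snd T2) = (fst T3 y3 + snd T3) - (fst T4 y4 + snd T4)"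
      unfolding B_def X_def by blast
    define z where "z = y1 - y2"
    have z3: "z = y3 - y4" using y(5) by (simp only: z_def)
    have z: "y1 = z + y2" "y3 = z + y4" by (simp add: z_def, simp add: z3)
    have zX: "z \<in> X" unfolding z_def X_def by (rule add_subgroup_diff[OF add_subgroup_vecs]) (use y in \<open>auto simp: X_def\<close>)
    have a: "additive (fst T1)" using T F by (auto simp: affine_maps_def)
    have "(fst T1 y2 - fst T2 y2) + (fst T1 z + snd T1 - snd T2 - (fst T3 (z + y4) + snd T3) + (fst T4 y4 + snd T4))
        = ((fst T1 y1 + snd T1) - (fst T2 y2 + snd T2)) - ((fst T3 y3 + snd T3) - (fst T4 y4 + snd T4))"
      unfolding z by (simp add: additive.add[OF a])
    also have "\<dots> = 0" using eq by simp
    finally have "y2 \<in> H ((T1, T2, T3, T4), z, y4)" using y by (simp add: H_def)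
    moreover have "(T1, T2, T3, T4) \<in> J" using T by (simp add: J_def)
    ultimately show "q \<in> (\<lambda>((_, z, y4), y2). (z + y2, y2, z + y4, y4)) ` (SIGMA j:J \<times> X \<times> X. H j)"
      using zX y by (intro image_eqI[of _ _ "(((T1, T2, T3, T4), z, y4), y2)"]) (auto simp: q z)
  qed
  then have "card B \<le> card (SIGMA j:J \<times> X \<times> X. H j)"
    using fS by (meson card_image_le card_mono finite_imageI order_trans)
  also have "\<dots> = (\<Sum>j\<in>J \<times> X \<times> X. card (H j))" using fJ X fH by (intro card_SigmaI) auto
  finally have "card B * CARD('p) ^ R \<le> (\<Sum>j\<in>J \<times> X \<times> X. card (H j)) * CARD('p) ^ R" by (rule mult_le_mono1)
  also have "\<dots> = (\<Sum>j\<in>J \<times> X \<times> X. card (H j) * CARD('p) ^ R)" by (simp add: sum_distrib_right)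
  also have "\<dots> \<le> (\<Sum>j\<in>J \<times> X \<times> X. CARD('p) ^ n)" by (rule sum_mono) (rule cH)
  also have "\<dots> = card J * CARD('p) ^ (3 * n)"
  proof -
    have "3 * n = n + n + n" by simp
    then show ?thesis by (simp only: power_add card_cartesian_product X sum_constant of_nat_id mult.assoc)
  qed
  also have "\<dots> \<le> card F ^ 4 * CARD('p) ^ (3 * n)" using cJ by (rule mult_le_mono1)
  finally show ?thesis .
qed

text \<open>
  The pairs \<open>(y, u)\<close> with \<open>u\<close> in the annihilator of \<open>V y\<close> form a graph with small fibres. Once the graphs
  of a few affine maps are removed, the remaining part has small energy, so it rarely takes part in
  an additive quadruple.
\<close>

theorem dense_affine_rows:
  "\<exists>C::nat. \<forall>n d S. \<forall>V :: (nat \<Rightarrow> 'p::prime_card mod_ring) \<Rightarrow> (nat \<Rightarrow> 'p mod_ring) set.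
    0 < d \<longrightarrow> S \<subseteq> vecs n \<longrightarrow> CARD('p) ^ n \<le> card S * CARD('p) ^ d \<longrightarrow>
    (\<forall>y\<in>S. add_subgroup (V y) \<and> V y \<subseteq> vecs n \<and> CARD('p) ^ n \<le> card (V y) * CARD('p) ^ d) \<longrightarrow>
    (\<exists>S' T. S' \<subseteq> vecs n \<and> CARD('p) ^ n \<le> card S' * CARD('p) ^ (C * d ^ 5) \<and>
      (\<forall>i<2 * d. T i \<in> affine_maps n) \<and>
      (\<forall>z\<in>S'. \<exists>y1\<in>S. \<exists>y2\<in>S. \<exists>y3\<in>S. \<exists>y4\<in>S. z = y1 - y2 \<and> z = y3 - y4 \<and>
        perp n (V y1 \<inter> V y2) \<inter> perp n (V y3 \<inter> V y4) \<subseteq> lspan (2 * d) (\<lambda>i. fst (T i) z + snd (T i))))"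
proof -
  define p where "p = CARD('p)"
  have p: "2 \<le> p" using prime_card[where 'a = 'p] prime_ge_2_nat by (simp add: p_def)
  obtain C2 :: nat where C2: "\<And>n d (\<Gamma> :: ((nat \<Rightarrow> 'p mod_ring) \<times> (nat \<Rightarrow> 'p mod_ring)) set).
    0 < d \<Longrightarrow> \<Gamma> \<subseteq> vecs n \<times> vecs n \<Longrightarrow> \<forall>y. card {u. (y, u) \<in> \<Gamma>} \<le> p ^ d \<Longrightarrow> card \<Gamma> \<le> p ^ (n + d) \<Longrightarrow>
    (\<exists>F. finite F \<and> F \<subseteq> affine_maps n \<and> card F \<le> p ^ (C2 * d ^ 4) \<and>
      mixed_energy {(y, u) \<in> \<Gamma>. \<forall>(L, c)\<in>F. u \<noteq> L y + c} \<Gamma> \<Gamma> \<Gamma> * p ^ (8 * d) \<le> p ^ (3 * n))"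
    using ex_affine_cover[where 'p = 'p] unfolding p_def by blast
  define C where "C = 21 + 12 * C2"
  show ?thesis unfolding p_def[symmetric]
  proof (intro exI[of _ C] allI impI)
    fix n d S and V :: "(nat \<Rightarrow> 'p mod_ring) \<Rightarrow> (nat \<Rightarrow> 'p mod_ring) set"
    assume d: "0 < d" and S: "S \<subseteq> vecs n" "p ^ n \<le> card S * p ^ d"
      and V: "\<forall>y\<in>S. add_subgroup (V y) \<and> V y \<subseteq> vecs n \<and> p ^ n \<le> card (V y) * p ^ d"
    have fS: "finite S" using S(1) by (rule finite_subset) simp
    have pn: "card (vecs n :: (nat \<Rightarrow> 'p mod_ring) set) = p ^ n" by (simp add: card_vecs p_def)
    define U where "U y = perp n (V y)" for y
    have U: "add_subgroup (U y)" "U y \<subseteq> vecs n" "finite (U y)" for y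
      unfolding U_def by (rule add_subgroup_perp, rule perp_subset_vecs, rule finite_subset[OF perp_subset_vecs], simp)
    have cU: "card (U y) \<le> p ^ d" if "y \<in> S" for y
    proof -
      have V': "add_subgroup (V y)" "V y \<subseteq> vecs n" "p ^ n \<le> card (V y) * p ^ d" using V that by auto
      have cV: "card (V y) > 0" using V'(3) p by (intro gr0I) simp
      have "card (V y) * card (U y) \<le> card (V y) * p ^ d"
        using card_perp[OF V'(1,2)] V'(3) by (simp add: U_def p_def)
      then show ?thesis using cV by simp
    qed
    define \<Gamma> where "\<Gamma> = (SIGMA y:S. U y)"
    have \<Gamma>: "\<Gamma> \<subseteq> vecs n \<times> vecs n" using S U by (auto simp: \<Gamma>_def)
    have f\<Gamma>: "finite \<Gamma>" by (rule finite_subset[OF \<Gamma>]) simp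
    have fib: "\<forall>y. card {u. (y, u) \<in> \<Gamma>} \<le> p ^ d"
    proof
      fix y
      show "card {u. (y, u) \<in> \<Gamma>} \<le> p ^ d" using cU[of y] by (cases "y \<in> S") (auto simp: \<Gamma>_def)
    qed
    have c\<Gamma>: "card \<Gamma> \<le> p ^ (n + d)"
    proof -
      have "card \<Gamma> = (\<Sum>y\<in>S. card (U y))" unfolding \<Gamma>_def using fS U by simp
      also have "\<dots> \<le> (\<Sum>y\<in>S. p ^ d)" by (rule sum_mono) (rule cU)
      also have "\<dots> \<le> p ^ n * p ^ d" using card_mono[OF _ S(1)] by (simp add: pn)
      finally show ?thesis by (simp add: power_add)
    qed
    obtain F where F: "finite F" "F \<subseteq> affine_maps n" "card F \<le> p ^ (C2 * d ^ 4)"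
      and rare: "mixed_energy {(y, u) \<in> \<Gamma>. \<forall>(L, c)\<in>F. u \<noteq> L y + c} \<Gamma> \<Gamma> \<Gamma> * p ^ (8 * d) \<le> p ^ (3 * n)"
      using C2[OF d \<Gamma> fib c\<Gamma>] by blast
    define \<kappa> where "\<kappa> = C2 * d ^ 4"
    \<comment> \<open>\<open>4 * \<kappa>\<close> compensates for the choice of four maps from
      \<open>F\<close>, and \<open>8 * d\<close> leaves the same margin as the bound on the mixed
      energy.\<close>
    define R where "R = 4 * \<kappa> + 8 * d"
    define \<Gamma>' where "\<Gamma>' = {(y, u) \<in> \<Gamma>. \<forall>(L, c)\<in>F. u \<noteq> L y + c}"
    have sub: "\<Gamma>' \<subseteq> \<Gamma>" by (auto simp: \<Gamma>'_def)
    define M where "M = {(a, b, c, d). a \<in> \<Gamma>' \<and> b \<in> \<Gamma> \<and> c \<in> \<Gamma> \<and> d \<in> \<Gamma> \<and> a - b = c - d}"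
    have fM: "finite M" by (rule finite_subset[of _ "\<Gamma> \<times> \<Gamma> \<times> \<Gamma> \<times> \<Gamma>"]) (use f\<Gamma> sub in \<open>auto simp: M_def\<close>)
    have cM: "card M * p ^ (8 * d) \<le> p ^ (3 * n)" using rare by (simp add: M_def \<Gamma>'_def mixed_energy_def)
    define Q where "Q = {(a, b, c, d). a \<in> S \<and> b \<in> S \<and> c \<in> S \<and> d \<in> S \<and> a - b = c - d}"
    have fQ: "finite Q" by (rule finite_subset[of _ "S \<times> S \<times> S \<times> S"]) (use fS in \<open>auto simp: Q_def\<close>)
    have cQ: "p ^ (3 * n) \<le> card Q * p ^ (4 * d)"
    proof -
      have "p ^ n * p ^ (3 * n) = (p ^ n) ^ 4" by (simp add: power_mult[symmetric] power_add[symmetric] mult.commute)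
      also have "\<dots> \<le> (card S * p ^ d) ^ 4" using S(2) by (rule power_mono) simp
      also have "\<dots> = card S ^ 4 * p ^ (4 * d)" by (simp add: power_mult_distrib power_mult[symmetric] mult.commute)
      also have "\<dots> \<le> (p ^ n * card Q) * p ^ (4 * d)"
        using card_power4_le_energy[OF S(1)] by (intro mult_le_mono1) (simp add: pn energy_def Q_def)
      finally have "p ^ n * p ^ (3 * n) \<le> p ^ n * (card Q * p ^ (4 * d))" by (simp add: mult.assoc)
      then show ?thesis using p by simp
    qed
    \<comment> \<open>The equation \<open>a - b = c - d\<close> has symmetries carrying its first
      position to each of the others, so \<open>M\<close> accounts for a point of
      \<open>\<Gamma>'\<close> in any of the four positions.\<close>
    define B1 where "B1 = (\<lambda>(a, b, c, d). (fst a, fst b, fst c, fst d)) ` M"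
    define B2 where "B2 = (\<lambda>(a, b, c, d). (fst b, fst a, fst d, fst c)) ` M"
    define B3 where "B3 = (\<lambda>(a, b, c, d). (fst c, fst d, fst a, fst b)) ` M"
    define B4 where "B4 = (\<lambda>(a, b, c, d). (fst d, fst c, fst b, fst a)) ` M"
    define B5 where "B5 = {(y1, y2, y3, y4). y1 \<in> vecs n \<and> y2 \<in> vecs n \<and> y3 \<in> vecs n \<and> y4 \<in> vecs n \<and> y1 - y2 = y3 - y4 \<and>
      (\<exists>T1\<in>F. \<exists>T2\<in>F. \<exists>T3\<in>F. \<exists>T4\<in>F.
         p ^ R \<le> card ((\<lambda>y. fst T1 y - fst T2 y) ` vecs n) \<and>
         (fst T1 y1 + snd T1) - (fst T2 y2 + snd T2) = (fst T3 y3 + snd T3) - (fst T4 y4 + snd T4))}"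
    have cB: "card B1 \<le> card M" "card B2 \<le> card M" "card B3 \<le> card M" "card B4 \<le> card M"
      unfolding B1_def B2_def B3_def B4_def by (rule card_image_le[OF fM])+
    have cB5: "card B5 * p ^ (8 * d) \<le> p ^ (3 * n)"
    proof -
      have "card B5 * p ^ R \<le> card F ^ 4 * p ^ (3 * n)"
        unfolding B5_def p_def by (rule card_high_rank_quadruples[OF F(1,2)])
      also have "\<dots> \<le> (p ^ \<kappa>) ^ 4 * p ^ (3 * n)" using F(3) unfolding \<kappa>_def by (intro mult_le_mono1 power_mono) auto
      also have "\<dots> = p ^ (3 * n) * p ^ (4 * \<kappa>)" by (simp add: power_mult[symmetric] mult.commute)
      finally have "(card B5 * p ^ (8 * d)) * p ^ (4 * \<kappa>) \<le> p ^ (3 * n) * p ^ (4 * \<kappa>)"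
        by (simp add: R_def power_add mult_ac)
      then show ?thesis using p by simp
    qed
    \<comment> \<open>There are at least \<open>p ^ (3 * n - 4 * d)\<close> quadruples in
      \<open>Q\<close>, and the five exceptional families have at most
      \<open>p ^ (3 * n - 8 * d)\<close> members each. As \<open>p ^ (4 * d) \<ge> 16\<close>, more
      than half of this lower bound survives.\<close>
    define G where "G = Q - (B1 \<union> B2 \<union> B3 \<union> B4 \<union> B5)"
    have cG: "p ^ (3 * n) \<le> card G * p ^ (4 * d + 1)"
    proof -
      have fB5: "finite B5" by (rule finite_subset[of _ "vecs n \<times> vecs n \<times> vecs n \<times> vecs n"]) (auto simp: B5_def)
      have fB: "finite B1" "finite B2" "finite B3" "finite B4"
        unfolding B1_def B2_def B3_def B4_def using fM by auto
      have "Q \<subseteq> G \<union> (B1 \<union> (B2 \<union> (B3 \<union> (B4 \<union> B5))))" by (auto simp: G_def)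
      then have "card Q \<le> card (G \<union> (B1 \<union> (B2 \<union> (B3 \<union> (B4 \<union> B5)))))"
        by (rule card_mono[rotated]) (use fQ fB fB5 in \<open>auto simp: G_def\<close>)
      also have "\<dots> \<le> card G + (card B1 + (card B2 + (card B3 + (card B4 + card B5))))"
        by (intro order_trans[OF card_Un_le] add_left_mono order_refl)
      also have "\<dots> \<le> card G + (4 * card M + card B5)" using cB by linarith
      finally have "card Q * (16 * p ^ (4 * d)) \<le> (card G + (4 * card M + card B5)) * (16 * p ^ (4 * d))"
        by (rule mult_le_mono1)
      also have "\<dots> = 16 * card G * p ^ (4 * d) + (4 * card M + card B5) * (16 * p ^ (4 * d))"
        by (simp add: algebra_simps)
      also have "(4 * card M + card B5) * (16 * p ^ (4 * d)) \<le> (4 * card M + card B5) * p ^ (8 * d)"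
      proof (rule mult_le_mono2)
        have "(2 :: nat) ^ 4 \<le> p ^ 4" using p by (rule power_mono) simp
        also have "\<dots> \<le> p ^ (4 * d)" using p d by (intro power_increasing) auto
        finally have "16 * p ^ (4 * d) \<le> p ^ (4 * d) * p ^ (4 * d)" by (intro mult_le_mono1) simp
        then show "16 * p ^ (4 * d) \<le> p ^ (8 * d)" by (simp add: power_add[symmetric])
      qed
      also have "\<dots> = 4 * (card M * p ^ (8 * d)) + card B5 * p ^ (8 * d)" by (simp add: algebra_simps)
      also have "\<dots> \<le> 5 * p ^ (3 * n)" using cM cB5 by linarith
      finally have "16 * (card Q * p ^ (4 * d)) \<le> 16 * (card G * p ^ (4 * d)) + 5 * p ^ (3 * n)" by (simp add: mult_ac)
      then have "p ^ (3 * n) \<le> 2 * (card G * p ^ (4 * d))" using cQ by linarith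
      also have "\<dots> \<le> p * (card G * p ^ (4 * d))" using p by (rule mult_le_mono1)
      finally show ?thesis by (simp add: mult_ac)
    qed
    define Z0 where "Z0 = (\<lambda>(a, b, c, d). a - b) ` G"
    have GQ: "G \<subseteq> Q" by (auto simp: G_def)
    have fG: "finite G" using GQ fQ by (rule finite_subset)
    have Z0v: "Z0 \<subseteq> vecs n" using GQ S(1) by (auto simp: Z0_def Q_def intro!: add_subgroup_diff[OF add_subgroup_vecs])
    have fZ0: "finite Z0" using fG by (simp add: Z0_def)
    \<comment> \<open>A quadruple is determined by its common difference together with its second
      and fourth entries.\<close>
    have cZ0: "p ^ n \<le> card Z0 * p ^ (4 * d + 1)"
    proof -
      have "card G \<le> card (Z0 \<times> (vecs n :: (nat \<Rightarrow> 'p mod_ring) set) \<times> (vecs n :: (nat \<Rightarrow> 'p mod_ring) set))"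
      proof (rule card_inj_on_le[of "\<lambda>(a, b, c, d). (a - b, b, d)"])
        have "a = a' \<and> c = c'" if "a - b = c - d" "a' - b = c' - d" "a - b = a' - b" for a b c d a' c' :: "nat \<Rightarrow> 'p mod_ring"
        proof -
          have "a = a'" using that(3) by (metis diff_add_cancel)
          moreover have "c = c'" using that by (metis diff_add_cancel)
          ultimately show ?thesis ..
        qed
        note inj = this
        show "inj_on (\<lambda>(a, b, c, d). (a - b, b, d)) G"
        proof (rule inj_onI)
          fix q q' assume q: "q \<in> G" "q' \<in> G"
            and e: "(case q of (a, b, c, d) \<Rightarrow> (a - b, b, d)) = (case q' of (a, b, c, d) \<Rightarrow> (a - b, b, d))"
          obtain a b c d a' b' c' d' where qq: "q = (a, b, c, d)" "q' = (a', b', c', d')" by (metis surj_pair)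
          then have "b' = b" "d' = d" "a - b = a' - b" using e by auto
          moreover from this have "a - b = c - d" "a' - b = c' - d" using q GQ by (auto simp: qq Q_def)
          ultimately show "q = q'" using inj[of a b c d a' c'] by (simp add: qq)
        qed
        show "(\<lambda>(a, b, c, d). (a - b, b, d)) ` G \<subseteq> Z0 \<times> vecs n \<times> vecs n"
        proof (rule image_subsetI)
          fix q assume q: "q \<in> G"
          obtain a b c d where qq: "q = (a, b, c, d)" by (metis surj_pair)
          then have "b \<in> vecs n" "d \<in> vecs n" using q GQ S(1) by (auto simp: Q_def)
          moreover have "a - b \<in> Z0" unfolding Z0_def by (rule image_eqI[of _ _ q]) (use q qq in auto)
          ultimately show "(case q of (a, b, c, d) \<Rightarrow> (a - b, b, d)) \<in> Z0 \<times> vecs n \<times> vecs n" by (simp add: qq)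
        qed
      qed (use fZ0 in auto)
      then have "card G \<le> card Z0 * p ^ (2 * n)"
        by (simp add: card_cartesian_product pn power_add[symmetric] mult_2)
      then have "card G * p ^ (4 * d + 1) \<le> (card Z0 * p ^ (2 * n)) * p ^ (4 * d + 1)" by (rule mult_le_mono1)
      with cG have "p ^ (3 * n) \<le> (card Z0 * p ^ (2 * n)) * p ^ (4 * d + 1)" by (rule order_trans)
      also have "\<dots> = (card Z0 * p ^ (4 * d + 1)) * p ^ (2 * n)" by (simp only: mult_ac)
      finally have "p ^ (3 * n) \<le> (card Z0 * p ^ (4 * d + 1)) * p ^ (2 * n)" .
      moreover have "p ^ (3 * n) = p ^ n * p ^ (2 * n)" by (simp add: power_add[symmetric])
      ultimately have "p ^ n * p ^ (2 * n) \<le> (card Z0 * p ^ (4 * d + 1)) * p ^ (2 * n)" by simp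
      then show ?thesis using p by simp
    qed
    \<comment> \<open>For \<open>z = y1 - y2\<close> the difference of the values of
      \<open>T1\<close> at \<open>y1\<close> and of \<open>T2\<close> at \<open>y2\<close> is
      \<open>fst T1 z\<close> plus the constant
      \<open>snd T1 - snd T2 + (fst T1 y2 - fst T2 y2)\<close>. With small rank there are at most
      \<open>p ^ R\<close> such constants for each pair, and each becomes an affine map of its
      own.\<close>
    define F' where "F' = (\<Union>(T1, T2)\<in>{q \<in> F \<times> F. card ((\<lambda>y. fst (fst q) y - fst (snd q) y) ` vecs n) \<le> p ^ R}.
      (\<lambda>s. (fst T1, snd T1 - snd T2 + s)) ` ((\<lambda>y. fst T1 y - fst T2 y) ` vecs n))"
    have fF': "finite F'" unfolding F'_def using F(1) by (intro finite_UN_I) auto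
    have F'a: "F' \<subseteq> affine_maps n"
    proof
      fix T assume "T \<in> F'"
      then obtain T1 T2 y where T: "T1 \<in> F" "T2 \<in> F" "y \<in> vecs n" "T = (fst T1, snd T1 - snd T2 + (fst T1 y - fst T2 y))"
        by (auto simp: F'_def)
      have "T1 \<in> affine_maps n" "T2 \<in> affine_maps n" using T F(2) by auto
      moreover from this have "fst T1 y \<in> vecs n" "fst T2 y \<in> vecs n" using T(3) by (auto simp: affine_maps_def)
      moreover from calculation have "snd T1 - snd T2 + (fst T1 y - fst T2 y) \<in> vecs n"
        by (intro add_subgroup_add[OF add_subgroup_vecs] add_subgroup_diff[OF add_subgroup_vecs])
          (simp_all add: affine_maps_def case_prod_unfold)
      ultimately show "T \<in> affine_maps n"
        unfolding T(4) by (simp add: affine_maps_def case_prod_unfold)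
    qed
    have cF': "card F' \<le> p ^ (6 * \<kappa> + 8 * d)"
    proof -
      define J where "J = {q \<in> F \<times> F. card ((\<lambda>y. fst (fst q) y - fst (snd q) y) ` vecs n) \<le> p ^ R}"
      have fJ: "finite J" using F(1) by (simp add: J_def)
      have "card J \<le> card (F \<times> F)" by (rule card_mono) (use F(1) in \<open>auto simp: J_def\<close>)
      also have "\<dots> \<le> p ^ \<kappa> * p ^ \<kappa>" using F(3) by (simp add: card_cartesian_product \<kappa>_def mult_le_mono)
      finally have cJ: "card J \<le> p ^ \<kappa> * p ^ \<kappa>" .
      have "card F' \<le> (\<Sum>(T1, T2)\<in>J. card ((\<lambda>s. (fst T1, snd T1 - snd T2 + s)) ` ((\<lambda>y. fst T1 y - fst T2 y) ` vecs n)))"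
        unfolding F'_def J_def[symmetric] case_prod_unfold by (rule card_UN_le[OF fJ])
      also have "\<dots> \<le> (\<Sum>q\<in>J. p ^ R)"
      proof (rule sum_mono, clarify)
        fix T1 T2 assume q: "(T1, T2) \<in> J"
        have "card ((\<lambda>s. (fst T1, snd T1 - snd T2 + s)) ` ((\<lambda>y. fst T1 y - fst T2 y) ` vecs n))
            \<le> card ((\<lambda>y. fst T1 y - fst T2 y) ` vecs n)" by (intro card_image_le) simp
        also have "\<dots> \<le> p ^ R" using q by (simp add: J_def)
        finally show "card ((\<lambda>s. (fst T1, snd T1 - snd T2 + s)) ` ((\<lambda>y. fst T1 y - fst T2 y) ` vecs n)) \<le> p ^ R" .
      qed
      also have "\<dots> = card J * p ^ R" by simp
      also have "\<dots> \<le> (p ^ \<kappa> * p ^ \<kappa>) * p ^ R" using cJ by (rule mult_le_mono1)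
      also have "\<dots> = p ^ (6 * \<kappa> + 8 * d)" by (simp add: R_def power_add[symmetric])
      finally show ?thesis .
    qed

    have good: "\<exists>T \<in> {..<2 * d} \<rightarrow>\<^sub>E F'. \<exists>y1\<in>S. \<exists>y2\<in>S. \<exists>y3\<in>S. \<exists>y4\<in>S. z = y1 - y2 \<and> z = y3 - y4 \<and>
        perp n (V y1 \<inter> V y2) \<inter> perp n (V y3 \<inter> V y4) \<subseteq> lspan (2 * d) (\<lambda>i. fst (T i) z + snd (T i))"
      if z: "z \<in> Z0" for z
    proof -
      obtain y1 y2 y3 y4 where g: "(y1, y2, y3, y4) \<in> G" "z = y1 - y2" using z by (auto simp: Z0_def)
      then have y: "y1 \<in> S" "y2 \<in> S" "y3 \<in> S" "y4 \<in> S" and z': "z = y3 - y4" using GQ by (auto simp: Q_def)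
      define I where "I = (U y1 + U y2) \<inter> (U y3 + U y4)"
      have Ieq: "perp n (V y1 \<inter> V y2) \<inter> perp n (V y3 \<inter> V y4) = I"
        unfolding I_def U_def using V y by (simp add: perp_Int)
      have val: "\<exists>T\<in>F'. u = fst T z + snd T" if u: "u \<in> I" for u
      proof -
        have diff: "\<exists>a\<in>U y. \<exists>b\<in>U y'. u = a - b" if "u \<in> U y + U y'" for y y'
        proof -
          obtain a b where "a \<in> U y" "b \<in> U y'" "u = a + b" using \<open>u \<in> U y + U y'\<close> by (rule set_plus_elim)
          then show ?thesis using add_subgroup_uminus[OF U(1), of b y'] by (intro bexI[of _ a] bexI[of _ "- b"]) auto
        qed
        obtain u1 u2 u3 u4 where u12: "u1 \<in> U y1" "u2 \<in> U y2" "u = u1 - u2"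
          and u34: "u3 \<in> U y3" "u4 \<in> U y4" "u = u3 - u4"
          using diff[of y1 y2] diff[of y3 y4] u by (auto simp: I_def)
        have in\<Gamma>: "(y1, u1) \<in> \<Gamma>" "(y2, u2) \<in> \<Gamma>" "(y3, u3) \<in> \<Gamma>" "(y4, u4) \<in> \<Gamma>"
          using y u12 u34 by (auto simp: \<Gamma>_def)
        have e: "(y1, u1) - (y2, u2) = (y3, u3) - (y4, u4)" using g(2) z' u12 u34 by simp
        have e2: "(y2, u2) - (y1, u1) = (y4, u4) - (y3, u3)" using e by (metis minus_diff_eq)
        have notin: "(y1, y2, y3, y4) \<notin> B1" "(y1, y2, y3, y4) \<notin> B2" "(y1, y2, y3, y4) \<notin> B3" "(y1, y2, y3, y4) \<notin> B4"
            "(y1, y2, y3, y4) \<notin> B5" using g(1) by (auto simp: G_def)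
        have "(y1, u1) \<notin> \<Gamma>'"
        proof
          assume "(y1, u1) \<in> \<Gamma>'"
          then have "((y1, u1), (y2, u2), (y3, u3), (y4, u4)) \<in> M" using in\<Gamma> e by (simp add: M_def)
          then show False using notin(1) unfolding B1_def by force
        qed
        moreover have "(y2, u2) \<notin> \<Gamma>'"
        proof
          assume "(y2, u2) \<in> \<Gamma>'"
          then have "((y2, u2), (y1, u1), (y4, u4), (y3, u3)) \<in> M" using in\<Gamma> e2 by (simp add: M_def)
          then show False using notin(2) unfolding B2_def by force
        qed
        moreover have "(y3, u3) \<notin> \<Gamma>'"
        proof
          assume "(y3, u3) \<in> \<Gamma>'"
          then have "((y3, u3), (y4, u4), (y1, u1), (y2, u2)) \<in> M" using in\<Gamma> e by (simp add: M_def)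
          then show False using notin(3) unfolding B3_def by force
        qed
        moreover have "(y4, u4) \<notin> \<Gamma>'"
        proof
          assume "(y4, u4) \<in> \<Gamma>'"
          then have "((y4, u4), (y3, u3), (y2, u2), (y1, u1)) \<in> M" using in\<Gamma> e2 by (simp add: M_def)
          then show False using notin(4) unfolding B4_def by force
        qed
        ultimately obtain T1 T2 T3 T4 where T: "T1 \<in> F" "T2 \<in> F" "T3 \<in> F" "T4 \<in> F"
          and uT: "u1 = fst T1 y1 + snd T1" "u2 = fst T2 y2 + snd T2" "u3 = fst T3 y3 + snd T3" "u4 = fst T4 y4 + snd T4"
          using in\<Gamma> unfolding \<Gamma>'_def by fastforce
        have "card ((\<lambda>y. fst T1 y - fst T2 y) ` vecs n) \<le> p ^ R"
        proof (rule ccontr)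
          assume "\<not> ?thesis"
          then have big: "p ^ R \<le> card ((\<lambda>y. fst T1 y - fst T2 y) ` vecs n)" by linarith
          have eq: "(fst T1 y1 + snd T1) - (fst T2 y2 + snd T2) = (fst T3 y3 + snd T3) - (fst T4 y4 + snd T4)"
            using u12(3) u34(3) unfolding uT by (rule trans[OF sym])
          have "y1 - y2 = y3 - y4" using g(2) z' by simp
          then have "(y1, y2, y3, y4) \<in> B5"
            unfolding B5_def using y S(1) T big eq by blast
          then show False using notin(5) by blast
        qed
        then have "(fst T1, snd T1 - snd T2 + (fst T1 y2 - fst T2 y2)) \<in> F'"
          unfolding F'_def using T y S(1) by force
        moreover have "u = fst T1 z + (snd T1 - snd T2 + (fst T1 y2 - fst T2 y2))"
        proof -
          have "additive (fst T1)" using T(1) F(2) by (auto simp: affine_maps_def)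
          then have "fst T1 z = fst T1 y1 - fst T1 y2" unfolding g(2) by (rule additive.diff)
          then show ?thesis unfolding u12(3) uT by simp
        qed
        ultimately show ?thesis by (metis fst_conv snd_conv)
      qed
      \<comment> \<open>Two annihilators of size at most \<open>p ^ d\<close> each have a sum of
        size at most \<open>p ^ (2 * d)\<close>, so \<open>2 * d\<close> generators suffice. By
        \<open>val\<close> each generator is the value at \<open>z\<close> of a map in
        \<open>F'\<close>.\<close>
      have Isub: "add_subgroup I" unfolding I_def by (intro add_subgroup_Int add_subgroup_set_plus U)
      have fU12: "finite (U y1 + U y2)" using U by (intro finite_set_plus)
      then have fI: "finite I" by (simp add: I_def)
      have "card I \<le> card (U y1 + U y2)" using fU12 by (intro card_mono) (auto simp: I_def)
      also have "\<dots> \<le> card (U y1 \<times> U y2)"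
        unfolding set_plus_image using U by (intro card_image_le finite_cartesian_product)
      also have "\<dots> \<le> p ^ d * p ^ d" using cU y by (simp add: card_cartesian_product mult_le_mono)
      also have "\<dots> = p ^ (2 * d)" by (simp add: power_add[symmetric] mult_2)
      finally have "card I \<le> CARD('p) ^ (2 * d)" by (simp add: p_def)
      then obtain b where b: "\<And>i. i < 2 * d \<Longrightarrow> b i \<in> I" "I \<subseteq> lspan (2 * d) b"
        using ex_generators[OF Isub fI] by blast
      have "\<forall>i\<in>{..<2 * d}. \<exists>T\<in>F'. b i = fst T z + snd T" using b(1) val by blast
      then obtain T where T: "\<forall>i\<in>{..<2 * d}. T i \<in> F' \<and> b i = fst (T i) z + snd (T i)" by metis
      have "lspan (2 * d) b = lspan (2 * d) (\<lambda>i. fst (restrict T {..<2 * d} i) z + snd (restrict T {..<2 * d} i))"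
        using T by (intro lspan_cong) auto
      moreover have "restrict T {..<2 * d} \<in> {..<2 * d} \<rightarrow>\<^sub>E F'" using T by auto
      ultimately show ?thesis using b(2) Ieq y g(2) z' by blast
    qed
    define P where "P z T \<longleftrightarrow> (\<exists>y1\<in>S. \<exists>y2\<in>S. \<exists>y3\<in>S. \<exists>y4\<in>S. z = y1 - y2 \<and> z = y3 - y4 \<and>
        perp n (V y1 \<inter> V y2) \<inter> perp n (V y3 \<inter> V y4) \<subseteq> lspan (2 * d) (\<lambda>i. fst (T i) z + snd (T i)))" for z T
    have "\<forall>z\<in>Z0. \<exists>T. T \<in> {..<2 * d} \<rightarrow>\<^sub>E F' \<and> P z T" using good unfolding P_def by blast
    then obtain \<tau> where \<tau>: "\<And>z. z \<in> Z0 \<Longrightarrow> \<tau> z \<in> {..<2 * d} \<rightarrow>\<^sub>E F' \<and> P z (\<tau> z)" by metis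
    have Z0ne: "Z0 \<noteq> {}" using cZ0 p by auto
    have fPE: "finite ({..<2 * d} \<rightarrow>\<^sub>E F')" using fF' by (intro finite_PiE) auto
    have "\<tau> ` Z0 \<subseteq> {..<2 * d} \<rightarrow>\<^sub>E F'" using \<tau> by blast
    \<comment> \<open>Pigeonhole over tuples of \<open>2 * d\<close> maps out of
      \<open>p ^ O(d ^ 4)\<close>: this is the step that costs \<open>p ^ O(d ^ 5)\<close>, and
      afterwards the maps no longer depend on the row.\<close>
    then obtain T where T: "T \<in> {..<2 * d} \<rightarrow>\<^sub>E F'"
      "card Z0 \<le> card ({..<2 * d} \<rightarrow>\<^sub>E F') * card {z \<in> Z0. \<tau> z = T}"
      using ex_popular_value[OF fZ0 fPE _ Z0ne] by blast
    define S' where "S' = {z \<in> Z0. \<tau> z = T}"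
    have "p ^ n \<le> card S' * p ^ (C * d ^ 5)"
    proof -
      have "card ({..<2 * d} \<rightarrow>\<^sub>E F') = card F' ^ (2 * d)" by (simp add: card_PiE)
      also have "\<dots> \<le> (p ^ (6 * \<kappa> + 8 * d)) ^ (2 * d)" using cF' by (rule power_mono) simp
      finally have "card Z0 \<le> p ^ ((6 * \<kappa> + 8 * d) * (2 * d)) * card S'"
        using T(2) mult_le_mono1 order_trans unfolding S'_def power_mult by blast
      then have "card Z0 * p ^ (4 * d + 1) \<le> p ^ ((6 * \<kappa> + 8 * d) * (2 * d)) * card S' * p ^ (4 * d + 1)"
        by (rule mult_le_mono1)
      with cZ0 have "p ^ n \<le> p ^ ((6 * \<kappa> + 8 * d) * (2 * d)) * card S' * p ^ (4 * d + 1)" by (rule order_trans)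
      also have "\<dots> = card S' * p ^ ((6 * \<kappa> + 8 * d) * (2 * d) + (4 * d + 1))"
        by (simp only: power_add mult_ac)
      finally have "p ^ n \<le> card S' * p ^ ((6 * \<kappa> + 8 * d) * (2 * d) + (4 * d + 1))" .
      also have "\<dots> \<le> card S' * p ^ (C * d ^ 5)"
      proof (intro mult_le_mono2 power_increasing)
        have d5: "d ^ 5 = d ^ 4 * d" by (simp add: eval_nat_numeral)
        have le: "d ^ 1 \<le> d ^ 5" "d ^ 2 \<le> d ^ 5" "d ^ 0 \<le> d ^ 5" using d by (intro power_increasing; simp)+
        have "(6 * \<kappa> + 8 * d) * (2 * d) + (4 * d + 1) = 12 * C2 * d ^ 5 + 16 * d ^ 2 + 4 * d + 1"
          by (simp add: \<kappa>_def d5 power2_eq_square algebra_simps)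
        also have "\<dots> \<le> C * d ^ 5" using le by (simp add: C_def algebra_simps)
        finally show "(6 * \<kappa> + 8 * d) * (2 * d) + (4 * d + 1) \<le> C * d ^ 5" .
      qed (use p in simp)
      finally show ?thesis .
    qed
    moreover have "S' \<subseteq> vecs n" using Z0v by (auto simp: S'_def)
    moreover have "\<forall>i<2 * d. T i \<in> affine_maps n" using T(1) F'a by auto
    moreover have "\<forall>z\<in>S'. P z T" using \<tau> by (auto simp: S'_def)
    ultimately show "\<exists>S' T. S' \<subseteq> vecs n \<and> p ^ n \<le> card S' * p ^ (C * d ^ 5) \<and>
      (\<forall>i<2 * d. T i \<in> affine_maps n) \<and>
      (\<forall>z\<in>S'. \<exists>y1\<in>S. \<exists>y2\<in>S. \<exists>y3\<in>S. \<exists>y4\<in>S. z = y1 - y2 \<and> z = y3 - y4 \<and>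
        perp n (V y1 \<inter> V y2) \<inter> perp n (V y3 \<inter> V y4) \<subseteq> lspan (2 * d) (\<lambda>i. fst (T i) z + snd (T i)))"
      unfolding P_def by blast
  qed
qed

subsection \<open>The bilinear argument\<close>

text \<open>With \<open>vdiff\<close>, the counterparts of \<open>phi_h\<close> and
  \<open>phi_v\<close> for sequences.\<close>

definition hdiff :: "('a::ab_group_add \<times> 'a) set \<Rightarrow> ('a \<times> 'a) set" where
  "hdiff A = {(x1 - x2, y) | x1 x2 y. (x1, y) \<in> A \<and> (x2, y) \<in> A}"

definition vdiff :: "('a::ab_group_add \<times> 'a) set \<Rightarrow> ('a \<times> 'a) set" where
  "vdiff A = {(x, y1 - y2) | x y1 y2. (x, y1) \<in> A \<and> (x, y2) \<in> A}"

lemma hdiffI: "(x1, y) \<in> A \<Longrightarrow> (x2, y) \<in> A \<Longrightarrow> (x1 - x2, y) \<in> hdiff A"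
  by (auto simp: hdiff_def)

lemma vdiffI: "(x, y1) \<in> A \<Longrightarrow> (x, y2) \<in> A \<Longrightarrow> (x, y1 - y2) \<in> vdiff A"
  by (auto simp: vdiff_def)

text \<open>Subtracting \<open>y1 - y1\<close> keeps a row unchanged, so a row once reached persists
  through the following vertical letters of the word.\<close>

lemma vdiff_subset_vdiff_vdiff: "vdiff A \<subseteq> vdiff (vdiff A)"
proof
  fix q assume "q \<in> vdiff A"
  then obtain x y1 y2 where q: "q = (x, y1 - y2)" "(x, y1) \<in> A" "(x, y2) \<in> A" by (auto simp: vdiff_def)
  have "(x, (y1 - y2) - (y1 - y1)) \<in> vdiff (vdiff A)" using q by (intro vdiffI)
  then show "q \<in> vdiff (vdiff A)" by (simp add: q)
qed

text \<open>Only the linear parts vary with \<open>z\<close>; all translation parts are gathered in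
  the fixed space \<open>C\<close>.\<close>

definition aspan :: "(nat \<Rightarrow> 'p::prime_card mod_ring) set \<Rightarrow> nat \<Rightarrow>
    (nat \<Rightarrow> (nat \<Rightarrow> 'p mod_ring) \<Rightarrow> nat \<Rightarrow> 'p mod_ring) \<Rightarrow> (nat \<Rightarrow> 'p mod_ring) \<Rightarrow> (nat \<Rightarrow> 'p mod_ring) set" where
  "aspan C k L z = C + lspan k (\<lambda>i. L i z)"

lemma add_subgroup_aspan: "add_subgroup C \<Longrightarrow> add_subgroup (aspan C k L z)"
  unfolding aspan_def by (intro add_subgroup_set_plus add_subgroup_lspan)

lemma aspan_subset_vecs:
  assumes "C \<subseteq> vecs n" "\<And>i. i < k \<Longrightarrow> L i ` vecs n \<subseteq> vecs n" "z \<in> vecs n"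
  shows "aspan C k L z \<subseteq> vecs n"
  unfolding aspan_def
  by (intro set_plus_subset_vecs assms(1) lspan_subset add_subgroup_vecs) (use assms in blast)

text \<open>For fixed \<open>y2\<close> and \<open>y3\<close> this is
  \<open>card_preimage_coset\<close> in the variable \<open>y1\<close>; one map of large rank is
  enough.\<close>

lemma card_triple_preimage_le:
  fixes M1 M2 M3 :: "(nat \<Rightarrow> 'p::prime_card mod_ring) \<Rightarrow> nat \<Rightarrow> 'p mod_ring"
  assumes M1: "additive M1" and C: "add_subgroup C" "finite C"
    and big: "CARD('p) ^ R * card C \<le> card (M1 ` vecs n + C)"
  shows "card {(y1, y2, y3). y1 \<in> vecs n \<and> y2 \<in> vecs n \<and> y3 \<in> vecs n \<and> M1 y1 + M2 y2 + M3 y3 + e \<in> C} * CARD('p) ^ R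
    \<le> CARD('p) ^ (3 * n)" (is "card ?B * _ \<le> _")
proof -
  define X where "X = (vecs n :: (nat \<Rightarrow> 'p mod_ring) set)"
  have X: "finite X" "card X = CARD('p) ^ n" by (simp_all add: X_def card_vecs)
  define H where "H q = {y1 \<in> X. M1 y1 + (M2 (fst q) + M3 (snd q) + e) \<in> C}" for q
  have fH: "finite (H q)" for q using X by (simp add: H_def)
  have "card ?B \<le> card (SIGMA q:X \<times> X. H q)"
    by (rule card_inj_on_le[of "\<lambda>(y1, y2, y3). ((y2, y3), y1)"])
      (use X fH in \<open>auto simp: inj_on_def H_def X_def add.assoc\<close>)
  also have "\<dots> = (\<Sum>q\<in>X \<times> X. card (H q))" using X fH by (intro card_SigmaI) auto
  finally have "card ?B * CARD('p) ^ R \<le> (\<Sum>q\<in>X \<times> X. card (H q)) * CARD('p) ^ R" by (rule mult_le_mono1)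
  also have "\<dots> = (\<Sum>q\<in>X \<times> X. card (H q) * CARD('p) ^ R)" by (simp add: sum_distrib_right)
  also have "\<dots> \<le> (\<Sum>q\<in>X \<times> X. CARD('p) ^ n)"
    unfolding H_def X_def by (intro sum_mono card_preimage_coset[OF M1 C big])
  also have "\<dots> = CARD('p) ^ (3 * n)"
  proof -
    have "3 * n = n + n + n" by simp
    then show ?thesis by (simp only: power_add card_cartesian_product X sum_constant of_nat_id mult.assoc)
  qed
  finally show ?thesis .
qed

text \<open>
  Against a fixed representation \<open>y'\<close> of \<open>w\<close>, a random representation \<open>y\<close> shares only the forced
  annihilators: any other coincidence is a nontrivial equation for a map of large rank.
\<close>

lemma ex_generic_representation:
  fixes L :: "nat \<Rightarrow> (nat \<Rightarrow> 'p::prime_card mod_ring) \<Rightarrow> nat \<Rightarrow> 'p mod_ring"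
  assumes L: "\<And>i. i < k \<Longrightarrow> additive (L i) \<and> L i ` vecs n \<subseteq> vecs n"
    and C: "add_subgroup C" "C \<subseteq> vecs n"
    and rank: "\<And>a i. i < k \<Longrightarrow> a i \<noteq> 0 \<Longrightarrow>
       CARD('p) ^ R * card C \<le> card ((\<lambda>y. \<Sum>j<k. smul (a j) (L j y)) ` vecs n + C)"
    and S: "S \<subseteq> vecs n" and w: "w \<in> vecs n"
    and reps: "CARD('p) ^ (3 * n) \<le> CARD('p) ^ c *
      card {(x1, x2, x3). x1 \<in> S \<and> x2 \<in> S \<and> x3 \<in> S \<and> x1 + x2 - x3 - w \<in> S}"
    and R: "8 * k + c < R"
    and y': "y1' \<in> S" "y2' \<in> S" "y3' \<in> S" "y4' \<in> S"
  obtains y1 y2 y3 y4 where "y1 \<in> S" "y2 \<in> S" "y3 \<in> S" "y4 \<in> S" "y4 = y1 + y2 - y3 - w"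
    "(aspan C k L y1 + aspan C k L y2 + aspan C k L y3 + aspan C k L y4) \<inter>
     (aspan C k L y1' + aspan C k L y2' + aspan C k L y3' + aspan C k L y4') \<subseteq> aspan C k L w"
proof -
  define p where "p = CARD('p)"
  have p: "2 \<le> p" using prime_card[where 'a = 'p] prime_ge_2_nat by (simp add: p_def)
  have fC: "finite C" using C(2) by (rule finite_subset) simp
  define lc where "lc a y = (\<Sum>i<k. smul (a i) (L i y))" for a y
  have lc_add: "additive (lc a)" for a
    unfolding lc_def[abs_def] by (rule additive_combination) (use L in auto)
  have lc_plus: "lc (\<lambda>i. a i + b i) y = lc a y + lc b y" for a b y
    by (simp add: lc_def smul_add_left sum.distrib)
  have lc_minus: "lc (\<lambda>i. a i - b i) y = lc a y - lc b y" for a b y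
    by (simp add: lc_def smul_diff_left sum_subtractf)
  define co where "co = ({..<k} \<rightarrow>\<^sub>E (UNIV :: 'p mod_ring set))"
  have co: "finite co" "card co = p ^ k" by (auto simp: co_def card_PiE p_def intro: finite_PiE)
  have asp: "\<exists>c\<in>C. \<exists>a\<in>co. u = c + lc a z" if "u \<in> aspan C k L z" for u z
    using that unfolding aspan_def lspan_restrict co_def lc_def by (auto elim!: set_plus_elim)
  \<comment> \<open>The linear parts available to the fixed representation. Their constants are not
    enumerated: a coincidence is tested modulo \<open>C\<close>, which saves the factor
    \<open>card C ^ 4\<close>.\<close>
  define Q0 where "Q0 = lspan k (\<lambda>i. L i y1') + lspan k (\<lambda>i. L i y2') + lspan k (\<lambda>i. L i y3') + lspan k (\<lambda>i. L i y4')"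
  have fQ0: "finite Q0" unfolding Q0_def by (intro finite_set_plus finite_lspan)
  have cQ0: "card Q0 \<le> p ^ (4 * k)"
  proof -
    have cp: "card (X + Y) \<le> card X * card Y" if "finite X" "finite Y" for X Y :: "(nat \<Rightarrow> 'p mod_ring) set"
      unfolding set_plus_image using card_image_le[of "X \<times> Y" "\<lambda>(x, y). x + y"] that
      by (simp add: card_cartesian_product)
    have l: "card (lspan k b) \<le> p ^ k" for b :: "nat \<Rightarrow> nat \<Rightarrow> 'p mod_ring" unfolding p_def by (rule card_lspan_le)
    have "card Q0 \<le> p ^ k * p ^ k * p ^ k * p ^ k"
      unfolding Q0_def
      by (intro order_trans[OF cp] mult_le_mono l finite_set_plus finite_lspan)
    also have "\<dots> = p ^ (4 * k)"
    proof -
      have "4 * k = k + k + k + k" by simp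
      then show ?thesis by (simp only: power_add)
    qed
    finally show ?thesis .
  qed
  \<comment> \<open>Substituting \<open>y4 = y1 + y2 - y3 - w\<close> collects the coefficients
    \<open>a1 + a4\<close>, \<open>a2 + a4\<close> and \<open>a3 - a4\<close> at the three free
    variables.\<close>
  define N where "N = (\<lambda>(q, a1, a2, a3, a4). {(y1, y2, y3). y1 \<in> vecs n \<and> y2 \<in> vecs n \<and> y3 \<in> vecs n \<and>
    lc (\<lambda>i. a1 i + a4 i) y1 + lc (\<lambda>i. a2 i + a4 i) y2 + lc (\<lambda>i. a3 i - a4 i) y3 + (- lc a4 w - q) \<in> C})"
  \<comment> \<open>The coincidences that are not forced: at least one of the three collected
    combinations is nontrivial and so has large rank.\<close>
  define J where "J = {(q, a1, a2, a3, a4) \<in> Q0 \<times> co \<times> co \<times> co \<times> co.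
    \<exists>i<k. a1 i + a4 i \<noteq> 0 \<or> a2 i + a4 i \<noteq> 0 \<or> a3 i - a4 i \<noteq> 0}"
  have JQ: "J \<subseteq> Q0 \<times> co \<times> co \<times> co \<times> co" by (auto simp: J_def)
  have fJ: "finite J" by (rule finite_subset[OF JQ]) (use fQ0 co in auto)
  have cJ: "card J \<le> p ^ (8 * k)"
  proof -
    have "card J \<le> card (Q0 \<times> co \<times> co \<times> co \<times> co)" by (rule card_mono[OF _ JQ]) (use fQ0 co in auto)
    also have "\<dots> = card Q0 * p ^ (4 * k)"
    proof -
      have "4 * k = k + (k + (k + k))" by simp
      then show ?thesis by (simp only: power_add card_cartesian_product co)
    qed
    also have "\<dots> \<le> p ^ (4 * k) * p ^ (4 * k)" using cQ0 by (rule mult_le_mono1)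
    finally show ?thesis by (simp add: power_add[symmetric])
  qed
  have cN: "card (N j) * p ^ R \<le> p ^ (3 * n)" if "j \<in> J" for j
  proof -
    obtain q a1 a2 a3 a4 where j: "j = (q, a1, a2, a3, a4)" by (metis surj_pair)
    define M1 M2 M3 where "M1 = lc (\<lambda>i. a1 i + a4 i)" and "M2 = lc (\<lambda>i. a2 i + a4 i)" and "M3 = lc (\<lambda>i. a3 i - a4 i)"
    define e where "e = - lc a4 w - q"
    define B where "B = {(y1, y2, y3). y1 \<in> vecs n \<and> y2 \<in> vecs n \<and> y3 \<in> vecs n \<and> M1 y1 + M2 y2 + M3 y3 + e \<in> C}"
    have NB: "N j = B" by (simp add: N_def j B_def M1_def M2_def M3_def e_def)
    have rk: "CARD('p) ^ R * card C \<le> card (lc b ` vecs n + C)" if "i < k" "b i \<noteq> 0" for b i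
      using rank[of i b] that by (simp add: lc_def[abs_def])
    from that obtain i where i: "i < k" "a1 i + a4 i \<noteq> 0 \<or> a2 i + a4 i \<noteq> 0 \<or> a3 i - a4 i \<noteq> 0"
      by (auto simp: J_def j)
    then consider "a1 i + a4 i \<noteq> 0" | "a2 i + a4 i \<noteq> 0" | "a3 i - a4 i \<noteq> 0" by blast
    then show ?thesis
    proof cases
      case 1
      have "CARD('p) ^ R * card C \<le> card (M1 ` vecs n + C)"
        unfolding M1_def using rk[of i "\<lambda>i. a1 i + a4 i"] i(1) 1 by simp
      then show ?thesis
        unfolding NB B_def p_def by (intro card_triple_preimage_le C fC) (simp_all add: M1_def lc_add)
    next
      case 2
      have "CARD('p) ^ R * card C \<le> card (M2 ` vecs n + C)"
        unfolding M2_def using rk[of i "\<lambda>i. a2 i + a4 i"] i(1) 2 by simp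
      then have "card {(y2, y1, y3). y2 \<in> vecs n \<and> y1 \<in> vecs n \<and> y3 \<in> vecs n \<and> M2 y2 + M1 y1 + M3 y3 + e \<in> C} * p ^ R \<le> p ^ (3 * n)"
        unfolding p_def by (intro card_triple_preimage_le C fC) (simp_all add: M2_def lc_add)
      moreover have "card B = card {(y2, y1, y3). y2 \<in> vecs n \<and> y1 \<in> vecs n \<and> y3 \<in> vecs n \<and> M2 y2 + M1 y1 + M3 y3 + e \<in> C}"
        unfolding B_def
        by (rule bij_betw_same_card[of "\<lambda>(y1, y2, y3). (y2, y1, y3)"],
            rule bij_betw_byWitness[where f' = "\<lambda>(y1, y2, y3). (y2, y1, y3)"]) (auto simp: add_ac)
      ultimately show ?thesis by (simp add: NB)
    next
      case 3
      have "CARD('p) ^ R * card C \<le> card (M3 ` vecs n + C)"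
        unfolding M3_def using rk[of i "\<lambda>i. a3 i - a4 i"] i(1) 3 by simp
      then have "card {(y3, y2, y1). y3 \<in> vecs n \<and> y2 \<in> vecs n \<and> y1 \<in> vecs n \<and> M3 y3 + M2 y2 + M1 y1 + e \<in> C} * p ^ R \<le> p ^ (3 * n)"
        unfolding p_def by (intro card_triple_preimage_le C fC) (simp_all add: M3_def lc_add)
      moreover have "card B = card {(y3, y2, y1). y3 \<in> vecs n \<and> y2 \<in> vecs n \<and> y1 \<in> vecs n \<and> M3 y3 + M2 y2 + M1 y1 + e \<in> C}"
        unfolding B_def
        by (rule bij_betw_same_card[of "\<lambda>(y1, y2, y3). (y3, y2, y1)"],
            rule bij_betw_byWitness[where f' = "\<lambda>(y1, y2, y3). (y3, y2, y1)"]) (auto simp: add_ac)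
      ultimately show ?thesis by (simp add: NB)
    qed
  qed
  have fN: "finite (N j)" for j
    by (rule finite_subset[of _ "vecs n \<times> vecs n \<times> vecs n"]) (auto simp: N_def split: prod.splits)
  define Reps where "Reps = {(x1, x2, x3). x1 \<in> S \<and> x2 \<in> S \<and> x3 \<in> S \<and> x1 + x2 - x3 - w \<in> S}"
  \<comment> \<open>At most \<open>p ^ (8 * k)\<close> coincidences, each satisfied by at most
    \<open>p ^ (3 * n - R)\<close> triples, cannot exhaust \<open>p ^ (3 * n - c)\<close>
    representations when \<open>8 * k + c < R\<close>.\<close>
  have "\<not> Reps \<subseteq> (\<Union>j\<in>J. N j)"
  proof
    assume "Reps \<subseteq> (\<Union>j\<in>J. N j)"
    then have "card Reps \<le> card (\<Union>j\<in>J. N j)" using fJ fN by (intro card_mono) auto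
    also have "\<dots> \<le> (\<Sum>j\<in>J. card (N j))" by (rule card_UN_le[OF fJ])
    finally have "card Reps * p ^ R \<le> (\<Sum>j\<in>J. card (N j)) * p ^ R" by (rule mult_le_mono1)
    also have "\<dots> = (\<Sum>j\<in>J. card (N j) * p ^ R)" by (simp add: sum_distrib_right)
    also have "\<dots> \<le> (\<Sum>j\<in>J. p ^ (3 * n))" by (rule sum_mono) (rule cN)
    also have "\<dots> \<le> p ^ (8 * k) * p ^ (3 * n)" using cJ by simp
    also have "\<dots> \<le> p ^ (8 * k) * (p ^ c * card Reps)"
      using reps unfolding Reps_def p_def by (rule mult_le_mono2)
    finally have "card Reps * p ^ R \<le> card Reps * p ^ (8 * k + c)" by (simp add: power_add mult_ac)
    moreover have "card Reps > 0"
    proof (rule gr0I)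
      assume "card Reps = 0"
      then have "p ^ (3 * n) \<le> 0" using reps unfolding Reps_def p_def by simp
      then show False using p by simp
    qed
    ultimately have "p ^ R \<le> p ^ (8 * k + c)" by simp
    then have "R \<le> 8 * k + c" by (rule power_le_imp_le_exp[rotated]) (use p in simp)
    then show False using R by simp
  qed
  then obtain r where r: "r \<in> Reps" "r \<notin> (\<Union>j\<in>J. N j)" by (meson subsetI)
  obtain y1 y2 y3 where "r = (y1, y2, y3)" by (metis surj_pair)
  with r have y: "(y1, y2, y3) \<in> Reps" and good: "\<And>j. j \<in> J \<Longrightarrow> (y1, y2, y3) \<notin> N j" by simp_all
  define y4 where "y4 = y1 + y2 - y3 - w"
  have yS: "y1 \<in> S" "y2 \<in> S" "y3 \<in> S" "y4 \<in> S" using y by (auto simp: Reps_def y4_def)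
  show ?thesis
  proof (rule that[of y1 y2 y3 y4])
    show "(aspan C k L y1 + aspan C k L y2 + aspan C k L y3 + aspan C k L y4) \<inter>
     (aspan C k L y1' + aspan C k L y2' + aspan C k L y3' + aspan C k L y4') \<subseteq> aspan C k L w"
    proof (rule subsetI, elim IntE)
      fix u assume u1: "u \<in> aspan C k L y1 + aspan C k L y2 + aspan C k L y3 + aspan C k L y4"
        and u2: "u \<in> aspan C k L y1' + aspan C k L y2' + aspan C k L y3' + aspan C k L y4'"
      obtain v1 v2 v3 v4 where v: "v1 \<in> aspan C k L y1" "v2 \<in> aspan C k L y2" "v3 \<in> aspan C k L y3" "v4 \<in> aspan C k L y4"
        "u = v1 + v2 + v3 + v4" using u1 by (auto elim!: set_plus_elim)
      obtain c1 a1 c2 a2 c3 a3 c4 a4 where ca: "c1 \<in> C" "a1 \<in> co" "v1 = c1 + lc a1 y1" "c2 \<in> C" "a2 \<in> co" "v2 = c2 + lc a2 y2"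
        "c3 \<in> C" "a3 \<in> co" "v3 = c3 + lc a3 y3" "c4 \<in> C" "a4 \<in> co" "v4 = c4 + lc a4 y4"
        using asp[OF v(1)] asp[OF v(2)] asp[OF v(3)] asp[OF v(4)] by blast
      obtain v1' v2' v3' v4' where v': "v1' \<in> aspan C k L y1'" "v2' \<in> aspan C k L y2'" "v3' \<in> aspan C k L y3'" "v4' \<in> aspan C k L y4'"
        "u = v1' + v2' + v3' + v4'" using u2 by (auto elim!: set_plus_elim)
      obtain d1 l1 d2 l2 d3 l3 d4 l4 where dl: "d1 \<in> C" "l1 \<in> lspan k (\<lambda>i. L i y1')" "v1' = d1 + l1"
        "d2 \<in> C" "l2 \<in> lspan k (\<lambda>i. L i y2')" "v2' = d2 + l2" "d3 \<in> C" "l3 \<in> lspan k (\<lambda>i. L i y3')" "v3' = d3 + l3"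
        "d4 \<in> C" "l4 \<in> lspan k (\<lambda>i. L i y4')" "v4' = d4 + l4"
        using v'(1-4) unfolding aspan_def by (elim set_plus_elim) blast
      define q where "q = l1 + l2 + l3 + l4"
      have q: "q \<in> Q0" unfolding q_def Q0_def using dl by (intro set_plus_intro)
      have y4: "lc a4 y4 = lc a4 y1 + lc a4 y2 - lc a4 y3 - lc a4 w"
        unfolding y4_def by (simp add: additive.add[OF lc_add] additive.diff[OF lc_add])
      have u3: "u = (c1 + c2 + c3 + c4) + (lc (\<lambda>i. a1 i + a4 i) y1 + lc (\<lambda>i. a2 i + a4 i) y2 + lc (\<lambda>i. a3 i - a4 i) y3 - lc a4 w)"
        unfolding v(5) ca lc_plus lc_minus y4 by (simp add: algebra_simps)
      have u4: "u = (d1 + d2 + d3 + d4) + q" unfolding v'(5) dl q_def by (simp add: algebra_simps)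
      have "lc (\<lambda>i. a1 i + a4 i) y1 + lc (\<lambda>i. a2 i + a4 i) y2 + lc (\<lambda>i. a3 i - a4 i) y3 + (- lc a4 w - q)
          = (d1 + d2 + d3 + d4) - (c1 + c2 + c3 + c4)"
        using u3 unfolding u4 by (simp add: algebra_simps)
      also have "\<dots> \<in> C" by (intro add_subgroup_diff[OF C(1)] add_subgroup_add[OF C(1)] ca dl)
      finally have "(y1, y2, y3) \<in> N (q, a1, a2, a3, a4)"
        unfolding N_def using yS S by auto
      then have "(q, a1, a2, a3, a4) \<notin> J" using good by blast
      \<comment> \<open>With all three combinations zero, nothing of \<open>y1\<close>,
        \<open>y2\<close>, \<open>y3\<close> is left, and \<open>u\<close> reduces to a constant
        minus a combination of the values at \<open>w\<close>.\<close>
      then have z: "\<And>i. i < k \<Longrightarrow> a1 i + a4 i = 0 \<and> a2 i + a4 i = 0 \<and> a3 i - a4 i = 0"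
        using q ca by (auto simp: J_def)
      have "lc (\<lambda>i. a1 i + a4 i) y1 = 0" "lc (\<lambda>i. a2 i + a4 i) y2 = 0" "lc (\<lambda>i. a3 i - a4 i) y3 = 0"
        using z by (simp_all add: lc_def)
      then have "u = (c1 + c2 + c3 + c4) + - lc a4 w" using u3 by simp
      also have "\<dots> \<in> aspan C k L w"
        unfolding aspan_def
      proof (rule set_plus_intro)
        show "c1 + c2 + c3 + c4 \<in> C" by (intro add_subgroup_add[OF C(1)] ca)
        show "- lc a4 w \<in> lspan k (\<lambda>i. L i w)"
          by (rule add_subgroup_uminus[OF add_subgroup_lspan]) (auto simp: lc_def lspan_def)
      qed
      finally show "u \<in> aspan C k L w" .
    qed
  qed (use yS y4_def in auto)
qed

text \<open>Rows of density below \<open>p ^ (- 2 * a)\<close> contain at most a proportion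
  \<open>p ^ (- a)\<close> of the points guaranteed by density, and \<open>p ^ a \<ge> 2\<close>, so
  at least half of that guarantee lies in the remaining rows.\<close>

lemma dense_rows:
  fixes A :: "((nat \<Rightarrow> 'p::prime_card mod_ring) \<times> (nat \<Rightarrow> 'p mod_ring)) set"
  assumes A: "A \<subseteq> vecs n \<times> vecs n" and a: "0 < a" and dense: "CARD('p) ^ (2 * n) \<le> card A * CARD('p) ^ a"
  shows "CARD('p) ^ n \<le> card {y \<in> vecs n. CARD('p) ^ n \<le> card {x. (x, y) \<in> A} * CARD('p) ^ (2 * a)} * CARD('p) ^ (2 * a)"
proof -
  define p where "p = CARD('p)"
  have p: "2 \<le> p" using prime_card[where 'a = 'p] prime_ge_2_nat by (simp add: p_def)
  define X where "X = (vecs n :: (nat \<Rightarrow> 'p mod_ring) set)"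
  have X: "finite X" "card X = p ^ n" by (simp_all add: X_def card_vecs p_def)
  define r where "r y = {x. (x, y) \<in> A}" for y
  have rX: "r y \<subseteq> X" for y using A by (auto simp: r_def X_def)
  have fr: "finite (r y)" for y using rX X(1) finite_subset by blast
  have cr: "card (r y) \<le> p ^ n" for y using card_mono[OF X(1) rX] X(2) by simp
  define S where "S = {y \<in> X. p ^ n \<le> card (r y) * p ^ (2 * a)}"
  have S: "S \<subseteq> X" "finite S" using X by (auto simp: S_def)
  have "card A = card (SIGMA y:X. r y)"
    by (rule bij_betw_same_card[of "\<lambda>(x, y). (y, x)"], rule bij_betw_byWitness[where f' = "\<lambda>(y, x). (x, y)"])
      (use A in \<open>auto simp: r_def X_def\<close>)
  also have "\<dots> = (\<Sum>y\<in>X. card (r y))" using X fr by simp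
  also have "\<dots> = (\<Sum>y\<in>X - S. card (r y)) + (\<Sum>y\<in>S. card (r y))"
    using S X by (intro sum.subset_diff) auto
  finally have cA: "card A = (\<Sum>y\<in>X - S. card (r y)) + (\<Sum>y\<in>S. card (r y))" .
  have "(\<Sum>y\<in>S. card (r y)) \<le> card S * p ^ n"
    using sum_mono[of S "\<lambda>y. card (r y)" "\<lambda>_. p ^ n", OF cr] by simp
  then have big: "card A \<le> (\<Sum>y\<in>X - S. card (r y)) + card S * p ^ n" using cA by linarith
  have "(\<Sum>y\<in>X - S. card (r y)) * p ^ (2 * a) = (\<Sum>y\<in>X - S. card (r y) * p ^ (2 * a))"
    by (simp add: sum_distrib_right)
  also have "\<dots> \<le> (\<Sum>y\<in>X - S. p ^ n)" by (rule sum_mono) (auto simp: S_def)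
  also have "\<dots> \<le> p ^ n * p ^ n" using card_mono[of X "X - S"] X by simp
  finally have small: "(\<Sum>y\<in>X - S. card (r y)) * p ^ (2 * a) \<le> p ^ n * p ^ n" .
  have pa: "2 \<le> p ^ a"
  proof -
    have "p ^ 1 \<le> p ^ a" using a p by (intro power_increasing) auto
    then show ?thesis using p by simp
  qed
  have paa: "p ^ (2 * a) = p ^ a * p ^ a" by (simp add: power_add[symmetric] mult_2)
  have "p ^ n * p ^ n \<le> card A * p ^ a" using dense by (simp add: p_def power_add[symmetric] mult_2)
  then have "p ^ n * p ^ n * p ^ a \<le> card A * p ^ a * p ^ a" by (rule mult_le_mono1)
  also have "\<dots> = card A * p ^ (2 * a)" by (simp add: paa)
  also have "\<dots> \<le> ((\<Sum>y\<in>X - S. card (r y)) + card S * p ^ n) * p ^ (2 * a)" using big by (rule mult_le_mono1)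
  also have "\<dots> = (\<Sum>y\<in>X - S. card (r y)) * p ^ (2 * a) + card S * p ^ n * p ^ (2 * a)"
    by (simp add: algebra_simps)
  also have "\<dots> \<le> p ^ n * p ^ n + card S * p ^ n * p ^ (2 * a)" using small by simp
  finally have 1: "p ^ n * p ^ n * p ^ a \<le> p ^ n * p ^ n + card S * p ^ n * p ^ (2 * a)" .
  have "p ^ n * p ^ n * 2 \<le> p ^ n * p ^ n * p ^ a" using pa by (rule mult_le_mono2)
  then have "p ^ n * p ^ n \<le> card S * p ^ n * p ^ (2 * a)" using 1 by linarith
  then have "p ^ n * p ^ n \<le> p ^ n * (card S * p ^ (2 * a))" by (simp add: mult_ac)
  then have "p ^ n \<le> card S * p ^ (2 * a)" using p by simp
  then show ?thesis by (simp add: S_def X_def r_def p_def)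
qed

text \<open>The forms appear as \<open>dot n (L i y) x\<close> because the argument describes, for
  each row \<open>y\<close>, the vectors that annihilate it; \<open>L i y\<close> is such a vector,
  additive in \<open>y\<close>.\<close>

theorem bilinear_bogolyubov_vecs:
  "\<exists>C::nat. \<forall>n a. \<forall>A :: ((nat \<Rightarrow> 'p::prime_card mod_ring) \<times> (nat \<Rightarrow> 'p mod_ring)) set.
    0 < a \<longrightarrow> A \<subseteq> vecs n \<times> vecs n \<longrightarrow> CARD('p) ^ (2 * n) \<le> card A * CARD('p) ^ a \<longrightarrow>
    (\<exists>V W k L. add_subgroup V \<and> V \<subseteq> vecs n \<and> add_subgroup W \<and> W \<subseteq> vecs n \<and>
      CARD('p) ^ n \<le> card V * CARD('p) ^ (C * a ^ 80) \<and> CARD('p) ^ n \<le> card W * CARD('p) ^ (C * a ^ 80) \<and>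
      k \<le> C * a ^ 80 \<and> (\<forall>i<k. additive (L i) \<and> L i ` vecs n \<subseteq> vecs n) \<and>
      {(x, y). x \<in> V \<and> y \<in> W \<and> (\<forall>i<k. dot n (L i y) x = 0)}
        \<subseteq> hdiff (vdiff (vdiff (hdiff (vdiff (vdiff (vdiff (hdiff (hdiff A)))))))))"
proof -
  define p where "p = CARD('p)"
  have p: "2 \<le> p" using prime_card[where 'a = 'p] prime_ge_2_nat by (simp add: p_def)
  obtain C0 :: nat where C0: "\<And>n a (A :: (nat \<Rightarrow> 'p mod_ring) set). 0 < a \<Longrightarrow> A \<subseteq> vecs n \<Longrightarrow> p ^ n \<le> card A * p ^ a \<Longrightarrow>
    (\<exists>V. add_subgroup V \<and> V \<subseteq> vecs n \<and> p ^ n \<le> card V * p ^ (C0 * a ^ 4) \<and>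
      (\<forall>v\<in>V. p ^ (3 * n) \<le> p ^ (C0 * a) *
        card {(x1, x2, x3). x1 \<in> A \<and> x2 \<in> A \<and> x3 \<in> A \<and> x1 + x2 - x3 - v \<in> A}))"
    using sanders[where 'p = 'p] unfolding p_def by blast
  obtain C1 :: nat where C1: "\<forall>n d S. \<forall>(V :: (nat \<Rightarrow> 'p mod_ring) \<Rightarrow> (nat \<Rightarrow> 'p mod_ring) set).
    0 < d \<longrightarrow> S \<subseteq> vecs n \<longrightarrow> p ^ n \<le> card S * p ^ d \<longrightarrow>
    (\<forall>y\<in>S. add_subgroup (V y) \<and> V y \<subseteq> vecs n \<and> p ^ n \<le> card (V y) * p ^ d) \<longrightarrow>
    (\<exists>S' T. S' \<subseteq> vecs n \<and> p ^ n \<le> card S' * p ^ (C1 * d ^ 5) \<and>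
      (\<forall>i<2 * d. T i \<in> affine_maps n) \<and>
      (\<forall>z\<in>S'. \<exists>y1\<in>S. \<exists>y2\<in>S. \<exists>y3\<in>S. \<exists>y4\<in>S. z = y1 - y2 \<and> z = y3 - y4 \<and>
        perp n (V y1 \<inter> V y2) \<inter> perp n (V y3 \<inter> V y4) \<subseteq> lspan (2 * d) (\<lambda>i. fst (T i) z + snd (T i))))"
    using dense_affine_rows[where 'p = 'p] unfolding p_def[symmetric] by (rule exE)
  \<comment> \<open>The 16 absorbs the rows' density \<open>p ^ (- 2 * a)\<close>, as
    \<open>(2 * a) ^ 4 = 16 * a ^ 4\<close>; the 2 ensures \<open>2 * a \<le> d\<close>, so that one
    parameter bounds both the set of rows and the codimension in each row.\<close>
  define D where "D = (C0 + 2) * 16"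
  define E where "E = (C1 + 1) * D ^ 5"
  \<comment> \<open>The summands pay for the codimension of \<open>W\<close>, for the constants
    \<open>Cc\<close> and the number of forms, and for the constants added by the rank
    reduction.\<close>
  define C where "C = C0 * E ^ 4 + 2 * D + 2 * D * (16 * D + C0 * E + 1)"
  show ?thesis unfolding p_def[symmetric]
  proof (intro exI[of _ C] allI impI)
    fix n a and A :: "((nat \<Rightarrow> 'p mod_ring) \<times> (nat \<Rightarrow> 'p mod_ring)) set"
    assume a: "0 < a" and A: "A \<subseteq> vecs n \<times> vecs n" and dense: "p ^ (2 * n) \<le> card A * p ^ a"
    define d where "d = D * a ^ 4"
    define a' where "a' = E * a ^ 20"
    have a4: "a \<le> a ^ 4" using a by (intro self_le_power) auto
    have d0: "0 < d" using a by (simp add: d_def D_def)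
    have d2: "2 * a \<le> d"
    proof -
      have "2 * a \<le> D * a" by (simp add: D_def)
      also have "\<dots> \<le> d" unfolding d_def using a4 by (rule mult_le_mono2)
      finally show ?thesis .
    qed
    have d3: "C0 * (2 * a) ^ 4 \<le> d" by (simp add: d_def D_def power_mult_distrib)
    have a'0: "0 < a'" using a by (simp add: a'_def E_def D_def)
    have a'd: "C1 * d ^ 5 \<le> a'"
      by (simp add: a'_def E_def d_def power_mult_distrib power_mult[symmetric] algebra_simps)

    define S where "S = {y \<in> vecs n. p ^ n \<le> card {x. (x, y) \<in> A} * p ^ (2 * a)}"
    have S: "S \<subseteq> vecs n" by (auto simp: S_def)
    have cS: "p ^ n \<le> card S * p ^ d"
    proof -
      have "p ^ n \<le> card S * p ^ (2 * a)" unfolding S_def p_def by (rule dense_rows[OF A a]) (use dense in \<open>simp add: p_def\<close>)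
      also have "\<dots> \<le> card S * p ^ d" using d2 p by (intro mult_le_mono2 power_increasing) auto
      finally show ?thesis .
    qed
    define H2 where "H2 = hdiff (hdiff A)"
    have "\<exists>V. add_subgroup V \<and> V \<subseteq> vecs n \<and> p ^ n \<le> card V * p ^ d \<and> (\<forall>v\<in>V. (v, y) \<in> H2)" if y: "y \<in> S" for y
    proof -
      define r where "r = {x. (x, y) \<in> A}"
      have "r \<subseteq> vecs n" using A by (auto simp: r_def)
      moreover have "p ^ n \<le> card r * p ^ (2 * a)" using y by (simp add: S_def r_def)
      ultimately obtain V where V: "add_subgroup V" "V \<subseteq> vecs n" "p ^ n \<le> card V * p ^ (C0 * (2 * a) ^ 4)"
        and reps: "\<And>v. v \<in> V \<Longrightarrow> p ^ (3 * n) \<le> p ^ (C0 * (2 * a)) *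
          card {(x1, x2, x3). x1 \<in> r \<and> x2 \<in> r \<and> x3 \<in> r \<and> x1 + x2 - x3 - v \<in> r}"
        using C0[of "2 * a" r n] a by auto
      have "(v, y) \<in> H2" if v: "v \<in> V" for v
      proof -
        have "card {(x1, x2, x3). x1 \<in> r \<and> x2 \<in> r \<and> x3 \<in> r \<and> x1 + x2 - x3 - v \<in> r} \<noteq> 0"
        proof
          assume "card {(x1, x2, x3). x1 \<in> r \<and> x2 \<in> r \<and> x3 \<in> r \<and> x1 + x2 - x3 - v \<in> r} = 0"
          then have "p ^ (3 * n) \<le> 0" using reps[OF v] by simp
          then show False using p by simp
        qed
        then have "{(x1, x2, x3). x1 \<in> r \<and> x2 \<in> r \<and> x3 \<in> r \<and> x1 + x2 - x3 - v \<in> r} \<noteq> {}"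
          by (metis card.empty)
        then obtain x1 x2 x3 where x: "x1 \<in> r" "x2 \<in> r" "x3 \<in> r" "x1 + x2 - x3 - v \<in> r" by blast
        \<comment> \<open>A combination with two plus and two minus signs is a difference of
          differences, which the two innermost horizontal letters supply.\<close>
        have "((x1 - x3) - ((x1 + x2 - x3 - v) - x2), y) \<in> H2"
          unfolding H2_def using x by (intro hdiffI) (auto simp: r_def)
        then show ?thesis by (simp add: algebra_simps)
      qed
      moreover have "p ^ n \<le> card V * p ^ d"
        using V(3) by (rule order_trans) (use d3 p in \<open>intro mult_le_mono2 power_increasing, auto\<close>)
      ultimately show ?thesis using V by blast
    qed
    then obtain V where V: "\<And>y. y \<in> S \<Longrightarrow> add_subgroup (V y) \<and> V y \<subseteq> vecs n \<and> p ^ n \<le> card (V y) * p ^ d \<and> (\<forall>v\<in>V y. (v, y) \<in> H2)"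
      by metis
    then have V': "\<forall>y\<in>S. add_subgroup (V y) \<and> V y \<subseteq> vecs n \<and> p ^ n \<le> card (V y) * p ^ d" by blast
    obtain S' T where S': "S' \<subseteq> vecs n" "p ^ n \<le> card S' * p ^ (C1 * d ^ 5)"
      and T: "\<forall>i<2 * d. T i \<in> affine_maps n"
      and rows: "\<forall>z\<in>S'. \<exists>y1\<in>S. \<exists>y2\<in>S. \<exists>y3\<in>S. \<exists>y4\<in>S. z = y1 - y2 \<and> z = y3 - y4 \<and>
        perp n (V y1 \<inter> V y2) \<inter> perp n (V y3 \<inter> V y4) \<subseteq> lspan (2 * d) (\<lambda>i. fst (T i) z + snd (T i))"
      using C1[THEN spec, THEN spec, THEN spec, THEN spec, THEN mp, THEN mp, THEN mp, THEN mp, OF d0 S cS V']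
      by (elim exE conjE) (rule that)
    define H4 where "H4 = hdiff (vdiff (vdiff (vdiff H2)))"
    have row4: "(x, z) \<in> H4" if z: "z \<in> S'" and x: "x \<in> perp n (lspan (2 * d) (\<lambda>i. fst (T i) z + snd (T i)))" for x z
    proof -
      obtain y1 y2 y3 y4 where y: "y1 \<in> S" "y2 \<in> S" "y3 \<in> S" "y4 \<in> S" "z = y1 - y2" "z = y3 - y4"
        and sub: "perp n (V y1 \<inter> V y2) \<inter> perp n (V y3 \<inter> V y4) \<subseteq> lspan (2 * d) (\<lambda>i. fst (T i) z + snd (T i))"
        using rows z by blast
      define V12 V34 where "V12 = V y1 \<inter> V y2" and "V34 = V y3 \<inter> V y4"
      have G: "add_subgroup V12" "V12 \<subseteq> vecs n" "add_subgroup V34" "V34 \<subseteq> vecs n"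
        using V y by (auto simp: V12_def V34_def intro: add_subgroup_Int)
      have GS: "add_subgroup (V12 + V34)" "V12 + V34 \<subseteq> vecs n"
        using G by (auto intro: add_subgroup_set_plus set_plus_subset_vecs[THEN subsetD])
      have "perp n (V12 + V34) \<subseteq> lspan (2 * d) (\<lambda>i. fst (T i) z + snd (T i))"
        using sub G by (simp add: perp_set_plus add_subgroup_zero V12_def[symmetric] V34_def[symmetric])
      \<comment> \<open>Passing to the double annihilator converts the conditions on
        \<open>x\<close> into membership in \<open>V12 + V34\<close>. The two summands are then
        reached in the same row through different representations of \<open>z\<close>.\<close>
      then have "x \<in> perp n (perp n (V12 + V34))" using x by (auto simp: perp_def)
      then have "x \<in> V12 + V34" using perp_perp[OF GS] by simp
      then obtain v w where vw: "v \<in> V12" "w \<in> V34" "x = v + w" by (rule set_plus_elim)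
      have "- w \<in> V34" using G vw by (intro add_subgroup_uminus)
      then have in2: "(v, y1) \<in> H2" "(v, y2) \<in> H2" "(- w, y3) \<in> H2" "(- w, y4) \<in> H2"
        using vw y V by (auto simp: V12_def V34_def)
      have "(v, z) \<in> vdiff H2" "(- w, z) \<in> vdiff H2"
        using vdiffI[OF in2(1,2)] vdiffI[OF in2(3,4)] y by auto
      moreover have "vdiff H2 \<subseteq> vdiff (vdiff (vdiff H2))"
        using vdiff_subset_vdiff_vdiff[of H2] vdiff_subset_vdiff_vdiff[of "vdiff H2"] by blast
      ultimately have "(v - - w, z) \<in> H4" unfolding H4_def by (intro hdiffI) auto
      then show ?thesis using vw by simp
    qed

    define Cc where "Cc = lspan (2 * d) (\<lambda>i. snd (T i))"
    \<comment> \<open>As \<open>k \<le> 2 * d\<close>, the first term covers \<open>8 * k\<close>;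
      the second is the loss in the number of representations, and the 1 makes the inequality
      strict.\<close>
    define R where "R = 16 * d + C0 * a' + 1"
    have Ta: "additive (fst (T i)) \<and> fst (T i) ` vecs n \<subseteq> vecs n" "snd (T i) \<in> vecs n" if "i < 2 * d" for i
      using T that by (auto simp: affine_maps_def case_prod_unfold)
    have Cc: "add_subgroup Cc" "Cc \<subseteq> vecs n"
      unfolding Cc_def by (rule add_subgroup_lspan, rule lspan_subset[OF add_subgroup_vecs Ta(2)])
    obtain k L C' where kL: "k \<le> 2 * d" "add_subgroup C'" "C' \<subseteq> vecs n" "Cc \<subseteq> C'" "card C' \<le> card Cc * p ^ (2 * d * R)"
      and L: "\<And>i. i < k \<Longrightarrow> additive (L i) \<and> L i ` vecs n \<subseteq> vecs n"
      and span: "\<And>i z. i < 2 * d \<Longrightarrow> z \<in> vecs n \<Longrightarrow> fst (T i) z \<in> C' + lspan k (\<lambda>j. L j z)"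
      and rank: "\<And>a i. i < k \<Longrightarrow> a i \<noteq> 0 \<Longrightarrow>
       p ^ R * card C' \<le> card ((\<lambda>y. \<Sum>j<k. smul (a j) (L j y)) ` vecs n + C')"
    proof (rule rank_reduction[where L = "\<lambda>i. fst (T i)" and k = "2 * d" and R = R, OF Ta(1) Cc, folded p_def], goal_cases)
      case (2 k L C')
      show ?case by (rule 2(1)[OF 2(2-9)])
    qed
    define P where "P z = aspan C' k L z" for z
    have PG: "add_subgroup (P z)" for z unfolding P_def by (rule add_subgroup_aspan[OF kL(2)])
    have Pv: "P z \<subseteq> vecs n" if "z \<in> vecs n" for z
      unfolding P_def by (rule aspan_subset_vecs) (use kL L that in auto)
    have TP: "lspan (2 * d) (\<lambda>i. fst (T i) z + snd (T i)) \<subseteq> P z" if z: "z \<in> vecs n" for z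
    proof (rule lspan_subset[OF PG])
      fix i assume i: "i < 2 * d"
      have "snd (T i) \<in> C'" using lspan_member[OF i, of "\<lambda>i. snd (T i)"] kL(4) unfolding Cc_def by blast
      then have "snd (T i) + 0 \<in> P z"
        unfolding P_def aspan_def by (intro set_plus_intro add_subgroup_zero[OF add_subgroup_lspan])
      moreover have "fst (T i) z \<in> P z" using span[OF i z] by (simp add: P_def aspan_def)
      ultimately show "fst (T i) z + snd (T i) \<in> P z" by (intro add_subgroup_add[OF PG]) simp_all
    qed
    have rowP: "(x, z) \<in> H4" if "z \<in> S'" "x \<in> perp n (P z)" for x z
      by (rule row4[OF that(1)]) (use that TP[of z] S'(1) in \<open>auto simp: perp_def\<close>)

    have cS': "p ^ n \<le> card S' * p ^ a'"
      using S'(2) by (rule order_trans) (use a'd p in \<open>intro mult_le_mono2 power_increasing, auto\<close>)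
    obtain W where W: "add_subgroup W" "W \<subseteq> vecs n" "p ^ n \<le> card W * p ^ (C0 * a' ^ 4)"
      and reps: "\<And>w. w \<in> W \<Longrightarrow> p ^ (3 * n) \<le> p ^ (C0 * a') *
        card {(x1, x2, x3). x1 \<in> S' \<and> x2 \<in> S' \<and> x3 \<in> S' \<and> x1 + x2 - x3 - w \<in> S'}"
      using C0[OF a'0 S'(1) cS'] by blast
    define H7 where "H7 = hdiff (vdiff (vdiff H4))"
    have row7: "(x, w) \<in> H7" if w: "w \<in> W" and x: "x \<in> perp n (P w)" for x w
    proof -
      have wv: "w \<in> vecs n" using w W by blast
      have "card {(x1, x2, x3). x1 \<in> S' \<and> x2 \<in> S' \<and> x3 \<in> S' \<and> x1 + x2 - x3 - w \<in> S'} \<noteq> 0"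
      proof
        assume "card {(x1, x2, x3). x1 \<in> S' \<and> x2 \<in> S' \<and> x3 \<in> S' \<and> x1 + x2 - x3 - w \<in> S'} = 0"
        then have "p ^ (3 * n) \<le> 0" using reps[OF w] by simp
        then show False using p by simp
      qed
      then have "{(x1, x2, x3). x1 \<in> S' \<and> x2 \<in> S' \<and> x3 \<in> S' \<and> x1 + x2 - x3 - w \<in> S'} \<noteq> {}"
        by (metis card.empty)
      then obtain y1' y2' y3' where y'3: "y1' \<in> S'" "y2' \<in> S'" "y3' \<in> S'" "y1' + y2' - y3' - w \<in> S'" by blast
      define y4' where "y4' = y1' + y2' - y3' - w"
      have y': "y1' \<in> S'" "y2' \<in> S'" "y3' \<in> S'" "y4' \<in> S'" using y'3 by (auto simp: y4'_def)
      have RR: "8 * k + C0 * a' < R" using kL(1) by (simp add: R_def)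
      obtain y1 y2 y3 y4 where y: "y1 \<in> S'" "y2 \<in> S'" "y3 \<in> S'" "y4 \<in> S'" "y4 = y1 + y2 - y3 - w"
        and meet: "(P y1 + P y2 + P y3 + P y4) \<inter> (P y1' + P y2' + P y3' + P y4') \<subseteq> P w"
        unfolding P_def
        by (rule ex_generic_representation[of k L n C' R S' w "C0 * a'" y1' y2' y3' y4', folded p_def])
          (use L kL(2,3) rank S'(1) wv reps[OF w] RR y' in auto)
      \<comment> \<open>Two nested vertical differences combine four rows of \<open>S'\<close> into
        the row \<open>w\<close>, on those \<open>u\<close> that annihilate all four spaces.\<close>
      have vanish: "(u, w) \<in> vdiff (vdiff H4)"
        if z: "z1 \<in> S'" "z2 \<in> S'" "z3 \<in> S'" "z4 \<in> S'" "z4 = z1 + z2 - z3 - w"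
          and u: "u \<in> perp n (P z1 + P z2 + P z3 + P z4)" for u z1 z2 z3 z4
      proof -
        have "u \<in> perp n (P z1)" "u \<in> perp n (P z2)" "u \<in> perp n (P z3)" "u \<in> perp n (P z4)"
          using u by (simp_all add: perp_set_plus add_subgroup_zero add_subgroup_set_plus PG)
        then have "(u, z1) \<in> H4" "(u, z2) \<in> H4" "(u, z3) \<in> H4" "(u, z4) \<in> H4" using z rowP by auto
        then have "(u, (z1 - z3) - (z4 - z2)) \<in> vdiff (vdiff H4)" by (intro vdiffI)
        moreover have "(z1 - z3) - (z4 - z2) = w" unfolding z(5) by (simp add: algebra_simps)
        ultimately show ?thesis by simp
      qed
      define Q Q' where "Q = P y1 + P y2 + P y3 + P y4" and "Q' = P y1' + P y2' + P y3' + P y4'"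
      have Q: "add_subgroup Q" "add_subgroup Q'" unfolding Q_def Q'_def by (intro add_subgroup_set_plus PG)+
      have Qv: "Q \<subseteq> vecs n" "Q' \<subseteq> vecs n"
        unfolding Q_def Q'_def by (intro set_plus_subset_vecs Pv; use y y' S'(1) in blast)+
      \<comment> \<open>The generic choice gives \<open>Q \<inter> Q' \<subseteq> P w\<close>.
        Dually, whatever annihilates \<open>P w\<close> splits into a part annihilating
        \<open>Q\<close> and one annihilating \<open>Q'\<close>, and the outermost horizontal
        difference joins these.\<close>
      have "x \<in> perp n (Q \<inter> Q')" using x meet unfolding Q_def[symmetric] Q'_def[symmetric] by (auto simp: perp_def)
      also have "perp n (Q \<inter> Q') = perp n Q + perp n Q'" using Q Qv by (intro perp_Int)
      finally obtain u v where uv: "u \<in> perp n Q" "v \<in> perp n Q'" "x = u + v" by (rule set_plus_elim)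
      have v: "- v \<in> perp n Q'" using uv(2) by (rule add_subgroup_uminus[OF add_subgroup_perp])
      have "(u - - v, w) \<in> H7"
        unfolding H7_def
        by (intro hdiffI vanish[OF y(1-5)] vanish[OF y' y4'_def]) (use uv v in \<open>auto simp: Q_def Q'_def\<close>)
      then show ?thesis using uv by simp
    qed

    \<comment> \<open>Restricting \<open>x\<close> to the annihilator of \<open>C'\<close> disposes
      of the constants, so that only the \<open>k\<close> bilinear conditions remain.\<close>
    define V0 where "V0 = perp n C'"
    have "p ^ n \<le> card V0 * p ^ (2 * d + 2 * d * R)"
    proof -
      have "card Cc \<le> p ^ (2 * d)" unfolding Cc_def p_def by (rule card_lspan_le)
      then have "card Cc * p ^ (2 * d * R) \<le> p ^ (2 * d) * p ^ (2 * d * R)" by (rule mult_le_mono1)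
      with kL(5) have "card C' \<le> p ^ (2 * d + 2 * d * R)" unfolding power_add by (rule order_trans)
      then have "card C' * card V0 \<le> p ^ (2 * d + 2 * d * R) * card V0" by (rule mult_le_mono1)
      then show ?thesis using card_perp[OF kL(2,3)] by (simp add: V0_def p_def mult.commute)
    qed
    also have "\<dots> \<le> card V0 * p ^ (C * a ^ 80)"
    proof (intro mult_le_mono2 power_increasing)
      have pw: "a ^ i \<le> a ^ j" if "i \<le> j" for i j using that a by (intro power_increasing) auto
      \<comment> \<open>The product of \<open>d = O(a ^ 4)\<close> and \<open>R = O(a ^ 20)\<close>
        is \<open>O(a ^ 24)\<close>.\<close>
      have dR: "d * R \<le> D * (16 * D + C0 * E + 1) * a ^ 80"
      proof -
        have "R = 16 * (D * a ^ 4) + C0 * (E * a ^ 20) + 1" by (simp add: R_def d_def a'_def)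
        also have "\<dots> \<le> 16 * (D * a ^ 20) + C0 * (E * a ^ 20) + a ^ 20"
          by (intro add_mono mult_le_mono2 pw) (use a in auto)
        also have "\<dots> = (16 * D + C0 * E + 1) * a ^ 20" by (simp only: distrib_right mult.assoc mult_1)
        finally have "R \<le> (16 * D + C0 * E + 1) * a ^ 20" .
        moreover have a24: "a ^ 24 = a ^ 4 * a ^ 20" by (simp flip: power_add)
        ultimately have "d * R \<le> D * a ^ 4 * ((16 * D + C0 * E + 1) * a ^ 20)"
          unfolding d_def by (intro mult_le_mono2)
        also have "\<dots> = D * (16 * D + C0 * E + 1) * a ^ 24"
          by (simp only: a24 mult_ac)
        also have "\<dots> \<le> D * (16 * D + C0 * E + 1) * a ^ 80" by (intro mult_le_mono2 pw) simp
        finally show ?thesis .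
      qed
      have "d \<le> D * a ^ 80" unfolding d_def by (intro mult_le_mono2 pw) simp
      then have "2 * d + 2 * (d * R) \<le> 2 * (D * a ^ 80) + 2 * (D * (16 * D + C0 * E + 1) * a ^ 80)"
        using dR by (intro add_mono mult_le_mono2)
      also have "\<dots> \<le> C * a ^ 80" by (simp add: C_def algebra_simps)
      finally show "2 * d + 2 * d * R \<le> C * a ^ 80" by (simp add: mult.assoc)
    qed (use p in simp)
    finally have cV0: "p ^ n \<le> card V0 * p ^ (C * a ^ 80)" .
    have cW: "p ^ n \<le> card W * p ^ (C * a ^ 80)"
    proof -
      have "C0 * a' ^ 4 \<le> C * a ^ 80"
        by (simp add: a'_def C_def power_mult_distrib power_mult[symmetric] algebra_simps)
      then have "card W * p ^ (C0 * a' ^ 4) \<le> card W * p ^ (C * a ^ 80)"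
        using p by (intro mult_le_mono2 power_increasing) auto
      then show ?thesis using W(3) by linarith
    qed
    have kC: "k \<le> C * a ^ 80"
    proof -
      have "a ^ 4 \<le> a ^ 80" using a by (intro power_increasing) auto
      then have "2 * (D * a ^ 4) \<le> 2 * (D * a ^ 80)" by (intro mult_le_mono2)
      also have "\<dots> \<le> C * a ^ 80" by (simp add: C_def algebra_simps)
      finally show ?thesis using kL(1) by (simp add: d_def)
    qed
    have sub: "{(x, y). x \<in> V0 \<and> y \<in> W \<and> (\<forall>i<k. dot n (L i y) x = 0)} \<subseteq> H7"
    proof clarify
      fix x y assume xy: "x \<in> V0" "y \<in> W" "\<forall>i<k. dot n (L i y) x = 0"
      have "lspan k (\<lambda>i. L i y) \<subseteq> {u. dot n u x = 0}"
        by (rule lspan_subset) (use xy in \<open>auto simp: add_subgroup_def dot_diff_left\<close>)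
      then have "x \<in> perp n (lspan k (\<lambda>i. L i y))" using xy(1) by (auto simp: perp_def V0_def)
      then have "x \<in> perp n (P y)"
        using xy(1) by (simp add: P_def aspan_def perp_set_plus V0_def add_subgroup_zero kL(2) add_subgroup_lspan)
      then show "(x, y) \<in> H7" by (rule row7[OF xy(2)])
    qed
    show "\<exists>V W k L. add_subgroup V \<and> V \<subseteq> vecs n \<and> add_subgroup W \<and> W \<subseteq> vecs n \<and>
      p ^ n \<le> card V * p ^ (C * a ^ 80) \<and> p ^ n \<le> card W * p ^ (C * a ^ 80) \<and>
      k \<le> C * a ^ 80 \<and> (\<forall>i<k. additive (L i) \<and> L i ` vecs n \<subseteq> vecs n) \<and>
      {(x, y). x \<in> V \<and> y \<in> W \<and> (\<forall>i<k. dot n (L i y) x = 0)}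
        \<subseteq> hdiff (vdiff (vdiff (hdiff (vdiff (vdiff (vdiff (hdiff (hdiff A))))))))"
    proof (rule exI[of _ V0], rule exI[of _ W], rule exI[of _ k], rule exI[of _ L], intro conjI)
      show "add_subgroup V0" "V0 \<subseteq> vecs n" unfolding V0_def by (rule add_subgroup_perp perp_subset_vecs)+
      show "\<forall>i<k. additive (L i) \<and> L i ` vecs n \<subseteq> vecs n" using L by simp
    qed (fact W(1,2) cV0 cW kC sub[unfolded H7_def H4_def H2_def])+
  qed
qed

subsection \<open>Transfer to vectors\<close>

text \<open>Coordinates with respect to a basis. Codimensions have been measured by cardinality so
  far, and this converts them into \<open>dim\<close>.\<close>

lemma card_vectorspace_eq_power_dim:
  fixes K :: "('a::finite, 'm) ring_scheme"
  assumes vs: "vectorspace K M" and K: "carrier K = UNIV" and finM: "finite (carrier M)"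
  shows "card (carrier M) = CARD('a) ^ vectorspace.dim K M"
proof -
  interpret vectorspace K M by (rule vs)
  have "span (carrier M) = carrier M"
    using in_own_span[of "carrier M"] span_is_subset2[of "carrier M"] by auto
  then have "fin_dim" unfolding fin_dim_def using finM by (intro exI[of _ "carrier M"]) auto
  then obtain \<beta> where \<beta>: "finite \<beta>" "basis \<beta>" using finite_basis_exists by blast
  have \<beta>c: "\<beta> \<subseteq> carrier M" using \<beta>(2) by (simp add: basis_def)
  have uniq: "\<forall>v. v \<in> carrier M \<longrightarrow> (\<exists>!a. a \<in> \<beta> \<rightarrow>\<^sub>E carrier K \<and> lincomb a \<beta> = v)"
    using basis_criterion[OF \<beta>(1) \<beta>c] \<beta>(2) by blast
  have closed: "lincomb a \<beta> \<in> carrier M" if "a \<in> \<beta> \<rightarrow>\<^sub>E carrier K" for a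
    using that \<beta>c by (intro lincomb_closed) auto
  have "bij_betw (\<lambda>a. lincomb a \<beta>) (\<beta> \<rightarrow>\<^sub>E carrier K) (carrier M)"
    unfolding bij_betw_def
  proof (intro conjI equalityI subsetI inj_onI)
    fix a b assume "a \<in> \<beta> \<rightarrow>\<^sub>E carrier K" "b \<in> \<beta> \<rightarrow>\<^sub>E carrier K" "lincomb a \<beta> = lincomb b \<beta>"
    then show "a = b" using uniq closed by metis
  next
    fix v assume "v \<in> (\<lambda>a. lincomb a \<beta>) ` (\<beta> \<rightarrow>\<^sub>E carrier K)"
    then show "v \<in> carrier M" using closed by auto
  next
    fix v assume "v \<in> carrier M"
    then show "v \<in> (\<lambda>a. lincomb a \<beta>) ` (\<beta> \<rightarrow>\<^sub>E carrier K)" using uniq by (metis image_eqI)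
  qed
  then have "card (\<beta> \<rightarrow>\<^sub>E carrier K) = card (carrier M)" by (rule bij_betw_same_card)
  then show ?thesis using \<beta> by (simp add: card_PiE K dim_basis)
qed

definition to_fun :: "'a::zero vec \<Rightarrow> nat \<Rightarrow> 'a" where
  "to_fun v = (\<lambda>i. if i < dim_vec v then v $ i else 0)"

lemma to_fun_in_vecs: "v \<in> carrier_vec n \<Longrightarrow> to_fun v \<in> vecs n"
  by (auto simp: to_fun_def vecs_def)

lemma vec_to_fun: "v \<in> carrier_vec n \<Longrightarrow> vec n (to_fun v) = v"
  by (auto simp: to_fun_def)

lemma to_fun_vec: "x \<in> vecs n \<Longrightarrow> to_fun (vec n x) = x"
  by (auto simp: to_fun_def vecs_def fun_eq_iff not_less)

lemma vec_diff: "vec n (x - y) = vec n x - vec n (y :: nat \<Rightarrow> 'a::ab_group_add)"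
  by auto

lemma vec_add: "vec n (x + y) = vec n x + vec n (y :: nat \<Rightarrow> 'a::ab_group_add)"
  by auto

lemma to_fun_add: "u \<in> carrier_vec n \<Longrightarrow> v \<in> carrier_vec n \<Longrightarrow> to_fun (u + v) = to_fun u + to_fun (v :: 'a::ab_group_add vec)"
  by (auto simp: to_fun_def fun_eq_iff)

lemma to_fun_smult: "to_fun (c \<cdot>\<^sub>v v) = smul c (to_fun (v :: 'a::ring vec))"
  by (auto simp: to_fun_def fun_eq_iff)

lemma inj_on_vec: "inj_on (vec n) (vecs n :: (nat \<Rightarrow> 'a::zero) set)"
  by (rule inj_on_inverseI[of _ to_fun]) (rule to_fun_vec)

text \<open>A scalar of a prime field is a multiple of 1, so additivity alone gives homogeneity, as
  bilinear forms require.\<close>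

lemma additive_smul:
  fixes L :: "(nat \<Rightarrow> 'p::prime_card mod_ring) \<Rightarrow> nat \<Rightarrow> 'p mod_ring"
  assumes "additive L"
  shows "L (smul c x) = smul c (L x)"
proof -
  obtain k where k: "c = of_nat k" using mod_ring_eq_of_nat by blast
  have "L (\<Sum>i<k. x) = (\<Sum>i<k. L x)" by (rule additive.sum[OF assms])
  then show ?thesis unfolding k smul_of_nat .
qed

text \<open>The size of \<open>V\<close> is \<open>p ^ k\<close> with \<open>k\<close> its
  dimension; comparing exponents gives \<open>k \<le> n\<close> and \<open>n \<le> k + R\<close>, so
  \<open>n - k\<close> is a genuine difference bounded by \<open>R\<close>.\<close>

lemma subspace_of_codim_vec_image:
  fixes V :: "(nat \<Rightarrow> 'p::prime_card mod_ring) set"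
  assumes V: "add_subgroup V" "V \<subseteq> vecs n" and R: "CARD('p) ^ n \<le> card V * CARD('p) ^ R"
  obtains r where "r \<le> R" "subspace_of_codim n r (vec n ` V)"
proof -
  have p: "1 < CARD('p)" using prime_card[where 'a = 'p] prime_gt_1_nat by blast
  define U where "U = vec n ` V"
  have fV: "finite V" using V(2) by (rule finite_subset) simp
  have cU: "card U = card V" unfolding U_def by (rule card_image) (use inj_on_vec V(2) in \<open>rule inj_on_subset\<close>)
  have sub: "VectorSpace.subspace class_ring U (module_vec TYPE('p mod_ring) n)"
  proof (rule subspace.intro)
    show vs: "vectorspace class_ring (module_vec TYPE('p mod_ring) n)" by (rule vec_vs)
    show "submodule class_ring U (module_vec TYPE('p mod_ring) n)"
    proof (rule submodule.intro)
      show "Module.module class_ring (module_vec TYPE('p mod_ring) n)" by (rule vec_module)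
      show "U \<subseteq> carrier (module_vec TYPE('p mod_ring) n)" by (auto simp: U_def module_vec_simps)
      show "v \<oplus>\<^bsub>module_vec TYPE('p mod_ring) n\<^esub> w \<in> U" if "v \<in> U" "w \<in> U" for v w
        using that add_subgroup_add[OF V(1)] by (auto simp: U_def module_vec_simps vec_add[symmetric])
      show "\<zero>\<^bsub>module_vec TYPE('p mod_ring) n\<^esub> \<in> U"
        unfolding U_def by (rule image_eqI[of _ _ 0]) (auto simp: module_vec_simps add_subgroup_zero[OF V(1)])
      show "c \<odot>\<^bsub>module_vec TYPE('p mod_ring) n\<^esub> v \<in> U" if c: "c \<in> carrier class_ring" and v: "v \<in> U" for c v
      proof -
        obtain x where x: "x \<in> V" "v = vec n x" using v by (auto simp: U_def)
        have "c \<cdot>\<^sub>v v = vec n (smul c x)" by (auto simp: x)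
        then show ?thesis using add_subgroup_smul[OF V(1) x(1), of c] by (auto simp: U_def module_vec_simps)
      qed
    qed
  qed
  have vsU: "vectorspace class_ring ((module_vec TYPE('p mod_ring) n)\<lparr>carrier := U\<rparr>)"
    using vectorspace.subspace_is_vs[OF vec_vs sub] .
  define k where "k = vectorspace.dim class_ring ((module_vec TYPE('p mod_ring) n)\<lparr>carrier := U\<rparr>)"
  have "finite U" using fV by (simp add: U_def)
  then have "card U = CARD('p mod_ring) ^ k"
    using card_vectorspace_eq_power_dim[OF vsU] by (simp add: k_def class_ring_simps)
  then have cV: "card V = CARD('p) ^ k" using cU by simp
  have "card V \<le> CARD('p) ^ n" using card_mono[OF _ V(2)] by (simp add: card_vecs)
  then have "k \<le> n" unfolding cV by (rule power_le_imp_le_exp[OF p])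
  moreover have "CARD('p) ^ n \<le> CARD('p) ^ (k + R)" using R unfolding cV by (simp add: power_add)
  then have "n \<le> k + R" by (rule power_le_imp_le_exp[OF p])
  ultimately show ?thesis
    using that[of "n - k"] sub unfolding subspace_of_codim_def k_def[symmetric] U_def[symmetric] by simp
qed

definition vimg :: "nat \<Rightarrow> ((nat \<Rightarrow> 'a) \<times> (nat \<Rightarrow> 'a)) set \<Rightarrow> ('a vec \<times> 'a vec) set" where
  "vimg n B = (\<lambda>(x, y). (vec n x, vec n y)) ` B"

lemma vimg_hdiff: "vimg n B \<subseteq> A \<Longrightarrow> vimg n (hdiff B) \<subseteq> phi_h A"
  by (fastforce simp: vimg_def hdiff_def phi_h_def vec_diff)

lemma vimg_vdiff: "vimg n B \<subseteq> A \<Longrightarrow> vimg n (vdiff B) \<subseteq> phi_v A"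
  by (fastforce simp: vimg_def vdiff_def phi_v_def vec_diff)

lemma vimg_word:
  "vimg n (hdiff (vdiff (vdiff (hdiff (vdiff (vdiff (vdiff (hdiff (hdiff B)))))))))
    \<subseteq> phi_word [Hor, Ver, Ver, Hor, Ver, Ver, Ver, Hor, Hor] (vimg n B)"
  by (simp, intro vimg_hdiff vimg_vdiff order_refl)

text \<open>A set larger than half of the space meets each of its translates.\<close>

lemma differences_of_large_set:
  fixes S :: "(nat \<Rightarrow> 'a::{finite, ab_group_add}) set"
  assumes S: "S \<subseteq> vecs n" "card (vecs n :: (nat \<Rightarrow> 'a) set) < 2 * card S" and y: "y \<in> vecs n"
  obtains y1 y2 where "y1 \<in> S" "y2 \<in> S" "y = y1 - y2"
proof -
  define S2 where "S2 = (\<lambda>s. s + y) ` S"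
  have f: "finite S" using S(1) by (rule finite_subset) simp
  have "S2 \<subseteq> vecs n" using S(1) y by (auto simp: S2_def intro: add_subgroup_add[OF add_subgroup_vecs])
  then have "card (S \<union> S2) \<le> card (vecs n :: (nat \<Rightarrow> 'a) set)" using S(1) by (intro card_mono) auto
  moreover have "card S2 = card S" by (simp add: S2_def card_image inj_on_def)
  moreover have "card (S \<union> S2) = card S + card S2" if "S \<inter> S2 = {}"
    using that f by (intro card_Un_disjoint) (auto simp: S2_def)
  ultimately have "S \<inter> S2 \<noteq> {}" using S(2) by auto
  then obtain y1 y2 where y12: "y1 \<in> S" "y2 \<in> S" "y1 = y2 + y" by (auto simp: S2_def)
  then have "y = y1 - y2" by simp
  with y12(1,2) show ?thesis by (rule that)
qed

text \<open>
  As \<open>ln (1 / density n A)\<close> tends to \<open>0\<close> when the density tends to \<open>1\<close>, the theorem requires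
  codimension \<open>0\<close> there.
\<close>

lemma word_of_very_dense_set:
  fixes A :: "((nat \<Rightarrow> 'a::{finite, ab_group_add}) \<times> (nat \<Rightarrow> 'a)) set"
  assumes A: "A \<subseteq> vecs n \<times> vecs n" and dense: "7 * card (vecs n :: (nat \<Rightarrow> 'a) set) ^ 2 \<le> 8 * card A"
  shows "vecs n \<times> vecs n \<subseteq> hdiff (vdiff (vdiff (hdiff (vdiff (vdiff (vdiff (hdiff (hdiff A))))))))"
proof -
  define X where "X = (vecs n :: (nat \<Rightarrow> 'a) set)"
  define N where "N = card X"
  have fX: "finite X" by (simp add: X_def)
  have XG: "add_subgroup X" by (simp add: X_def add_subgroup_vecs)
  have N: "N > 0" by (simp add: N_def X_def card_gt_0_iff)
  define r where "r y = {x. (x, y) \<in> A}" for y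
  have rX: "r y \<subseteq> X" for y using A by (auto simp: r_def X_def)
  have fr: "finite (r y)" for y using rX fX finite_subset by blast
  \<comment> \<open>Rows that are more than half full: one horizontal difference fills them
    completely. The density \<open>7 / 8\<close> puts at least three quarters of all rows into
    \<open>S\<close>, so one vertical difference then reaches every row.\<close>
  define S where "S = {y \<in> X. N < 2 * card (r y)}"
  have S: "S \<subseteq> X" "finite S" using fX by (auto simp: S_def)
  have "2 * card A = 2 * (\<Sum>y\<in>X. card (r y))"
  proof -
    have "card A = card (SIGMA y:X. r y)"
      by (rule bij_betw_same_card[of "\<lambda>(x, y). (y, x)"], rule bij_betw_byWitness[where f' = "\<lambda>(y, x). (x, y)"])
        (use A in \<open>auto simp: r_def X_def\<close>)
    then show ?thesis using fX fr by simp
  qed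
  also have "\<dots> = (\<Sum>y\<in>X. 2 * card (r y))" by (simp add: sum_distrib_left)
  also have "\<dots> \<le> (\<Sum>y\<in>X. N + (if y \<in> S then N else 0))"
  proof (rule sum_mono)
    fix y assume y: "y \<in> X"
    have "card (r y) \<le> N" unfolding N_def by (rule card_mono[OF fX rX])
    then show "2 * card (r y) \<le> N + (if y \<in> S then N else 0)" using y by (auto simp: S_def)
  qed
  also have "\<dots> = N * N + card S * N"
  proof -
    have "(\<Sum>y\<in>X. if y \<in> S then N else 0) = card S * N"
      using S fX by (simp add: sum.If_cases Int_absorb1)
    then show ?thesis by (simp add: sum.distrib N_def)
  qed
  finally have "2 * card A \<le> N * N + card S * N" .
  moreover have "7 * (N * N) \<le> 8 * card A" using dense unfolding N_def X_def power2_eq_square .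
  ultimately have "3 * (N * N) \<le> 4 * (card S * N)" by linarith
  then have "N * (3 * N) \<le> N * (4 * card S)" by (simp only: mult_ac)
  then have "3 * N \<le> 4 * card S" using N by simp
  then have cS: "N < 2 * card S" using N by linarith
  \<comment> \<open>Once rows are full, subtracting a zero vector carries them through the remaining
    letters.\<close>
  have full_h: "X \<times> Y \<subseteq> hdiff B" if "X \<times> Y \<subseteq> B" for B Y
  proof
    fix q assume "q \<in> X \<times> Y"
    then obtain x y where q: "q = (x, y)" "x \<in> X" "y \<in> Y" by blast
    have "(x - 0, y) \<in> hdiff B" using q that add_subgroup_zero[OF XG] by (intro hdiffI) auto
    then show "q \<in> hdiff B" by (simp add: q)
  qed
  have full_v: "X \<times> X \<subseteq> vdiff B" if "X \<times> X \<subseteq> B" for B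
  proof
    fix q assume "q \<in> X \<times> X"
    then obtain x y where q: "q = (x, y)" "x \<in> X" "y \<in> X" by blast
    have "(x, y - 0) \<in> vdiff B" using q that add_subgroup_zero[OF XG] by (intro vdiffI) auto
    then show "q \<in> vdiff B" by (simp add: q)
  qed
  have "X \<times> S \<subseteq> hdiff A"
  proof
    fix q assume "q \<in> X \<times> S"
    then obtain x y where q: "q = (x, y)" "x \<in> X" "y \<in> S" by blast
    obtain x1 x2 where "x1 \<in> r y" "x2 \<in> r y" "x = x1 - x2"
      using differences_of_large_set[of "r y" n x] rX q by (auto simp: S_def N_def X_def)
    then show "q \<in> hdiff A" using hdiffI[of x1 y A x2] by (simp add: q r_def)
  qed
  then have h: "X \<times> S \<subseteq> hdiff (hdiff A)" by (rule full_h)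
  have "X \<times> X \<subseteq> vdiff (hdiff (hdiff A))"
  proof
    fix q assume "q \<in> X \<times> X"
    then obtain x y where q: "q = (x, y)" "x \<in> X" "y \<in> X" by blast
    obtain y1 y2 where "y1 \<in> S" "y2 \<in> S" "y = y1 - y2"
      using differences_of_large_set[of S n y] S cS q by (auto simp: N_def X_def)
    then show "q \<in> vdiff (hdiff (hdiff A))" using h q vdiffI[of x y1 "hdiff (hdiff A)" y2] by auto
  qed
  then show ?thesis unfolding X_def[symmetric] by (rule full_h[OF full_v[OF full_v[OF full_h[OF full_v[OF full_v]]]]])
qed

theorem theorem1p3:
  shows "\<exists>C :: real. \<forall>n. \<forall>A :: ('p :: prime_card mod_ring vec \<times> 'p mod_ring vec) set.
    A \<subseteq> carrier_vec n \<times> carrier_vec n \<longrightarrow> A \<noteq> {} \<longrightarrow>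
    (\<exists>r B. bilinear_variety n r B \<and> B \<subseteq> phi_word [Hor, Ver, Ver, Hor, Ver, Ver, Ver, Hor, Hor] A \<and>
       real r \<le> C * ln (1 / density n A) ^ 80)"
proof -
  define p where "p = CARD('p)"
  have p: "2 \<le> p" using prime_card[where 'a = 'p] prime_ge_2_nat by (simp add: p_def)
  obtain C0 :: nat where C0: "\<forall>n a. \<forall>(A :: ((nat \<Rightarrow> 'p mod_ring) \<times> (nat \<Rightarrow> 'p mod_ring)) set).
    0 < a \<longrightarrow> A \<subseteq> vecs n \<times> vecs n \<longrightarrow> p ^ (2 * n) \<le> card A * p ^ a \<longrightarrow>
    (\<exists>V W k L. add_subgroup V \<and> V \<subseteq> vecs n \<and> add_subgroup W \<and> W \<subseteq> vecs n \<and>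
      p ^ n \<le> card V * p ^ (C0 * a ^ 80) \<and> p ^ n \<le> card W * p ^ (C0 * a ^ 80) \<and>
      k \<le> C0 * a ^ 80 \<and> (\<forall>i<k. additive (L i) \<and> L i ` vecs n \<subseteq> vecs n) \<and>
      {(x, y). x \<in> V \<and> y \<in> W \<and> (\<forall>i<k. dot n (L i y) x = 0)}
        \<subseteq> hdiff (vdiff (vdiff (hdiff (vdiff (vdiff (vdiff (hdiff (hdiff A)))))))))"
    using bilinear_bogolyubov_vecs[where 'p = 'p] unfolding p_def[symmetric] by (rule exE)
  \<comment> \<open>Rounding the logarithm up adds at most 1, which is at most
    \<open>l / ln (8 / 7)\<close> when the density is below \<open>7 / 8\<close>.\<close>
  define c where "c = 1 / ln 2 + 1 / ln (8 / 7 :: real)"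
  \<comment> \<open>The 3 counts the codimensions of the two subspaces and the number of
    forms.\<close>
  define C where "C = 3 * real C0 * c ^ 80"
  have c0: "c \<ge> 0" by (simp add: c_def)
  have Cpos: "C \<ge> 0" using c0 by (simp add: C_def)
  show ?thesis
  proof (intro exI[of _ C] allI impI)
    fix n and A :: "('p mod_ring vec \<times> 'p mod_ring vec) set"
    assume A: "A \<subseteq> carrier_vec n \<times> carrier_vec n" and ne: "A \<noteq> {}"
    define B where "B = map_prod to_fun to_fun ` A"
    have B: "B \<subseteq> vecs n \<times> vecs n" using A by (auto simp: B_def to_fun_in_vecs)
    have BA: "vimg n B = A"
    proof -
      have "vimg n B = (\<lambda>q. q) ` A"
        unfolding vimg_def B_def image_image by (rule image_cong) (use A in \<open>auto simp: vec_to_fun\<close>)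
      then show ?thesis by simp
    qed
    have fB: "finite B" by (rule finite_subset[OF B]) simp
    have cB: "card B = card A"
      unfolding B_def
      by (rule card_image, rule inj_on_inverseI[of _ "\<lambda>(x, y). (vec n x, vec n y)"]) (use A in \<open>auto simp: vec_to_fun\<close>)
    have "B \<noteq> {}" using ne by (simp add: B_def)
    then have cA: "card A > 0" using fB cB by (metis card_gt_0_iff)
    have word: "vimg n (hdiff (vdiff (vdiff (hdiff (vdiff (vdiff (vdiff (hdiff (hdiff B)))))))))
        \<subseteq> phi_word [Hor, Ver, Ver, Hor, Ver, Ver, Ver, Hor, Hor] A"
      using vimg_word[of n B] unfolding BA .
    define l where "l = ln (1 / density n A)"
    have dens: "density n A = card A / p ^ (2 * n)" by (simp add: density_def p_def)
    have d0: "density n A > 0" using cA p by (simp add: dens)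
    show "\<exists>r B. bilinear_variety n r B \<and> B \<subseteq> phi_word [Hor, Ver, Ver, Hor, Ver, Ver, Ver, Hor, Hor] A \<and>
       real r \<le> C * ln (1 / density n A) ^ 80"
    proof (cases "7 / 8 \<le> density n A")
      case True
      then have "7 * real (p ^ (2 * n)) \<le> 8 * real (card A)" using p by (simp add: dens field_simps)
      then have "real (7 * p ^ (2 * n)) \<le> real (8 * card A)" by simp
      then have "7 * p ^ (2 * n) \<le> 8 * card A" unfolding of_nat_le_iff .
      then have "7 * card (vecs n :: (nat \<Rightarrow> 'p mod_ring) set) ^ 2 \<le> 8 * card B"
        by (simp add: cB card_vecs p_def power_mult[symmetric] mult.commute)
      from word_of_very_dense_set[OF B this]
      have "vimg n (vecs n \<times> vecs n) \<subseteq> phi_word [Hor, Ver, Ver, Hor, Ver, Ver, Ver, Hor, Hor] A"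
        using word unfolding vimg_def by blast
      moreover have "carrier_vec n \<times> carrier_vec n \<subseteq> vimg n (vecs n \<times> vecs n :: ((nat \<Rightarrow> 'p mod_ring) \<times> _) set)"
      proof
        fix q :: "'p mod_ring vec \<times> 'p mod_ring vec" assume "q \<in> carrier_vec n \<times> carrier_vec n"
        then obtain x y where q: "q = (x, y)" "x \<in> carrier_vec n" "y \<in> carrier_vec n" by blast
        then show "q \<in> vimg n (vecs n \<times> vecs n)"
          unfolding vimg_def by (intro image_eqI[of _ _ "(to_fun x, to_fun y)"]) (auto simp: vec_to_fun to_fun_in_vecs)
      qed
      moreover have "bilinear_variety n 0 (carrier_vec n \<times> carrier_vec n :: ('p mod_ring vec \<times> 'p mod_ring vec) set)"
      proof -
        obtain r where "r \<le> 0" "subspace_of_codim n r (vec n ` (vecs n :: (nat \<Rightarrow> 'p mod_ring) set))"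
          using subspace_of_codim_vec_image[of "vecs n :: (nat \<Rightarrow> 'p mod_ring) set" n 0]
          by (auto simp: add_subgroup_vecs card_vecs)
        moreover have "vec n ` (vecs n :: (nat \<Rightarrow> 'p mod_ring) set) = carrier_vec n"
        proof
          show "carrier_vec n \<subseteq> vec n ` (vecs n :: (nat \<Rightarrow> 'p mod_ring) set)"
          proof
            fix v :: "'p mod_ring vec" assume "v \<in> carrier_vec n"
            then show "v \<in> vec n ` vecs n" by (metis image_eqI to_fun_in_vecs vec_to_fun)
          qed
        qed auto
        ultimately have "subspace_of_codim n 0 (carrier_vec n :: 'p mod_ring vec set)" by simp
        then show ?thesis unfolding bilinear_variety_def
          by (intro exI[of _ 0] exI[of _ "carrier_vec n"] exI[of _ "\<lambda>_ _ _. 0"]) auto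
      qed
      moreover have "real 0 \<le> C * ln (1 / density n A) ^ 80" using Cpos by simp
      ultimately show ?thesis by (meson order_trans)
    next
      case False
      have l1: "ln (8 / 7) \<le> l" unfolding l_def
      proof (rule ln_mono)
        show "8 / 7 \<le> 1 / density n A" using False d0 by (simp add: field_simps)
      qed (use d0 in auto)
      have l78: "ln (8 / 7 :: real) > 0" by simp
      have l0: "l > 0" using l1 l78 by linarith
      \<comment> \<open>The binary logarithm of the inverse density, rounded up; base 2 suffices
        since \<open>2 ^ a \<le> p ^ a\<close>.\<close>
      define a where "a = nat \<lceil>l / ln 2\<rceil>"
      have a_ge: "l / ln 2 \<le> a" unfolding a_def by linarith
      have a0: "a > 0" unfolding a_def using l0 by simp
      have a_le: "real a \<le> c * l"
      proof -
        have "0 \<le> l / ln 2" using l0 by simp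
        then have "real a \<le> l / ln 2 + 1" unfolding a_def by linarith
        also have "1 \<le> l / ln (8 / 7)" using l1 l78 by simp
        finally show ?thesis by (simp add: c_def algebra_simps)
      qed
      have "1 / density n A \<le> p ^ a"
      proof -
        have "l \<le> a * ln 2" using a_ge by (simp add: divide_le_eq)
        then have "exp l \<le> exp (a * ln 2)" by simp
        also have "\<dots> = 2 ^ a" by (simp add: exp_of_nat_mult)
        also have "\<dots> \<le> real p ^ a" using p by (intro power_mono) auto
        also have "exp l = 1 / density n A" using d0 by (simp add: l_def)
        finally show ?thesis by simp
      qed
      then have "real (p ^ (2 * n)) \<le> real (card A * p ^ a)"
        using cA by (simp add: dens divide_le_eq mult.commute)
      then have dense: "p ^ (2 * n) \<le> card B * p ^ a" unfolding of_nat_le_iff cB .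
      obtain V W k L where V: "add_subgroup V" "V \<subseteq> vecs n" and W: "add_subgroup W" "W \<subseteq> vecs n"
        and cV: "p ^ n \<le> card V * p ^ (C0 * a ^ 80)" and cW: "p ^ n \<le> card W * p ^ (C0 * a ^ 80)"
        and k: "k \<le> C0 * a ^ 80" and L: "\<forall>i<k. additive (L i) \<and> L i ` vecs n \<subseteq> vecs n"
        and sub: "{(x, y). x \<in> V \<and> y \<in> W \<and> (\<forall>i<k. dot n (L i y) x = 0)}
          \<subseteq> hdiff (vdiff (vdiff (hdiff (vdiff (vdiff (vdiff (hdiff (hdiff B))))))))"
        using C0[THEN spec, THEN spec, THEN spec, THEN mp, THEN mp, THEN mp, OF a0 B dense]
        by (elim exE conjE) (rule that)
      obtain r1 where r1: "r1 \<le> C0 * a ^ 80" "subspace_of_codim n r1 (vec n ` V)"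
        using subspace_of_codim_vec_image[OF V cV[unfolded p_def]] .
      obtain r2 where r2: "r2 \<le> C0 * a ^ 80" "subspace_of_codim n r2 (vec n ` W)"
        using subspace_of_codim_vec_image[OF W cW[unfolded p_def]] .
      define b where "b i x y = dot n (L i (to_fun y)) (to_fun x)" for i x y
      have bil: "bilinear_form n (b i)" if "i < k" for i
      proof -
        have a: "additive (L i)" using L that by blast
        show ?thesis
          unfolding bilinear_form_def b_def
          by (intro conjI ballI allI)
            (simp_all add: to_fun_add to_fun_smult dot_add_right dot_add_left dot_smul_left dot_smul_right
              additive.add[OF a] additive_smul[OF a])
      qed
      define Y where "Y = {(x, y). x \<in> vec n ` V \<and> y \<in> vec n ` W \<and> (\<forall>i < k. b i x y = 0)}"
      have "bilinear_variety n (r1 + r2 + k) Y"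
        unfolding bilinear_variety_def Y_def using r1(2) r2(2) bil by blast
      moreover have "Y \<subseteq> phi_word [Hor, Ver, Ver, Hor, Ver, Ver, Ver, Hor, Hor] A"
      proof (rule order_trans[OF _ word])
        have "Y \<subseteq> vimg n {(x, y). x \<in> V \<and> y \<in> W \<and> (\<forall>i<k. dot n (L i y) x = 0)}"
        proof
          fix q assume "q \<in> Y"
          then obtain x y where q: "q = (vec n x, vec n y)" "x \<in> V" "y \<in> W" "\<forall>i<k. b i (vec n x) (vec n y) = 0"
            by (auto simp: Y_def)
          then have "\<forall>i<k. dot n (L i y) x = 0" using V(2) W(2) by (auto simp: b_def to_fun_vec subset_iff)
          then show "q \<in> vimg n {(x, y). x \<in> V \<and> y \<in> W \<and> (\<forall>i<k. dot n (L i y) x = 0)}"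
            unfolding vimg_def using q by (intro image_eqI[of _ _ "(x, y)"]) auto
        qed
        also have "\<dots> \<subseteq> vimg n (hdiff (vdiff (vdiff (hdiff (vdiff (vdiff (vdiff (hdiff (hdiff B)))))))))"
          unfolding vimg_def using sub by (rule image_mono)
        finally show "Y \<subseteq> vimg n (hdiff (vdiff (vdiff (hdiff (vdiff (vdiff (vdiff (hdiff (hdiff B)))))))))" .
      qed
      moreover have "real (r1 + r2 + k) \<le> C * ln (1 / density n A) ^ 80"
      proof -
        have "r1 + r2 + k \<le> 3 * (C0 * a ^ 80)" using r1(1) r2(1) k by linarith
        then have "real (r1 + r2 + k) \<le> real (3 * (C0 * a ^ 80))" unfolding of_nat_le_iff .
        also have "\<dots> = 3 * real C0 * real a ^ 80" by simp
        also have "\<dots> \<le> 3 * real C0 * (c * l) ^ 80" using a_le by (intro mult_left_mono power_mono) auto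
        also have "\<dots> = C * l ^ 80" by (simp add: C_def power_mult_distrib)
        finally show ?thesis by (simp add: l_def)
      qed
      ultimately show ?thesis by blast
    qed
  qed
qed

end
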